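(* Let $\varepsilon>0$, $T>0$, $U_0>0$, $V_0>0$. The unique weak solution $w$ of the problem $$w_t=\mathcal{D}(w)_{xx}\ \text{ in }Q_T=\mathbb{R}\times(0,T),\qquad w(x,0)=w_0(x):=\begin{cases}U_0,& x<0,\\-V_0,& x>0,\end{cases}$$ has a self-similar form: there exist a function $f:\mathbb{R}\to\mathbb{R}$ and a constant $a\in\mathbb{R}$ such that $w(x,t)=f\left(\frac{x}{\sqrt t}\right)$ for $(x,t)\in Q_T$, and the free boundary is $\beta(t)=a\sqrt t$, $t\in[0,T]$ (that is, $w(x,t)>0$ if $x<\beta(t)$ and $w(x,t)<0$ if $x>\beta(t)$). Writing $\eta=x/\sqrt t$, $f$ satisfies the system $$\begin{aligned} &-\tfrac12\eta f'(\eta)=[\phi'(f(\eta))f'(\eta)]' &&\text{if }\eta<a,\\ &-\tfrac12\eta f'(\eta)=[\varepsilon\phi'(-f(\eta))f'(\eta)]' &&\text{if }\eta>a,\\ &\lim_{\eta\to-\infty}f(\eta)=U_0,\qquad \lim_{\eta\to\infty}f(\eta)=-V_0,\\ &\lim_{\eta\nearrow a}f(\eta)=0=-\lim_{\eta\searrow a}f(\eta),\\ &\lim_{\eta\nearrow a}\phi'(f(\eta))f'(\eta)=\varepsilon\lim_{\eta\searrow a}\phi'(-f(\eta))f'(\eta), \end{aligned}$$ where a prime on $f$ or on a bracket denotes differentiation with respect to $\eta$.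
   Context: $\phi\in C^2(\mathbb{R})$ is such that $\phi$ and $\phi'$ are strictly increasing on $[0,\infty)$, $\phi(s)>0$ for $s>0$, $\phi(0)=\phi'(0)=0$, and $\int_0^1\frac{\phi'(s)}{s}\,ds<\infty$, $\int_1^\infty\frac{\phi'(s)}{s}\,ds=\infty$. The function $\mathcal{D}$ is $\mathcal{D}(s)=\phi(s)$ for $s\ge0$ and $\mathcal{D}(s)=-\varepsilon\phi(-s)$ for $s<0$. Weak solution: a function $w$ is a weak solution if (i) $w\in L^\infty(Q_T)$; (ii) $\mathcal{D}(w)\in\mathcal{D}(\hat w)+L^2(0,T;W^{1,2}(\mathbb{R}))$, where $\hat w\in C^\infty(\mathbb{R})$ is a fixed smooth function of $x$ with $\hat w(x)=U_0$ for $x<-1$ and $\hat w(x)=-V_0$ for $x>1$; (iii) $\int_{\mathbb{R}}w_0(x)\Psi(x,0)\,dx+\iint_{Q_T}w\,\Psi_t\,dx\,dt=\iint_{Q_T}\mathcal{D}(w)_x\,\Psi_x\,dx\,dt$ for all $\Psi\in C^1(\mathbb{R}\times[0,T])$ with $\Psi(\cdot,T)=0$ and $\operatorname{supp}\Psi\subset[-J,J]\times[0,T]$ for some $J>0$. Solutions $f$ of the system are understood classically: $f$ is continuous, $f>0$ on $(-\infty,a)$, $f<0$ on $(a,\infty)$, and $f$ is $C^2$ on $(-\infty,a)$ and on $(a,\infty)$. *)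

theory Defs
  imports "HOL-Analysis.Analysis"
begin

text \<open>To be used for open \<open>S\<close> only, since \<^const>\<open>deriv\<close> is the two-sided derivative.\<close>
definition C2_on :: "real set \<Rightarrow> (real \<Rightarrow> real) \<Rightarrow> bool" where
  "C2_on S f \<longleftrightarrow>
     (\<forall>x\<in>S. f differentiable (at x)) \<and>
     (\<forall>x\<in>S. deriv f differentiable (at x)) \<and>
     continuous_on S (deriv (deriv f))"

definition smooth :: "(real \<Rightarrow> real) \<Rightarrow> bool" where
  "smooth f \<longleftrightarrow> (\<forall>n x. (deriv ^^ n) f differentiable (at x))"

definition locally_integrable :: "(real \<Rightarrow> real) \<Rightarrow> bool" where
  "locally_integrable u \<longleftrightarrow> (\<forall>J. integrable (lebesgue_on {-J..J}) u)"

definition has_weak_deriv :: "(real \<Rightarrow> real) \<Rightarrow> (real \<Rightarrow> real) \<Rightarrow> bool" where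
  "has_weak_deriv u g \<longleftrightarrow>
     locally_integrable u \<and> locally_integrable g \<and>
     (\<forall>\<psi>. smooth \<psi> \<and> (\<exists>J. \<forall>x. \<bar>x\<bar> > J \<longrightarrow> \<psi> x = 0) \<longrightarrow>
        (\<integral>x. u x * deriv \<psi> x \<partial>lebesgue) = - (\<integral>x. g x * \<psi> x \<partial>lebesgue))"

definition L2 :: "(real \<Rightarrow> real) set" where
  "L2 = {u. u \<in> borel_measurable lebesgue \<and> integrable lebesgue (\<lambda>x. (u x)\<^sup>2)}"

text \<open>The Sobolev space \<open>W\<^sup>1\<^sup>,\<^sup>2(\<real>)\<close>. As everywhere below, its elements are represented by
  functions rather than by their classes modulo equality almost everywhere.\<close>
definition W12 :: "(real \<Rightarrow> real) set" where
  "W12 = {u \<in> L2. \<exists>g\<in>L2. has_weak_deriv u g}"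

text \<open>The weak derivative is unique almost everywhere, so the norm does not depend on the choice.\<close>
definition W12_norm :: "(real \<Rightarrow> real) \<Rightarrow> real" where
  "W12_norm u = sqrt ((\<integral>x. (u x)\<^sup>2 \<partial>lebesgue) +
                      (\<integral>x. ((SOME g. has_weak_deriv u g) x)\<^sup>2 \<partial>lebesgue))"

text \<open>The Bochner space \<open>L\<^sup>2(0,T;W\<^sup>1\<^sup>,\<^sup>2(\<real>))\<close>: strongly measurable \<open>V\<close> (an almost everywhere limit,
  in the norm of \<open>W\<^sup>1\<^sup>,\<^sup>2\<close>, of \<open>W\<^sup>1\<^sup>,\<^sup>2\<close>-valued simple functions) with square integrable norm.\<close>
definition L2_W12 :: "real \<Rightarrow> (real \<Rightarrow> real \<Rightarrow> real) set" where
  "L2_W12 T = {V.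
     (\<forall>t\<in>{0<..<T}. V t \<in> W12) \<and>
     (\<exists>s. (\<forall>n. simple_function (lebesgue_on {0<..<T}) (s n) \<and> (\<forall>t\<in>{0<..<T}. s n t \<in> W12)) \<and>
          (AE t in lebesgue_on {0<..<T}. (\<lambda>n. W12_norm (\<lambda>x. s n t x - V t x)) \<longlonglongrightarrow> 0)) \<and>
     integrable (lebesgue_on {0<..<T}) (\<lambda>t. (W12_norm (V t))\<^sup>2)}"

definition QT :: "real \<Rightarrow> (real \<times> real) set" where
  "QT T = UNIV \<times> {0<..<T}"

definition L_infinity :: "(real \<times> real) set \<Rightarrow> (real \<times> real \<Rightarrow> real) set" where
  "L_infinity Q = {w. w \<in> borel_measurable (lebesgue_on Q) \<and>
     (\<exists>M. AE p in lebesgue_on Q. \<bar>w p\<bar> \<le> M)}"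

text \<open>\<open>\<Psi>\<close> is \<open>C\<^sup>1\<close> on the closed strip \<open>\<real> \<times> [0,T]\<close>, with (one-sided in time at \<open>t = 0\<close> and \<open>t = T\<close>)
  partial derivatives \<open>\<Psi>x\<close> and \<open>\<Psi>t\<close>.\<close>
definition C1_strip ::
  "real \<Rightarrow> (real \<times> real \<Rightarrow> real) \<Rightarrow> (real \<times> real \<Rightarrow> real) \<Rightarrow> (real \<times> real \<Rightarrow> real) \<Rightarrow> bool" where
  "C1_strip T \<Psi> \<Psi>x \<Psi>t \<longleftrightarrow>
     (\<forall>p \<in> UNIV \<times> {0..T}.
        (\<Psi> has_derivative (\<lambda>h. \<Psi>x p * fst h + \<Psi>t p * snd h)) (at p within UNIV \<times> {0..T})) \<and>
     continuous_on (UNIV \<times> {0..T}) \<Psi>x \<and> continuous_on (UNIV \<times> {0..T}) \<Psi>t"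

text \<open>Weak solutions of \<open>w\<^sub>t = D(w)\<^sub>x\<^sub>x\<close> in \<open>QT T\<close> with \<open>w(\<cdot>,0) = w0\<close>, where a point of \<open>QT T\<close> is the
  pair \<open>(x,t)\<close>. The function \<open>g\<close> is the weak derivative \<open>D(w)\<^sub>x\<close>; it is determined almost everywhere
  in \<open>QT T\<close> and exists by the second condition.\<close>
definition weak_solution ::
  "(real \<Rightarrow> real) \<Rightarrow> (real \<Rightarrow> real) \<Rightarrow> (real \<Rightarrow> real) \<Rightarrow> real \<Rightarrow> (real \<times> real \<Rightarrow> real) \<Rightarrow> bool" where
  "weak_solution D w0 what T w \<longleftrightarrow>
     w \<in> L_infinity (QT T) \<and>
     (\<exists>V\<in>L2_W12 T. AE p in lebesgue_on (QT T). D (w p) = D (what (fst p)) + V (snd p) (fst p)) \<and>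
     (\<exists>g \<in> borel_measurable (lebesgue_on (QT T)).
        (AE t in lebesgue_on {0<..<T}. has_weak_deriv (\<lambda>x. D (w (x, t))) (\<lambda>x. g (x, t))) \<and>
        (\<forall>\<Psi> \<Psi>x \<Psi>t. C1_strip T \<Psi> \<Psi>x \<Psi>t \<and> (\<forall>x. \<Psi> (x, T) = 0) \<and>
             (\<exists>J>0. \<forall>x. \<forall>t\<in>{0..T}. \<bar>x\<bar> > J \<longrightarrow> \<Psi> (x, t) = 0) \<longrightarrow>
           (\<integral>x. w0 x * \<Psi> (x, 0) \<partial>lebesgue) + (\<integral>p. w p * \<Psi>t p \<partial>lebesgue_on (QT T))
             = (\<integral>p. g p * \<Psi>x p \<partial>lebesgue_on (QT T))))"

definition Dfun :: "(real \<Rightarrow> real) \<Rightarrow> real \<Rightarrow> real \<Rightarrow> real" where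
  "Dfun \<phi> \<epsilon> s = (if s \<ge> 0 then \<phi> s else - \<epsilon> * \<phi> (- s))"

text \<open>The value at \<open>x = 0\<close> is immaterial.\<close>
definition step_data :: "real \<Rightarrow> real \<Rightarrow> real \<Rightarrow> real" where
  "step_data U0 V0 x = (if x < 0 then U0 else - V0)"

definition free_boundary :: "real \<Rightarrow> (real \<times> real \<Rightarrow> real) \<Rightarrow> (real \<Rightarrow> real) \<Rightarrow> bool" where
  "free_boundary T w \<beta> \<longleftrightarrow>
     (\<forall>(x, t)\<in>QT T. (x < \<beta> t \<longrightarrow> w (x, t) > 0) \<and> (x > \<beta> t \<longrightarrow> w (x, t) < 0))"

definition selfsimilar_system ::
  "(real \<Rightarrow> real) \<Rightarrow> real \<Rightarrow> real \<Rightarrow> real \<Rightarrow> (real \<Rightarrow> real) \<Rightarrow> real \<Rightarrow> bool" where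
  "selfsimilar_system \<phi> \<epsilon> U0 V0 f a \<longleftrightarrow>
     continuous_on UNIV f \<and> (\<forall>\<eta><a. f \<eta> > 0) \<and> (\<forall>\<eta>>a. f \<eta> < 0) \<and>
     C2_on {..<a} f \<and> C2_on {a<..} f \<and>
     (\<forall>\<eta><a. ((\<lambda>y. deriv \<phi> (f y) * deriv f y)
        has_real_derivative (- (1/2) * \<eta> * deriv f \<eta>)) (at \<eta>)) \<and>
     (\<forall>\<eta>>a. ((\<lambda>y. \<epsilon> * deriv \<phi> (- f y) * deriv f y)
        has_real_derivative (- (1/2) * \<eta> * deriv f \<eta>)) (at \<eta>)) \<and>
     (f \<longlongrightarrow> U0) at_bot \<and> (f \<longlongrightarrow> - V0) at_top \<and>
     (f \<longlongrightarrow> 0) (at_left a) \<and> (f \<longlongrightarrow> 0) (at_right a) \<and>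
     (\<exists>l r. ((\<lambda>\<eta>. deriv \<phi> (f \<eta>) * deriv f \<eta>) \<longlongrightarrow> l) (at_left a) \<and>
            ((\<lambda>\<eta>. deriv \<phi> (- f \<eta>) * deriv f \<eta>) \<longlongrightarrow> r) (at_right a) \<and>
            l = \<epsilon> * r)"

end

theory Submission
  imports Defs
begin

text \<open>Existence: for a profile \<open>f\<close> with flux \<open>N = - D(f)'\<close> the similarity equation reads
  \<open>2 N' = \<eta> f'\<close>. Taking \<open>s = f\<close> as independent variable, \<open>p(s) = N\<close> satisfies the singular
  two-point problem \<open>2 p p'' = - D'\<close> on \<open>(-V\<^sub>0, U\<^sub>0)\<close> with \<open>p = 0\<close> at both ends, in which the
  interface no longer appears. It is solved by monotone iteration with the Green function of
  \<open>- p''\<close>, for boundary values \<open>\<delta>\<close> that then decrease to \<open>0\<close>. Conversely \<open>\<eta> = 2 p'(s)\<close> is strictly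
  decreasing, because \<open>p\<close> is concave, and covers \<open>\<real>\<close>, so that \<open>f\<close> is its inverse; \<open>a = 2 p'(0)\<close>.

  Uniqueness: let \<open>u\<close> be the difference of two weak solutions and \<open>h\<close> that of their images under
  \<open>D\<close>. Oleinik's test function \<open>\<integral>\<^sub>t\<^sup>T h\<close> gives \<open>\<integral>\<integral> u h \<le> 0\<close>, and \<open>D\<close> is strictly increasing.\<close>

section \<open>A singular two-point boundary value problem\<close>

text \<open>Origin of the equation for p: N = - D'(f) f' and 2 N' = \<eta> f' give p'(f) = \<eta>/2
  when N = p(f); one more derivative gives 2 p''(f) f' = 1, and f' = - p/D' turns this into 2 p p''
  = - D'. The zero of D' at s = 0 makes f' infinite at the interface but only makes p'' vanish
  there, so the flux condition becomes continuity of p. The difficulty moves to the end points,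
  where p = 0: hence the shift by \<delta>, which keeps the right-hand side bounded, and a lower
  bound c s (1 - s) uniform in \<delta>, under which the Green integrals still converge in the
  limit. In the uniqueness proof the time integral of h is not a C^1 test function. Only products of
  a smooth function of x and a C^1 function of t are inserted; they identify the time primitive P of
  h_x as a function with P_x = u, and the energy computation is done for P. A cutoff in x with
  gradient O(1/r) closes it, because P h is integrable.\<close>

text \<open>The solution of \<open>- p'' = h\<close>, \<open>p(0) = p(1) = 0\<close>; \<open>h\<close> may be singular at the end points.\<close>
definition green :: "(real \<Rightarrow> real) \<Rightarrow> real \<Rightarrow> real" where
  "green h s = (1 - s) * integral {0..s} (\<lambda>r. r * h r) + s * integral {s..1} (\<lambda>r. (1 - r) * h r)"

text \<open>Differentiating the limits of integration in \<open>green\<close> contributes (1 - s) s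
  h(s) and - s (1 - s) h(s), which cancel; only the derivatives of the two prefactors
  remain.\<close>

definition green_deriv :: "(real \<Rightarrow> real) \<Rightarrow> real \<Rightarrow> real" where
  "green_deriv h s = integral {s..1} (\<lambda>r. (1 - r) * h r) - integral {0..s} (\<lambda>r. r * h r)"

text \<open>On each interval only the weight that vanishes at the end point it contains is kept.
  This admits h of order 1/(r (1 - r)), which is the growth allowed to m/p once \<delta> has gone to
  0.\<close>

definition green_integrable :: "(real \<Rightarrow> real) \<Rightarrow> bool" where
  "green_integrable h \<longleftrightarrow>
     (\<forall>s\<in>{0<..<1}. (\<lambda>r. r * h r) integrable_on {0..s} \<and> (\<lambda>r. (1 - r) * h r) integrable_on {s..1})"

lemma green_endpoints [simp]: "green h 0 = 0" "green h 1 = 0"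
  by (auto simp: green_def)

lemma green_integrable_continuous:
  assumes "continuous_on {0..1} h"
  shows "green_integrable h"
  unfolding green_integrable_def
  by (auto intro!: integrable_continuous_interval continuous_intros continuous_on_subset[OF assms])

lemma green_mono:
  assumes "green_integrable g" "green_integrable h" "s \<in> {0..1}"
    and le: "\<And>r. r \<in> {0..1} \<Longrightarrow> g r \<le> h r"
  shows "green g s \<le> green h s"
proof (cases "s \<in> {0<..<1}")
  case True
  have "integral {0..s} (\<lambda>r. r * g r) \<le> integral {0..s} (\<lambda>r. r * h r)"
    "integral {s..1} (\<lambda>r. (1 - r) * g r) \<le> integral {s..1} (\<lambda>r. (1 - r) * h r)"
    using assms(1,2) True le
    by (auto simp: green_integrable_def intro!: integral_le mult_left_mono)
  then show ?thesis
    using True unfolding green_def by (intro add_mono mult_left_mono) auto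
next
  case False
  then have "s = 0 \<or> s = 1" using assms(3) by auto
  then show ?thesis by auto
qed

lemma continuous_on_green:
  assumes "green_integrable h"
  shows "continuous_on {0<..<1} (green h)"
proof (rule continuous_at_imp_continuous_on, rule ballI)
  fix s :: real assume s: "s \<in> {0<..<1}"
  \<comment> \<open>Each interval is extended half way to the far end, so that s becomes an interior
    point and one-sided statements become two-sided.\<close>
  have i: "(\<lambda>r. r * h r) integrable_on {0..(s+1)/2}" "(\<lambda>r. (1 - r) * h r) integrable_on {s/2..1}"
    using assms s by (auto simp: green_integrable_def)
  have "isCont (\<lambda>s. integral {0..s} (\<lambda>r. r * h r)) s"
    using indefinite_integral_continuous_1[OF i(1)] s by (auto intro: continuous_on_interior)
  moreover have "isCont (\<lambda>s. integral {s..1} (\<lambda>r. (1 - r) * h r)) s"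
    using indefinite_integral_continuous_1'[OF i(2)] s by (auto intro: continuous_on_interior)
  ultimately show "isCont (green h) s"
    unfolding green_def[abs_def] by (intro continuous_intros)
qed

lemma DERIV_green:
  assumes "green_integrable h" "continuous_on {0<..<1} h" and s: "s \<in> {0<..<1}"
  shows "DERIV (green h) s :> green_deriv h s" "DERIV (green_deriv h) s :> - h s"
proof -
  have i: "(\<lambda>r. r * h r) integrable_on {0..(s+1)/2}" "(\<lambda>r. (1 - r) * h r) integrable_on {s/2..1}"
    using assms(1) s by (auto simp: green_integrable_def)
  have hc: "isCont h s" using assms(2) s by (simp add: continuous_on_eq_continuous_at)
  have k1: "isCont (\<lambda>r. r * h r) s" and k2: "isCont (\<lambda>r. (1 - r) * h r) s"
    by (intro continuous_intros hc)+
  have d1: "DERIV (\<lambda>s. integral {0..s} (\<lambda>r. r * h r)) s :> s * h s"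
  proof -
    have "((\<lambda>s. integral {0..s} (\<lambda>r. r * h r)) has_vector_derivative s * h s) (at s within {0..(s+1)/2})"
      using integral_has_vector_derivative_continuous_at[OF i(1), of s "{}"] s
        continuous_at_imp_continuous_at_within[OF k1] by simp
    moreover have "at s within {0..(s+1)/2} = at s" using s by (intro at_within_interior) auto
    ultimately show ?thesis by (simp add: has_real_derivative_iff_has_vector_derivative)
  qed
  have d2: "DERIV (\<lambda>s. integral {s..1} (\<lambda>r. (1 - r) * h r)) s :> - ((1 - s) * h s)"
  proof -
    let ?k = "\<lambda>r. (1 - r) * h r"
    have "((\<lambda>t. integral {s/2..t} ?k) has_vector_derivative ?k s) (at s within {s/2..1})"
      using integral_has_vector_derivative_continuous_at[OF i(2), of s "{}"] s
        continuous_at_imp_continuous_at_within[OF k2] by simp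
    moreover have "at s within {s/2..1} = at s" using s by (intro at_within_interior) auto
    ultimately have "DERIV (\<lambda>t. integral {s/2..t} ?k) s :> ?k s"
      by (simp add: has_real_derivative_iff_has_vector_derivative)
    then have *: "DERIV (\<lambda>t. integral {s/2..1} ?k - integral {s/2..t} ?k) s :> 0 - ?k s"
      by (intro derivative_intros)
    have eq: "integral {s/2..1} ?k - integral {s/2..t} ?k = integral {t..1} ?k" if "t \<in> {s/2<..<1}" for t
      using Henstock_Kurzweil_Integration.integral_combine[OF _ _ i(2), of t] that by auto
    show ?thesis
      using has_field_derivative_transform_within_open[OF *, of "{s/2<..<1}"] eq s by auto
  qed
  show "DERIV (green h) s :> green_deriv h s"
    unfolding green_def[abs_def] green_deriv_def
    by (rule derivative_eq_intros d1 d2 refl)+ (simp add: algebra_simps)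
  show "DERIV (green_deriv h) s :> - h s"
    unfolding green_deriv_def[abs_def]
    by (rule derivative_eq_intros d1 d2 refl)+ (simp add: algebra_simps)
qed

text \<open>Green's function is min(s,r) (1 - max(s,r)), and this is at least s (1 - s) r (1 - r):
  for r \<le> s because s (1 - r) \<le> 1, for r \<ge> s because (1 - s) r \<le> 1. The bound later
  keeps the solutions away from 0 as \<delta> goes to 0.\<close>

lemma green_lower_bound:
  assumes "continuous_on {0..1} h" "\<And>r. r \<in> {0..1} \<Longrightarrow> 0 \<le> h r" and s: "s \<in> {0..1}"
  shows "s * (1 - s) * integral {0..1} (\<lambda>r. r * (1 - r) * h r) \<le> green h s"
proof -
  let ?k = "\<lambda>r. r * (1 - r) * h r"
  have i: "?k integrable_on {0..1}" "(\<lambda>r. r * h r) integrable_on {0..s}" "(\<lambda>r. (1 - r) * h r) integrable_on {s..1}"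
    "?k integrable_on {0..s}" "?k integrable_on {s..1}"
    using s by (auto intro!: integrable_continuous_interval continuous_intros continuous_on_subset[OF assms(1)])
  have "integral {0..1} ?k = integral {0..s} ?k + integral {s..1} ?k"
    using Henstock_Kurzweil_Integration.integral_combine[OF _ _ i(1), of s] s by auto
  moreover have "(1 - s) * (s * integral {0..s} ?k) \<le> (1 - s) * integral {0..s} (\<lambda>r. r * h r)"
  proof (rule mult_left_mono)
    have "integral {0..s} (\<lambda>r. s * ?k r) \<le> integral {0..s} (\<lambda>r. r * h r)"
    proof (rule integral_le)
      show "(\<lambda>r. s * ?k r) integrable_on {0..s}" using i(4) by (rule integrable_on_mult_right)
      show "s * ?k r \<le> r * h r" if "r \<in> {0..s}" for r
      proof -
        have "s * (1 - r) \<le> 1" using that s by (intro mult_le_one) auto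
        then have "s * (1 - r) * (r * h r) \<le> 1 * (r * h r)"
          using that s assms(2)[of r] by (intro mult_right_mono) auto
        then show ?thesis by (simp add: algebra_simps)
      qed
    qed (use i in auto)
    then show "s * integral {0..s} ?k \<le> integral {0..s} (\<lambda>r. r * h r)" by simp
  qed (use s in auto)
  moreover have "s * ((1 - s) * integral {s..1} ?k) \<le> s * integral {s..1} (\<lambda>r. (1 - r) * h r)"
  proof (rule mult_left_mono)
    have "integral {s..1} (\<lambda>r. (1 - s) * ?k r) \<le> integral {s..1} (\<lambda>r. (1 - r) * h r)"
    proof (rule integral_le)
      show "(\<lambda>r. (1 - s) * ?k r) integrable_on {s..1}" using i(5) by (rule integrable_on_mult_right)
      show "(1 - s) * ?k r \<le> (1 - r) * h r" if "r \<in> {s..1}" for r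
      proof -
        have "(1 - s) * r \<le> 1" using that s by (intro mult_le_one) auto
        then have "(1 - s) * r * ((1 - r) * h r) \<le> 1 * ((1 - r) * h r)"
          using that s assms(2)[of r] by (intro mult_right_mono) auto
        then show ?thesis by (simp add: algebra_simps)
      qed
    qed (use i in auto)
    then show "(1 - s) * integral {s..1} ?k \<le> integral {s..1} (\<lambda>r. (1 - r) * h r)" by simp
  qed (use s in auto)
  ultimately show ?thesis unfolding green_def by (simp add: algebra_simps)
qed

text \<open>With |h| \<le> B/(r (1 - r)), the weight r leaves the constant majorant B/(1 - s) on
  [0,s], and the weight 1 - r leaves B/s on [s,1]. At the end point itself the weight is 0, so it is
  enough to control h inside.\<close>

lemma green_dominated:
  assumes int: "\<And>k. green_integrable (h k)"
    and bd: "\<And>k r. r \<in> {0<..<1} \<Longrightarrow> \<bar>h k r\<bar> * (r * (1 - r)) \<le> B"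
    and lim: "\<And>r. r \<in> {0<..<1} \<Longrightarrow> (\<lambda>k. h k r) \<longlonglongrightarrow> h' r"
  shows "green_integrable h'"
    and "\<And>s. s \<in> {0<..<1} \<Longrightarrow> (\<lambda>k. green (h k) s) \<longlonglongrightarrow> green h' s"
proof -
  have B0: "0 \<le> B" using bd[of "1/2" 0] by (smt (verit) abs_ge_zero greaterThanLessThan_iff mult_nonneg_nonneg field_sum_of_halves)
  have left: "(\<lambda>r. r * h' r) integrable_on {0..s}"
    "(\<lambda>k. integral {0..s} (\<lambda>r. r * h k r)) \<longlonglongrightarrow> integral {0..s} (\<lambda>r. r * h' r)" if s: "s \<in> {0<..<1}" for s
  proof -
    have 1: "(\<lambda>r. r * h k r) integrable_on {0..s}" for k using int s by (auto simp: green_integrable_def)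
    have 2: "norm (r * h k r) \<le> B / (1 - s)" if r: "r \<in> {0..s}" for r k
    proof (cases "r = 0")
      case False
      then have "r \<in> {0<..<1}" using r s by auto
      then have "\<bar>h k r\<bar> * r * (1 - r) \<le> B" using bd[of r k] by (simp add: mult.assoc)
      moreover have "\<bar>h k r\<bar> * r * (1 - s) \<le> \<bar>h k r\<bar> * r * (1 - r)"
        using r by (intro mult_left_mono) auto
      ultimately have "\<bar>h k r\<bar> * r * (1 - s) \<le> B" by linarith
      then show ?thesis using r s by (simp add: field_simps abs_mult)
    qed (use B0 s in auto)
    have 3: "(\<lambda>k. r * h k r) \<longlonglongrightarrow> r * h' r" if r: "r \<in> {0..s}" for r
      by (cases "r = 0") (use lim r s in \<open>auto intro!: tendsto_intros\<close>)
    show "(\<lambda>r. r * h' r) integrable_on {0..s}"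
      by (rule dominated_convergence(1)[OF 1 _ 2 3]) auto
    show "(\<lambda>k. integral {0..s} (\<lambda>r. r * h k r)) \<longlonglongrightarrow> integral {0..s} (\<lambda>r. r * h' r)"
      by (rule dominated_convergence(2)[OF 1 _ 2 3]) auto
  qed
  have right: "(\<lambda>r. (1 - r) * h' r) integrable_on {s..1}"
    "(\<lambda>k. integral {s..1} (\<lambda>r. (1 - r) * h k r)) \<longlonglongrightarrow> integral {s..1} (\<lambda>r. (1 - r) * h' r)" if s: "s \<in> {0<..<1}" for s
  proof -
    have 1: "(\<lambda>r. (1 - r) * h k r) integrable_on {s..1}" for k using int s by (auto simp: green_integrable_def)
    have 2: "norm ((1 - r) * h k r) \<le> B / s" if r: "r \<in> {s..1}" for r k
    proof (cases "r = 1")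
      case False
      then have "r \<in> {0<..<1}" using r s by auto
      then have "\<bar>h k r\<bar> * (1 - r) * r \<le> B" using bd[of r k] by (simp add: mult_ac)
      moreover have "\<bar>h k r\<bar> * (1 - r) * s \<le> \<bar>h k r\<bar> * (1 - r) * r"
        using r by (intro mult_left_mono) auto
      ultimately have "\<bar>h k r\<bar> * (1 - r) * s \<le> B" by linarith
      moreover have "norm ((1 - r) * h k r) = \<bar>h k r\<bar> * (1 - r)" using r by (simp add: abs_mult)
      ultimately show ?thesis using s by (simp add: pos_le_divide_eq)
    qed (use B0 s in auto)
    have 3: "(\<lambda>k. (1 - r) * h k r) \<longlonglongrightarrow> (1 - r) * h' r" if r: "r \<in> {s..1}" for r
      by (cases "r = 1") (use lim r s in \<open>auto intro!: tendsto_intros\<close>)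
    show "(\<lambda>r. (1 - r) * h' r) integrable_on {s..1}"
      by (rule dominated_convergence(1)[OF 1 _ 2 3]) auto
    show "(\<lambda>k. integral {s..1} (\<lambda>r. (1 - r) * h k r)) \<longlonglongrightarrow> integral {s..1} (\<lambda>r. (1 - r) * h' r)"
      by (rule dominated_convergence(2)[OF 1 _ 2 3]) auto
  qed
  show "green_integrable h'" using left(1) right(1) by (simp add: green_integrable_def)
  show "(\<lambda>k. green (h k) s) \<longlonglongrightarrow> green h' s" if "s \<in> {0<..<1}" for s
    unfolding green_def using left(2)[OF that] right(2)[OF that] by (intro tendsto_intros)
qed

text \<open>The quotient \<open>p\<^sub>1 / p\<^sub>2\<close> cannot have an interior maximum above \<open>1\<close>: its derivative is
  the Wronskian over \<open>p\<^sub>2\<^sup>2\<close>, and the Wronskian vanishes there and increases while the quotient is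
  above \<open>1\<close>.\<close>
lemma wronskian_comparison:
  fixes p1 p2 :: "real \<Rightarrow> real"
  assumes c: "continuous_on {0..1} p1" "continuous_on {0..1} p2"
    and pos: "\<And>s. s \<in> {0..1} \<Longrightarrow> p1 s > 0" "\<And>s. s \<in> {0..1} \<Longrightarrow> p2 s > 0"
    and d: "\<And>s. s \<in> {0<..<1} \<Longrightarrow> DERIV p1 s :> q1 s" "\<And>s. s \<in> {0<..<1} \<Longrightarrow> DERIV p2 s :> q2 s"
      "\<And>s. s \<in> {0<..<1} \<Longrightarrow> DERIV q1 s :> r1 s" "\<And>s. s \<in> {0<..<1} \<Longrightarrow> DERIV q2 s :> r2 s"
    and bd: "p1 0 \<le> p2 0" "p1 1 \<le> p2 1"
    and ineq: "\<And>s. s \<in> {0<..<1} \<Longrightarrow> p1 s > p2 s \<Longrightarrow> p1 s * r2 s \<le> p2 s * r1 s"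
    and s: "s \<in> {0..1}"
  shows "p1 s \<le> p2 s"
proof -
  define \<rho> where "\<rho> s = p1 s / p2 s" for s
  define W where "W s = p2 s * q1 s - p1 s * q2 s" for s
  have \<rho>c: "continuous_on {0..1} \<rho>"
    unfolding \<rho>_def using pos(2) by (intro continuous_intros c) force
  have \<rho>d: "DERIV \<rho> s :> W s / (p2 s)\<^sup>2" if "s \<in> {0<..<1}" for s
  proof -
    have "p2 s \<noteq> 0" using pos(2)[of s] that by auto
    then show ?thesis unfolding \<rho>_def[abs_def] W_def
      by (auto intro!: derivative_eq_intros d that simp: power2_eq_square algebra_simps)
  qed
  have Wd: "DERIV W s :> p2 s * r1 s - p1 s * r2 s" if "s \<in> {0<..<1}" for s
    unfolding W_def[abs_def] by (auto intro!: derivative_eq_intros d that simp: algebra_simps)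
  obtain x where x: "x \<in> {0..1}" and mx: "\<And>y. y \<in> {0..1} \<Longrightarrow> \<rho> y \<le> \<rho> x"
    using continuous_attains_sup[OF _ _ \<rho>c] by auto
  have "\<rho> x \<le> 1"
  proof (rule ccontr)
    assume "\<not> \<rho> x \<le> 1"
    then have gt: "\<rho> x > 1" by simp
    have e: "\<rho> 0 \<le> 1" "\<rho> 1 \<le> 1" using bd pos[of 0] pos[of 1] by (auto simp: \<rho>_def)
    with gt have "x \<noteq> 0" "x \<noteq> 1" by auto
    then have x': "x \<in> {0<..<1}" using x by auto
    have "W x / (p2 x)\<^sup>2 = 0"
    proof (rule DERIV_local_max[OF \<rho>d[OF x']])
      show "0 < min x (1 - x)" using x' by auto
      show "\<forall>y. \<bar>x - y\<bar> < min x (1 - x) \<longrightarrow> \<rho> y \<le> \<rho> x"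
      proof (intro allI impI)
        fix y assume "\<bar>x - y\<bar> < min x (1 - x)"
        then have "y \<in> {0..1}" unfolding atLeastAtMost_iff by linarith
        then show "\<rho> y \<le> \<rho> x" by (rule mx)
      qed
    qed
    then have Wx: "W x = 0" using pos(2)[OF x] by simp
    \<comment> \<open>The infimum c of Z is the first point to the right of the maximum at which the
      quotient has come down to 1; Z contains 1 by the boundary condition. On [x,c) the Wronskian
      only grows from 0, so \<rho> does not decrease up to c, contradicting \<rho> c \<le> 1 <
      \<rho> x.\<close>
    define Z where "Z = {y \<in> {x..1}. \<rho> y \<le> 1}"
    have "continuous_on {x..1} \<rho>" by (rule continuous_on_subset[OF \<rho>c]) (use x in auto)
    then have "closed Z" unfolding Z_def
      by (intro continuous_on_closed_Collect_le continuous_on_const closed_atLeastAtMost)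
    moreover have Z1: "1 \<in> Z" "bdd_below Z" using e x by (auto simp: Z_def)
    ultimately have cZ: "Inf Z \<in> Z" by (intro closed_contains_Inf) auto
    define c where "c = Inf Z"
    have c1: "x \<le> c" "c \<le> 1" "\<rho> c \<le> 1" using cZ by (auto simp: Z_def c_def)
    have above: "\<rho> y > 1" if "y \<in> {x..<c}" for y
    proof (rule ccontr)
      assume "\<not> \<rho> y > 1"
      then have "y \<in> Z" using that c1 by (auto simp: Z_def)
      then have "c \<le> y" using Z1(2) unfolding c_def by (rule cInf_lower)
      with that show False by auto
    qed
    have Wnn: "0 \<le> W y" if y: "y \<in> {x..<c}" for y
    proof -
      have "W x \<le> W y"
      proof (rule DERIV_nonneg_imp_nondecreasing[of x y W])
        fix z assume z: "x \<le> z" "z \<le> y"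
        then have z': "z \<in> {0<..<1}" "z \<in> {x..<c}" using x' y c1 by auto
        then have "p1 z > p2 z" using above[of z] pos(2)[of z] by (simp add: \<rho>_def z')
        then show "\<exists>D. DERIV W z :> D \<and> 0 \<le> D" using Wd[OF z'(1)] ineq[OF z'(1)] by (intro exI[of _ "p2 z * r1 z - p1 z * r2 z"]) simp
      qed (use y in auto)
      then show ?thesis using Wx by simp
    qed
    have "\<rho> x \<le> \<rho> c"
    proof (rule DERIV_nonneg_imp_increasing_open[of x c \<rho>])
      fix z assume z: "x < z" "z < c"
      then have "z \<in> {0<..<1}" using x' c1 by auto
      then show "\<exists>D. DERIV \<rho> z :> D \<and> 0 \<le> D" using \<rho>d[of z] Wnn[of z] z by (intro exI[of _ "W z / (p2 z)\<^sup>2"]) simp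
    next
      show "continuous_on {x..c} \<rho>" by (rule continuous_on_subset[OF \<rho>c]) (use c1 x' in auto)
    qed (use c1 in auto)
    then show False using gt c1 by simp
  qed
  then have "\<rho> s \<le> 1" using mx[OF s] by simp
  then show ?thesis using pos(2)[OF s] by (simp add: \<rho>_def)
qed

section \<open>The problem shifted by \<delta> and its limit\<close>

lemma continuous_on_green_closed:
  assumes "continuous_on {0..1} h"
  shows "continuous_on {0..1} (green h)"
  unfolding green_def[abs_def]
  by (intro continuous_intros indefinite_integral_continuous_1 indefinite_integral_continuous_1'
      integrable_continuous_interval assms)

lemma DERIV_cong_open:
  assumes "DERIV f x :> d" "open S" "x \<in> S" "\<And>y. y \<in> S \<Longrightarrow> g y = f y"
  shows "DERIV g x :> (d::real)"
  by (rule has_field_derivative_transform_within_open[OF assms(1-3)]) (simp add: assms(4))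

text \<open>The map \<open>p \<mapsto> \<delta> + green (m / p)\<close> is antitone, so its iterates from the constant \<open>\<delta>\<close> enclose a pair
  \<open>p\<^sub>l \<le> p\<^sub>u\<close> that it exchanges; the comparison lemma shows \<open>p\<^sub>u \<le> p\<^sub>l\<close>.\<close>
lemma bvp_shifted:
  fixes m :: "real \<Rightarrow> real"
  assumes m: "continuous_on {0..1} m" "\<And>s. s \<in> {0..1} \<Longrightarrow> 0 \<le> m s" and \<delta>: "\<delta> > 0"
  obtains p where "continuous_on {0..1} p" "\<And>s. s \<in> {0..1} \<Longrightarrow> \<delta> \<le> p s"
    "\<And>s. s \<in> {0..1} \<Longrightarrow> p s = \<delta> + green (\<lambda>r. m r / p r) s"
proof -
  define A where "A p s = \<delta> + green (\<lambda>r. m r / p r) s" for p s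
  \<comment> \<open>Continuity is asked on the open interval, because the pointwise limits
    \<open>pl\<close> and \<open>pu\<close> get theirs from \<open>continuous_on_green\<close>. The
    end points are recovered by \<open>cont_closed\<close>.\<close>
  define adm where "adm p \<longleftrightarrow> continuous_on {0<..<1} p \<and> green_integrable (\<lambda>r. m r / p r) \<and>
     (\<forall>s\<in>{0..1}. \<delta> \<le> p s)" for p :: "real \<Rightarrow> real"
  obtain M where M: "\<And>r. r \<in> {0..1} \<Longrightarrow> m r \<le> M"
    using continuous_attains_sup[of "{0..1::real}" m] m(1) by fastforce
  have M0: "0 \<le> M" using M[of 0] m(2)[of 0] by simp
  have green_nonneg: "0 \<le> green h s" if "green_integrable h" "s \<in> {0..1}" "\<And>r. r \<in> {0..1} \<Longrightarrow> 0 \<le> h r" for h s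
    using green_mono[of "\<lambda>_. 0" h s] that by (simp add: green_def green_integrable_continuous)
  have quot: "0 \<le> m r / p r" "m r / p r \<le> M / \<delta>" "p r > 0" if "adm p" "r \<in> {0..1}" for p r
  proof -
    have "\<delta> \<le> p r" using that by (auto simp: adm_def)
    then show "0 \<le> m r / p r" "m r / p r \<le> M / \<delta>" "p r > 0"
      using m(2)[OF that(2)] M[OF that(2)] M0 \<delta> by (auto intro!: frac_le)
  qed
  have A_ge: "\<delta> \<le> A p s" if "adm p" "s \<in> {0..1}" for p s
    using green_nonneg[of "\<lambda>r. m r / p r" s] that quot(1)[OF that(1)] by (auto simp: A_def adm_def)
  have A_cont: "continuous_on {0<..<1} (A p)" if "adm p" for p
    using that unfolding A_def[abs_def] adm_def by (intro continuous_intros continuous_on_green) auto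
  have A_anti: "A q s \<le> A p s" if "adm p" "adm q" "s \<in> {0..1}" "\<And>r. r \<in> {0..1} \<Longrightarrow> p r \<le> q r" for p q s
  proof -
    have "green (\<lambda>r. m r / q r) s \<le> green (\<lambda>r. m r / p r) s"
    proof (rule green_mono)
      show "m r / q r \<le> m r / p r" if "r \<in> {0..1}" for r
        using quot(3)[OF \<open>adm p\<close> that] quot(3)[OF \<open>adm q\<close> that] m(2)[OF that]
          \<open>\<And>r. r \<in> {0..1} \<Longrightarrow> p r \<le> q r\<close>[OF that]
        by (intro divide_left_mono) auto
    qed (use that in \<open>auto simp: adm_def\<close>)
    then show ?thesis by (simp add: A_def)
  qed
  have bound_ends: "A p s \<le> \<delta> + green (\<lambda>r. M / \<delta>) s" if "adm p" "s \<in> {0..1}" for p s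
    unfolding A_def using that quot(2)[OF that(1)]
    by (auto simp: adm_def intro!: green_mono green_integrable_continuous)
  have cont_const: "continuous_on {0..1} (\<lambda>s. \<delta> + green (\<lambda>r. M / \<delta>) s)"
    by (intro continuous_intros continuous_on_green_closed)
  \<comment> \<open>At an end point A p is squeezed between \<delta> and \<delta> plus the Green
    potential of the constant M/\<delta>; that potential is continuous up to the boundary and
    vanishes there.\<close>
  have cont_closed: "continuous_on {0..1} (A p)" if "adm p" for p
  proof -
    have "continuous (at s within {0..1}) (A p)" if s: "s \<in> {0..1}" for s
    proof (cases "s \<in> {0<..<1}")
      case True
      then have "isCont (A p) s" using A_cont[OF \<open>adm p\<close>] by (simp add: continuous_on_eq_continuous_at)
      then show ?thesis by (rule continuous_at_imp_continuous_at_within)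
    next
      case False
      then have s': "s = 0 \<or> s = 1" using s by auto
      have "((\<lambda>s. \<delta> + green (\<lambda>r. M / \<delta>) s) \<longlongrightarrow> \<delta> + green (\<lambda>r. M / \<delta>) s) (at s within {0..1})"
        using cont_const s by (auto simp: continuous_on_def)
      then have "((\<lambda>s. \<delta> + green (\<lambda>r. M / \<delta>) s) \<longlongrightarrow> \<delta>) (at s within {0..1})" using s' by auto
      then have "(A p \<longlongrightarrow> \<delta>) (at s within {0..1})"
        by (rule tendsto_sandwich[OF _ _ tendsto_const, rotated 2])
          (auto simp: eventually_at_filter A_ge[OF \<open>adm p\<close>] bound_ends[OF \<open>adm p\<close>])
      moreover have "A p s = \<delta>" using s' by (auto simp: A_def)
      ultimately show ?thesis by (simp add: continuous_within)
    qed
    then show ?thesis by (simp add: continuous_on_eq_continuous_within)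
  qed
  have cont_quot: "continuous_on S (\<lambda>r. m r / p r)"
    if "continuous_on S p" "S \<subseteq> {0..1}" "\<And>s. s \<in> {0..1} \<Longrightarrow> \<delta> \<le> p s" for p S
    using that \<delta> by (intro continuous_on_divide continuous_on_subset[OF m(1)]) force+
  have adm_A: "adm (A p)" if "adm p" for p
    unfolding adm_def using A_ge[OF that] A_cont[OF that] cont_closed[OF that]
    by (auto intro!: green_integrable_continuous cont_quot)
  define a where "a n = (A ^^ n) (\<lambda>_. \<delta>)" for n
  have a_Suc: "a (Suc n) = A (a n)" for n by (simp add: a_def)
  have a0: "a 0 = (\<lambda>_. \<delta>)" by (simp add: a_def)
  have adm_a: "adm (a n)" for n
  proof (induction n)
    case 0
    show ?case using \<delta> by (auto simp: adm_def a0 intro!: green_integrable_continuous continuous_intros m)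
  next
    case (Suc n) then show ?case using adm_A by (simp add: a_Suc)
  qed
  have a_ge: "\<delta> \<le> a n s" if "s \<in> {0..1}" for n s using adm_a[of n] that by (auto simp: adm_def)
  have a_le: "a (Suc n) s \<le> a 1 s" if "s \<in> {0..1}" for n s
    using A_anti[OF adm_a[of 0] adm_a[of n] that] a_ge by (simp add: a_Suc a0)
  \<comment> \<open>The initial iterate \<delta> lies below all others, so a 0 \<le> a 2 and a 3
    \<le> a 1; antitonicity passes these inequalities on to the following indices. Even iterates
    increase and odd ones decrease.\<close>
  have step: "(\<forall>s\<in>{0..1}. a (2*n) s \<le> a (2*n+2) s) \<and> (\<forall>s\<in>{0..1}. a (2*n+3) s \<le> a (2*n+1) s)" for n
  proof (induction n)
    case 0
    have "\<forall>s\<in>{0..1}. a 0 s \<le> a 2 s" using a_ge by (simp add: a0)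
    moreover have "\<forall>s\<in>{0..1}. a 3 s \<le> a 1 s" using a_le[of _ 2] by (simp add: numeral_eq_Suc)
    ultimately show ?case by (simp add: numeral_eq_Suc)
  next
    case (Suc n)
    have e: "\<forall>s\<in>{0..1}. a (2*n+2) s \<le> a (2*n+4) s"
      using A_anti[OF adm_a[of "2*n+3"] adm_a[of "2*n+1"]] Suc a_Suc[of "2*n+1"] a_Suc[of "2*n+3"]
      by (simp add: numeral_eq_Suc)
    have "\<forall>s\<in>{0..1}. a (2*n+5) s \<le> a (2*n+3) s"
      using A_anti[OF adm_a[of "2*n+2"] adm_a[of "2*n+4"]] e a_Suc[of "2*n+2"] a_Suc[of "2*n+4"]
      by (simp add: numeral_eq_Suc)
    with e show ?case by (simp add: algebra_simps numeral_eq_Suc)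
  qed
  have "\<exists>l. (\<lambda>n. a (2*n) s) \<longlonglongrightarrow> l" if s: "s \<in> {0..1}" for s
  proof -
    \<comment> \<open>For n = 0 the iterate is the constant \<delta>, hence the maximum; for n > 0
      the index 2 n is the successor of 2 n - 1.\<close>
    have "a (2*n) s \<le> max \<delta> (a 1 s)" for n
      using a_le[OF s, of "2*n-1"] by (cases n) (auto simp: a0 numeral_eq_Suc le_max_iff_disj)
    moreover have "incseq (\<lambda>n. a (2*n) s)"
      using step s by (intro incseq_SucI) (simp add: numeral_eq_Suc)
    ultimately show ?thesis using incseq_convergent by blast
  qed
  then obtain pl where pl: "\<And>s. s \<in> {0..1} \<Longrightarrow> (\<lambda>n. a (2*n) s) \<longlonglongrightarrow> pl s" by metis
  have "\<exists>l. (\<lambda>n. a (2*n+1) s) \<longlonglongrightarrow> l" if s: "s \<in> {0..1}" for s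
  proof -
    have "decseq (\<lambda>n. a (2*n+1) s)"
      using step s by (intro decseq_SucI) (simp add: numeral_eq_Suc)
    then show ?thesis using a_ge[OF s] decseq_convergent by blast
  qed
  then obtain pu where pu: "\<And>s. s \<in> {0..1} \<Longrightarrow> (\<lambda>n. a (2*n+1) s) \<longlonglongrightarrow> pu s" by metis
  have pl_ge: "\<delta> \<le> pl s" if "s \<in> {0..1}" for s using LIMSEQ_le_const[OF pl[OF that]] a_ge[OF that] by auto
  have pu_ge: "\<delta> \<le> pu s" if "s \<in> {0..1}" for s using LIMSEQ_le_const[OF pu[OF that]] a_ge[OF that] by auto
  have lim: "green_integrable (\<lambda>r. m r / q' r)"
    "\<And>s. s \<in> {0..1} \<Longrightarrow> (\<lambda>n. A (q n) s) \<longlonglongrightarrow> A q' s"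
    if q: "\<And>n. adm (q n)" "\<And>s. s \<in> {0..1} \<Longrightarrow> (\<lambda>n. q n s) \<longlonglongrightarrow> q' s" for q q'
  proof -
    have q'_ge: "\<delta> \<le> q' s" if "s \<in> {0..1}" for s
      using LIMSEQ_le_const[OF q(2)[OF that]] q(1) that by (auto simp: adm_def)
    have 1: "green_integrable (\<lambda>r. m r / q n r)" for n using q(1) by (simp add: adm_def)
    have 2: "\<bar>m r / q n r\<bar> * (r * (1 - r)) \<le> M / \<delta>" if "r \<in> {0<..<1}" for r n
    proof -
      have "\<bar>m r / q n r\<bar> \<le> M / \<delta>" using quot(1,2)[OF q(1), of r n] that by auto
      moreover have "r * (1 - r) \<le> 1" using that by (intro mult_le_one) auto
      ultimately have "\<bar>m r / q n r\<bar> * (r * (1 - r)) \<le> (M / \<delta>) * 1"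
        using that M0 \<delta> by (intro mult_mono) auto
      then show ?thesis by simp
    qed
    have 3: "(\<lambda>n. m r / q n r) \<longlonglongrightarrow> m r / q' r" if "r \<in> {0<..<1}" for r
      using q(2)[of r] q'_ge[of r] that \<delta> by (intro tendsto_intros) auto
    show "green_integrable (\<lambda>r. m r / q' r)" by (rule green_dominated(1)[OF 1 2 3])
    show "(\<lambda>n. A (q n) s) \<longlonglongrightarrow> A q' s" if "s \<in> {0..1}" for s
    proof (cases "s \<in> {0<..<1}")
      case True
      then show ?thesis unfolding A_def by (intro tendsto_intros green_dominated(2)[OF 1 2 3])
    next
      case False
      then have "s = 0 \<or> s = 1" using that by auto
      then show ?thesis by (auto simp: A_def)
    qed
  qed
  have pu_eq: "pu s = A pl s" if "s \<in> {0..1}" for s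
    using LIMSEQ_unique[OF pu[OF that]] lim(2)[OF adm_a pl that] by (simp add: a_Suc)
  have pl_eq: "pl s = A pu s" if "s \<in> {0..1}" for s
    using LIMSEQ_unique[OF LIMSEQ_Suc[OF pl[OF that]]] lim(2)[OF adm_a pu that] by (simp add: a_Suc)
  have gi: "green_integrable (\<lambda>r. m r / pl r)" "green_integrable (\<lambda>r. m r / pu r)"
    using lim(1)[OF adm_a pl] lim(1)[OF adm_a pu] by auto
  have c0: "continuous_on {0<..<1} pl" "continuous_on {0<..<1} pu"
  proof -
    have "continuous_on {0<..<1} (A pu)" "continuous_on {0<..<1} (A pl)"
      unfolding A_def[abs_def] by (intro continuous_intros continuous_on_green gi)+
    moreover have "continuous_on {0<..<1} pl = continuous_on {0<..<1} (A pu)"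
      by (rule continuous_on_cong[OF refl pl_eq]) simp
    moreover have "continuous_on {0<..<1} pu = continuous_on {0<..<1} (A pl)"
      by (rule continuous_on_cong[OF refl pu_eq]) simp
    ultimately show "continuous_on {0<..<1} pl" "continuous_on {0<..<1} pu" by simp_all
  qed
  have adm: "adm pl" "adm pu" using c0 gi pl_ge pu_ge by (auto simp: adm_def)
  have c: "continuous_on {0..1} pl" "continuous_on {0..1} pu"
    by (rule continuous_on_cong[OF refl pl_eq, THEN iffD2, OF _ cont_closed[OF adm(2)]], assumption)
      (rule continuous_on_cong[OF refl pu_eq, THEN iffD2, OF _ cont_closed[OF adm(1)]], assumption)
  have hc: "continuous_on {0<..<1} (\<lambda>r. m r / pl r)" "continuous_on {0<..<1} (\<lambda>r. m r / pu r)"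
    using c0 pl_ge pu_ge by (auto intro!: cont_quot)
  have dpl: "DERIV pl s :> green_deriv (\<lambda>r. m r / pu r) s" if "s \<in> {0<..<1}" for s
  proof -
    have "DERIV (A pu) s :> 0 + green_deriv (\<lambda>r. m r / pu r) s"
      unfolding A_def[abs_def] by (intro derivative_intros DERIV_green gi hc that)
    then have "DERIV (A pu) s :> green_deriv (\<lambda>r. m r / pu r) s" by simp
    then show ?thesis
      by (rule DERIV_cong_open[OF _ open_greaterThanLessThan that]) (rule pl_eq, simp)
  qed
  have dpu: "DERIV pu s :> green_deriv (\<lambda>r. m r / pl r) s" if "s \<in> {0<..<1}" for s
  proof -
    have "DERIV (A pl) s :> 0 + green_deriv (\<lambda>r. m r / pl r) s"
      unfolding A_def[abs_def] by (intro derivative_intros DERIV_green gi hc that)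
    then have "DERIV (A pl) s :> green_deriv (\<lambda>r. m r / pl r) s" by simp
    then show ?thesis
      by (rule DERIV_cong_open[OF _ open_greaterThanLessThan that]) (rule pu_eq, simp)
  qed
  have ends: "pl 0 = \<delta>" "pl 1 = \<delta>" "pu 0 = \<delta>" "pu 1 = \<delta>"
    using pl_eq[of 0] pl_eq[of 1] pu_eq[of 0] pu_eq[of 1] by (auto simp: A_def)
  have pos: "pl s > 0" "pu s > 0" if "s \<in> {0..1}" for s using pl_ge[OF that] pu_ge[OF that] \<delta> by auto
  \<comment> \<open>The second derivatives of \<open>pl\<close> and \<open>pu\<close> are -
    m/\<open>pu\<close> and - m/\<open>pl\<close>, so each function times the second derivative of
    the other is - m. The inequality asked of the Wronskian thus holds with equality, and the
    comparison applies in both directions.\<close>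
  have ratio: "pl r * - (m r / pl r) \<le> pu r * - (m r / pu r)" "pu r * - (m r / pu r) \<le> pl r * - (m r / pl r)"
    if "r \<in> {0<..<1}" for r using pos[of r] that by auto
  have le: "pl s \<le> pu s" if "s \<in> {0..1}" for s
    by (rule wronskian_comparison[OF c(1) c(2) pos(1) pos(2) dpl dpu
          DERIV_green(2)[OF gi(2) hc(2)] DERIV_green(2)[OF gi(1) hc(1)] _ _ _ that])
      (use ends pos ratio in \<open>simp_all\<close>)
  have ge: "pu s \<le> pl s" if "s \<in> {0..1}" for s
    by (rule wronskian_comparison[OF c(2) c(1) pos(2) pos(1) dpu dpl
          DERIV_green(2)[OF gi(1) hc(1)] DERIV_green(2)[OF gi(2) hc(2)] _ _ _ that])
      (use ends pos ratio in \<open>simp_all\<close>)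
  have "pu s = pl s" if "s \<in> {0..1}" for s using le[OF that] ge[OF that] by simp
  then have "green (\<lambda>r. m r / pu r) s = green (\<lambda>r. m r / pl r) s" if "s \<in> {0..1}" for s
    using that unfolding green_def by (intro arg_cong2[where f="(+)"] arg_cong2[where f="(*)"] integral_cong refl) auto
  then show ?thesis using that[OF c(1) pl_ge] pl_eq by (auto simp: A_def)
qed

text \<open>The solutions P \<delta> decrease as \<delta> decreases, again by comparison, and along
  the sequence chosen they stay above c s (1 - s) with one constant c. Hence m/P \<delta> \<le>
  (M/c)/(s (1 - s)), which is the majorant that \<open>green_dominated\<close> asks for. A single
  point with m > 0 makes c positive.\<close>

lemma bvp_unit_interval:
  fixes m :: "real \<Rightarrow> real"
  assumes m: "continuous_on {0..1} m" "\<And>s. s \<in> {0..1} \<Longrightarrow> 0 \<le> m s" and s0: "s0 \<in> {0<..<1}" "m s0 > 0"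
  obtains p q where "\<And>s. s \<in> {0<..<1} \<Longrightarrow> p s > 0"
    "\<And>s. s \<in> {0<..<1} \<Longrightarrow> DERIV p s :> q s"
    "\<And>s. s \<in> {0<..<1} \<Longrightarrow> DERIV q s :> - m s / p s"
    "(p \<longlongrightarrow> 0) (at_right 0)" "(p \<longlongrightarrow> 0) (at_left 1)"
proof -
  obtain M where M: "\<And>r. r \<in> {0..1} \<Longrightarrow> m r \<le> M"
    using continuous_attains_sup[of "{0..1::real}" m] m(1) by fastforce
  have "\<forall>\<delta>\<in>{0<..}. \<exists>p. continuous_on {0..1} p \<and> (\<forall>s\<in>{0..1}. \<delta> \<le> p s) \<and>
      (\<forall>s\<in>{0..1}. p s = \<delta> + green (\<lambda>r. m r / p r) s)"
  proof
    fix \<delta> :: real assume "\<delta> \<in> {0<..}"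
    then have "\<delta> > 0" by simp
    then obtain p where "continuous_on {0..1} p" "\<And>s. s \<in> {0..1} \<Longrightarrow> \<delta> \<le> p s"
      "\<And>s. s \<in> {0..1} \<Longrightarrow> p s = \<delta> + green (\<lambda>r. m r / p r) s" using bvp_shifted[OF m] by blast
    then show "\<exists>p. continuous_on {0..1} p \<and> (\<forall>s\<in>{0..1}. \<delta> \<le> p s) \<and>
      (\<forall>s\<in>{0..1}. p s = \<delta> + green (\<lambda>r. m r / p r) s)" by (intro exI conjI ballI)
  qed
  from bchoice[OF this] obtain P where PP: "\<forall>\<delta>\<in>{0<..}. continuous_on {0..1} (P \<delta>) \<and> (\<forall>s\<in>{0..1}. \<delta> \<le> P \<delta> s) \<and>
      (\<forall>s\<in>{0..1}. P \<delta> s = \<delta> + green (\<lambda>r. m r / P \<delta> r) s)" by (elim exE)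
  have P: "continuous_on {0..1} (P \<delta>)"
    "s \<in> {0..1} \<Longrightarrow> \<delta> \<le> P \<delta> s"
    "s \<in> {0..1} \<Longrightarrow> P \<delta> s = \<delta> + green (\<lambda>r. m r / P \<delta> r) s" if "\<delta> > 0" for \<delta> s
    using bspec[OF PP, of \<delta>] that by blast+
  have Ppos: "P \<delta> s > 0" if "\<delta> > 0" "s \<in> {0..1}" for \<delta> s using P(2)[OF that] that by simp
  have hc: "continuous_on {0..1} (\<lambda>r. m r / P \<delta> r)" if "\<delta> > 0" for \<delta>
    using Ppos[OF that] by (intro continuous_on_divide m P that) force
  then have gi: "green_integrable (\<lambda>r. m r / P \<delta> r)" if "\<delta> > 0" for \<delta>
    using that by (intro green_integrable_continuous)
  have hc': "continuous_on {0<..<1} (\<lambda>r. m r / P \<delta> r)" if "\<delta> > 0" for \<delta>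
    by (rule continuous_on_subset[OF hc[OF that]]) auto
  have dP: "DERIV (P \<delta>) s :> green_deriv (\<lambda>r. m r / P \<delta> r) s" if "\<delta> > 0" "s \<in> {0<..<1}" for s \<delta>
  proof -
    have "DERIV (\<lambda>s. \<delta> + green (\<lambda>r. m r / P \<delta> r) s) s :> 0 + green_deriv (\<lambda>r. m r / P \<delta> r) s"
      by (intro derivative_intros DERIV_green gi hc' that)
    then have "DERIV (\<lambda>s. \<delta> + green (\<lambda>r. m r / P \<delta> r) s) s :> green_deriv (\<lambda>r. m r / P \<delta> r) s"
      by simp
    then show ?thesis
    proof (rule DERIV_cong_open[OF _ open_greaterThanLessThan that(2)])
      show "P \<delta> y = \<delta> + green (\<lambda>r. m r / P \<delta> r) y" if "y \<in> {0<..<1}" for y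
        by (rule P(3)[OF \<open>\<delta> > 0\<close>]) (use that in auto)
    qed
  qed
  have mono: "P \<delta>1 s \<le> P \<delta>2 s" if "0 < \<delta>1" "\<delta>1 \<le> \<delta>2" and s: "s \<in> {0..1}" for \<delta>1 \<delta>2 s
  proof (rule wronskian_comparison[OF P(1) P(1) Ppos Ppos dP dP
          DERIV_green(2)[OF gi hc'] DERIV_green(2)[OF gi hc'] _ _ _ s])
    show "P \<delta>1 0 \<le> P \<delta>2 0" "P \<delta>1 1 \<le> P \<delta>2 1"
      using P(3)[of \<delta>1 0] P(3)[of \<delta>1 1] P(3)[of \<delta>2 0] P(3)[of \<delta>2 1] that by auto
    fix r :: real assume r: "r \<in> {0<..<1}" "P \<delta>1 r > P \<delta>2 r"
    have p: "0 < P \<delta>1 r" "0 < P \<delta>2 r" using Ppos[of _ r] that r by auto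
    \<comment> \<open>Where P \<delta>1 exceeds P \<delta>2, the ratio P \<delta>2 / P \<delta>1 is
      below 1 and its inverse above; with m \<ge> 0 this is the Wronskian inequality for p'' = -
      m/p.\<close>
    have "m r * (P \<delta>2 r / P \<delta>1 r) \<le> m r * (P \<delta>1 r / P \<delta>2 r)"
    proof (rule mult_left_mono)
      have "P \<delta>2 r / P \<delta>1 r \<le> 1" "1 \<le> P \<delta>1 r / P \<delta>2 r" using p r by auto
      then show "P \<delta>2 r / P \<delta>1 r \<le> P \<delta>1 r / P \<delta>2 r" by linarith
    qed (use m(2)[of r] r in auto)
    then show "P \<delta>1 r * - (m r / P \<delta>2 r) \<le> P \<delta>2 r * - (m r / P \<delta>1 r)"
      by (simp add: algebra_simps)
  qed (use that in auto)
  define \<delta> where "\<delta> n = 1 / real (Suc n)" for n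
  have \<delta>: "\<delta> n > 0" "\<delta> n \<le> 1" "\<delta> (Suc n) \<le> \<delta> n" for n by (auto simp: \<delta>_def field_simps)
  obtain B where B: "\<And>r. r \<in> {0..1} \<Longrightarrow> P 1 r \<le> B"
    using continuous_attains_sup[of "{0..1::real}" "P 1"] P(1)[of 1] by fastforce
  have B0: "B > 0" using B[of 0] Ppos[of 1 0] by simp
  \<comment> \<open>P (\<delta> n) \<le> P 1 \<le> B, so m/P (\<delta> n) \<ge> m/B, and
    \<open>green_lower_bound\<close> applied to m/B produces exactly this constant.\<close>
  define c where "c = integral {0..1} (\<lambda>r. r * (1 - r) * (m r / B))"
  have "c > 0"
  proof -
    have cc: "continuous_on {0..1} (\<lambda>r. r * (1 - r) * (m r / B))"
      using B0 by (intro continuous_intros m) auto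
    have "c \<ge> 0" unfolding c_def using B0 m(2)
      by (intro integral_nonneg integrable_continuous_interval cc) auto
    moreover have "c \<noteq> 0"
    proof
      assume "c = 0"
      then have "((\<lambda>r. r * (1 - r) * (m r / B)) has_integral 0) {0..1}"
        using integrable_continuous_interval[OF cc] unfolding c_def by (metis integrable_integral)
      then have "s0 * (1 - s0) * (m s0 / B) = 0"
        using has_integral_0_cbox_imp_0[of 0 1 "\<lambda>r. r * (1 - r) * (m r / B)" s0] cc m(2) B0 s0 by auto
      then show False using s0 B0 by auto
    qed
    ultimately show ?thesis by simp
  qed
  have lower: "c * (s * (1 - s)) \<le> P (\<delta> n) s" if s: "s \<in> {0..1}" for s n
  proof -
    have mB: "continuous_on {0..1} (\<lambda>r. m r / B)" using B0 by (intro continuous_intros m) auto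
    have "c * (s * (1 - s)) \<le> green (\<lambda>r. m r / B) s"
      using green_lower_bound[OF mB _ s] m(2) B0 by (simp add: c_def mult_ac)
    also have "\<dots> \<le> green (\<lambda>r. m r / P (\<delta> n) r) s"
    proof (rule green_mono[OF green_integrable_continuous[OF mB] gi[OF \<delta>(1)] s])
      fix r :: real assume r: "r \<in> {0..1}"
      have "P (\<delta> n) r \<le> B" using mono[of "\<delta> n" 1 r] B[OF r] \<delta>[of n] r by auto
      then show "m r / B \<le> m r / P (\<delta> n) r"
        using m(2)[OF r] Ppos[OF \<delta>(1) r, of n] B0 by (intro divide_left_mono) auto
    qed
    also have "\<dots> \<le> P (\<delta> n) s" using P(3)[OF \<delta>(1) s, of n] \<delta>(1)[of n] by simp
    finally show ?thesis .
  qed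
  have "\<exists>l. (\<lambda>n. P (\<delta> n) s) \<longlonglongrightarrow> l \<and> (\<forall>n. l \<le> P (\<delta> n) s)" if s: "s \<in> {0..1}" for s
  proof -
    have "decseq (\<lambda>n. P (\<delta> n) s)" using mono[OF \<delta>(1) \<delta>(3) s] by (intro decseq_SucI)
    then show ?thesis using lower[OF s] decseq_convergent by blast
  qed
  then obtain p where p: "\<And>s. s \<in> {0..1} \<Longrightarrow> (\<lambda>n. P (\<delta> n) s) \<longlonglongrightarrow> p s"
    and p_le: "\<And>s n. s \<in> {0..1} \<Longrightarrow> p s \<le> P (\<delta> n) s" by metis
  have p_ge: "c * (s * (1 - s)) \<le> p s" if "s \<in> {0..1}" for s
    using LIMSEQ_le_const[OF p[OF that]] lower[OF that] by auto
  have ppos: "p s > 0" if "s \<in> {0<..<1}" for s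
  proof -
    have "0 < c * (s * (1 - s))" using that \<open>c > 0\<close> by auto
    then show ?thesis using p_ge[of s] that by auto
  qed
  have 2: "\<bar>m r / P (\<delta> n) r\<bar> * (r * (1 - r)) \<le> M / c" if r: "r \<in> {0<..<1}" for n r
  proof -
    have q: "0 < P (\<delta> n) r" "0 \<le> m r" "m r \<le> M" "c * (r * (1 - r)) \<le> P (\<delta> n) r"
      using Ppos[OF \<delta>(1), of r n] m(2)[of r] M[of r] lower[of r n] r by auto
    have "m r * (c * (r * (1 - r))) \<le> M * P (\<delta> n) r"
      using q r \<open>c > 0\<close> by (intro mult_mono) auto
    then show ?thesis using q \<open>c > 0\<close> by (simp add: field_simps)
  qed
  have 3: "(\<lambda>n. m r / P (\<delta> n) r) \<longlonglongrightarrow> m r / p r" if "r \<in> {0<..<1}" for r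
    using p[of r] ppos[OF that] that by (intro tendsto_intros) auto
  have gip: "green_integrable (\<lambda>r. m r / p r)" by (rule green_dominated(1)[OF gi[OF \<delta>(1)] 2 3])
  have p_eq: "p s = green (\<lambda>r. m r / p r) s" if s: "s \<in> {0<..<1}" for s
  proof (rule LIMSEQ_unique[OF p])
    have "(\<lambda>n. \<delta> n + green (\<lambda>r. m r / P (\<delta> n) r) s) \<longlonglongrightarrow> 0 + green (\<lambda>r. m r / p r) s"
      unfolding \<delta>_def
      by (intro tendsto_add LIMSEQ_inverse_real_of_nat[unfolded inverse_eq_divide]
          green_dominated(2)[OF gi[OF \<delta>(1)] 2 3, unfolded \<delta>_def] s)
    then show "(\<lambda>n. P (\<delta> n) s) \<longlonglongrightarrow> green (\<lambda>r. m r / p r) s"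
      by (subst P(3)[OF \<delta>(1)]) (use s in auto)
  qed (use s in auto)
  have pc: "continuous_on {0<..<1} p"
    by (rule continuous_on_cong[OF refl p_eq, THEN iffD2, OF _ continuous_on_green[OF gip]])
  have mpc: "continuous_on {0<..<1} (\<lambda>r. m r / p r)"
    using ppos by (intro continuous_on_divide pc continuous_on_subset[OF m(1)]) force+
  have dp: "DERIV p s :> green_deriv (\<lambda>r. m r / p r) s" if "s \<in> {0<..<1}" for s
    by (rule DERIV_cong_open[OF DERIV_green(1)[OF gip mpc that] open_greaterThanLessThan that p_eq])
  have lim0: "(p \<longlongrightarrow> 0) (at x within {0<..<1})" if x: "x = 0 \<or> x = 1" for x
  proof (rule order_tendstoI)
    fix e :: real assume "0 > e"
    then show "\<forall>\<^sub>F s in at x within {0<..<1}. e < p s"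
      unfolding eventually_at_filter by (intro always_eventually) (use ppos in force)
  next
    \<comment> \<open>The limit p lies below every P (\<delta> n), whose boundary value \<delta> n
      can be taken smaller than e.\<close>
    fix e :: real assume "0 < e"
    then obtain n where n: "\<delta> n < e" unfolding \<delta>_def using nat_approx_posE by metis
    have "(P (\<delta> n) \<longlongrightarrow> P (\<delta> n) x) (at x within {0<..<1})"
      by (rule tendsto_within_subset[of _ _ _ "{0..1}"])
        (use P(1)[OF \<delta>(1)] x in \<open>auto simp: continuous_on_def\<close>)
    moreover have "P (\<delta> n) x = \<delta> n" using P(3)[OF \<delta>(1), of x n] x by auto
    ultimately have "\<forall>\<^sub>F s in at x within {0<..<1}. P (\<delta> n) s < e" using n by (auto dest: order_tendstoD)
    moreover have "\<forall>\<^sub>F s in at x within {0<..<1}. p s \<le> P (\<delta> n) s"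
      unfolding eventually_at_filter by (intro always_eventually) (use p_le in auto)
    ultimately show "\<forall>\<^sub>F s in at x within {0<..<1}. p s < e" by eventually_elim auto
  qed
  have at: "at_right (0::real) = at 0 within {0<..<1}" "at_left (1::real) = at 1 within {0<..<1}"
    by (auto intro: at_within_nhd[where S="{-1<..<1}"] at_within_nhd[where S="{0<..<2}"])
  show ?thesis
    by (rule that[OF ppos dp]) (use DERIV_green(2)[OF gip mpc] lim0 in \<open>auto simp: at\<close>)
qed

lemma singular_bvp:
  fixes m :: "real \<Rightarrow> real"
  assumes lu: "l < u" and m: "continuous_on {l..u} m" "\<And>s. s \<in> {l..u} \<Longrightarrow> 0 \<le> m s"
    and s0: "s0 \<in> {l<..<u}" "m s0 > 0"
  obtains p q where "\<And>s. s \<in> {l<..<u} \<Longrightarrow> p s > 0"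
    "\<And>s. s \<in> {l<..<u} \<Longrightarrow> DERIV p s :> q s"
    "\<And>s. s \<in> {l<..<u} \<Longrightarrow> DERIV q s :> - m s / p s"
    "(p \<longlongrightarrow> 0) (at_right l)" "(p \<longlongrightarrow> 0) (at_left u)"
proof -
  define L where "L = u - l"
  have L: "L > 0" using lu by (simp add: L_def)
  define y where "y s = (s - l) / L" for s
  have ly: "l + L * y s = s" for s using L by (simp add: y_def)
  have yin: "y s \<in> {0<..<1}" if "s \<in> {l<..<u}" for s using that L by (auto simp: y_def field_simps L_def)
  have lin: "l + L * r \<in> {l..u}" if "r \<in> {0..1}" for r
  proof -
    have "L * r \<le> L * 1" using that L by (intro mult_left_mono) auto
    moreover have "0 \<le> L * r" using that L by auto
    ultimately show ?thesis using L_def by auto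
  qed
  \<comment> \<open>Every derivative with respect to s = l + L y brings a factor 1/L; the factor L^2
    on the right compensates for both.\<close>
  obtain p q where pq: "\<And>s. s \<in> {0<..<1} \<Longrightarrow> p s > 0"
    "\<And>s. s \<in> {0<..<1} \<Longrightarrow> DERIV p s :> q s"
    "\<And>s. s \<in> {0<..<1} \<Longrightarrow> DERIV q s :> - (L\<^sup>2 * m (l + L * s)) / p s"
    "(p \<longlongrightarrow> 0) (at_right 0)" "(p \<longlongrightarrow> 0) (at_left 1)"
  proof -
    have 1: "continuous_on {0..1} (\<lambda>s. L\<^sup>2 * m (l + L * s))"
      by (intro continuous_intros continuous_on_compose2[OF m(1)]) (use lin in auto)
    have 2: "0 \<le> L\<^sup>2 * m (l + L * s)" if "s \<in> {0..1}" for s using m(2)[OF lin[OF that]] by auto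
    have 3: "y s0 \<in> {0<..<1}" using yin s0 by auto
    have 4: "0 < L\<^sup>2 * m (l + L * y s0)" using s0 L by (simp add: ly)
    show thesis by (rule bvp_unit_interval[OF 1 2 3 4]) (assumption | rule that)+
  qed
  have yd: "DERIV y s :> 1 / L" for s unfolding y_def[abs_def] using L by (auto intro!: derivative_eq_intros)
  show ?thesis
  proof (rule that[of "\<lambda>s. p (y s)" "\<lambda>s. q (y s) / L"])
    fix s assume s: "s \<in> {l<..<u}"
    show "p (y s) > 0" using pq(1) yin s by auto
    show "DERIV (\<lambda>s. p (y s)) s :> q (y s) / L"
      using DERIV_chain2[OF pq(2)[OF yin[OF s]] yd] by simp
    show "DERIV (\<lambda>s. q (y s) / L) s :> - m s / p (y s)"
      using DERIV_cdivide[OF DERIV_chain2[OF pq(3)[OF yin[OF s]] yd], of L] L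
      by (simp add: ly power2_eq_square)
  next
    have "filterlim y (at_right 0) (at_right l)"
    unfolding filterlim_at
    proof (rule conjI[rotated])
      have "(y \<longlongrightarrow> y l) (at l)" using yd by (intro isContD DERIV_isCont)
      then show "(y \<longlongrightarrow> 0) (at_right l)" by (simp add: y_def filterlim_at_split)
    next
      show "\<forall>\<^sub>F s in at_right l. y s \<in> {0<..} \<and> y s \<noteq> 0"
        using L by (auto simp: y_def eventually_at_filter)
    qed
    then show "((\<lambda>s. p (y s)) \<longlongrightarrow> 0) (at_right l)" using pq(4) by (rule filterlim_compose[rotated])
    have "filterlim y (at_left 1) (at_left u)"
    unfolding filterlim_at
    proof (rule conjI[rotated])
      have "(y \<longlongrightarrow> y u) (at u)" using yd by (intro isContD DERIV_isCont)
      then show "(y \<longlongrightarrow> 1) (at_left u)" using L by (simp add: y_def L_def filterlim_at_split)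
    next
      show "\<forall>\<^sub>F s in at_left u. y s \<in> {..<1} \<and> y s \<noteq> 1"
        using L by (auto simp: y_def L_def eventually_at_filter field_simps)
    qed
    then show "((\<lambda>s. p (y s)) \<longlongrightarrow> 0) (at_left u)" using pq(5) by (rule filterlim_compose[rotated])
  qed
qed

section \<open>The similarity profile\<close>

text \<open>The fundamental theorem of calculus tolerates one exceptional point, so f is a primitive
  of the continuous g near a. This carries identities across points where they are known on either
  side only: the interface, where the slope of f is infinite, and the junctions at 0 of
  \<open>Dfun\<close> and \<open>flat\<close>.\<close>

lemma DERIV_removable_point:
  fixes f g :: "real \<Rightarrow> real"
  assumes d: "\<And>x. x \<noteq> a \<Longrightarrow> DERIV f x :> g x" and f: "isCont f a" and g: "\<And>x. isCont g x"
  shows "DERIV f x :> g x"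
proof (cases "x = a")
  case True
  have "isCont f x" for x using f DERIV_isCont[OF d] by (cases "x = a") auto
  then have fc: "continuous_on S f" for S by (simp add: continuous_at_imp_continuous_on)
  have gc: "continuous_on S g" for S using g by (simp add: continuous_at_imp_continuous_on)
  have "(g has_integral (f y - f (a - 1))) {a-1..y}" if "a - 1 \<le> y" for y
    by (rule fundamental_theorem_of_calculus_interior_strong[of "{a}"])
      (use that d fc in \<open>auto simp: has_real_derivative_iff_has_vector_derivative[symmetric]\<close>)
  then have eq: "f y = f (a - 1) + integral {a-1..y} g" if "a - 1 \<le> y" for y
    using integral_unique[of g "f y - f (a - 1)" "{a-1..y}"] that by simp
  have "((\<lambda>y. integral {a-1..y} g) has_real_derivative g a) (at a within {a-1..a+1})"
    by (rule integral_has_real_derivative[OF gc]) auto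
  moreover have "at a within {a-1..a+1} = at a" by (intro at_within_interior) auto
  ultimately have "DERIV (\<lambda>y. f (a - 1) + integral {a-1..y} g) a :> 0 + g a"
    by (intro derivative_intros) auto
  then have "DERIV (\<lambda>y. f (a - 1) + integral {a-1..y} g) a :> g a" by simp
  then show ?thesis unfolding True
    by (rule DERIV_cong_open[where S="{a-1<..<a+1}"]) (auto intro: eq)
qed (rule d)

text \<open>Suppose q \<ge> K = - k. As p tends to 0 at u, it follows that p s \<le> k (u - s),
  hence q' = - m/p \<le> - c/(k (u - s)). This is not integrable up to u, so q would be dragged to
  minus infinity by (c/k) ln (u - s).\<close>

lemma bvp_slope_unbounded:
  fixes p q m :: "real \<Rightarrow> real"
  assumes bu: "b < u" and p: "\<And>s. s \<in> {b<..<u} \<Longrightarrow> p s > 0"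
    and dp: "\<And>s. s \<in> {b<..<u} \<Longrightarrow> DERIV p s :> q s"
    and dq: "\<And>s. s \<in> {b<..<u} \<Longrightarrow> DERIV q s :> - m s / p s"
    and lim: "(p \<longlongrightarrow> 0) (at_left u)"
    and c: "c > 0" "\<And>s. s \<in> {b<..<u} \<Longrightarrow> c \<le> m s"
  shows "\<exists>s\<in>{b<..<u}. q s < K"
proof (rule ccontr)
  assume "\<not> ?thesis"
  then have K: "K \<le> q s" if "s \<in> {b<..<u}" for s using that by force
  define k where "k = - K"
  have pk: "p s \<le> k * (u - s)" if s: "s \<in> {b<..<u}" for s
  proof -
    have "p t - K * t \<ge> p s - K * s" if t: "t \<in> {s<..<u}" for t
    proof (rule DERIV_nonneg_imp_nondecreasing[of s t "\<lambda>t. p t - K * t"])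
      fix x assume "s \<le> x" "x \<le> t"
      then have x: "x \<in> {b<..<u}" using s t by auto
      show "\<exists>y. DERIV (\<lambda>t. p t - K * t) x :> y \<and> 0 \<le> y"
        using K[OF x] by (intro exI[of _ "q x - K"]) (auto intro!: derivative_eq_intros dp x)
    qed (use t in auto)
    then have "\<forall>\<^sub>F t in at_left u. p s - K * s \<le> p t - K * t"
      using s by (auto simp: eventually_at_left_field intro!: exI[of _ s])
    moreover have "((\<lambda>t. p t - K * t) \<longlongrightarrow> 0 - K * u) (at_left u)"
      by (intro tendsto_intros lim)
    ultimately have "p s - K * s \<le> 0 - K * u"
      by (intro tendsto_lowerbound) (auto simp: trivial_limit_at_left_real)
    then show ?thesis by (simp add: k_def algebra_simps)
  qed
  \<comment> \<open>Positivity of p in p \<le> k (u - s) excludes a non-negative K, which permits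
    the division by k below.\<close>
  have k: "k > 0"
  proof -
    have s: "(b + u) / 2 \<in> {b<..<u}" using bu by auto
    have "0 < k * (u - (b + u) / 2)" using p[OF s] pk[OF s] by linarith
    then show ?thesis using bu by (auto simp: zero_less_mult_iff)
  qed
  define s1 where "s1 = (b + u) / 2"
  have s1: "s1 \<in> {b<..<u}" using bu by (auto simp: s1_def)
  have mono: "q t - c / k * ln (u - t) \<le> q s1 - c / k * ln (u - s1)" if t: "t \<in> {s1..<u}" for t
  proof (rule DERIV_nonpos_imp_nonincreasing[of s1 t "\<lambda>t. q t - c / k * ln (u - t)"])
    fix x assume "s1 \<le> x" "x \<le> t"
    then have x: "x \<in> {b<..<u}" using s1 t by auto
    have d: "DERIV (\<lambda>t. q t - c / k * ln (u - t)) x :> - m x / p x - c / k * (- 1 / (u - x))"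
      by (rule derivative_eq_intros dq x refl | use x in simp)+
    have "c / (k * (u - x)) \<le> m x / p x"
      using c(1) c(2)[OF x] pk[OF x] p[OF x] k x by (intro frac_le) auto
    then have "- m x / p x - c / k * (- 1 / (u - x)) \<le> 0" by simp
    with d show "\<exists>y. DERIV (\<lambda>t. q t - c / k * ln (u - t)) x :> y \<and> y \<le> 0" by blast
  qed (use t in auto)
  \<comment> \<open>At t = u - exp (- B) the logarithm of u - t equals - B. The first entry of the
    maximum places t to the right of s1; the second makes (c/k) B exceed what \<open>mono\<close>
    and K \<le> q t allow.\<close>
  define B where "B = max (- ln (u - s1)) (k / c * (q s1 - c / k * ln (u - s1) - K) + 1)"
  define t where "t = u - exp (- B)"
  have "exp (- B) \<le> exp (ln (u - s1))" unfolding exp_le_cancel_iff by (simp add: B_def)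
  also have "\<dots> = u - s1" using s1 by simp
  finally have t: "t \<in> {s1..<u}" by (simp add: t_def)
  have "K \<le> q t" using K[of t] t s1 by auto
  with mono[OF t] have "c / k * B \<le> q s1 - c / k * ln (u - s1) - K" by (simp add: t_def)
  then have "k / c * (c / k * B) \<le> k / c * (q s1 - c / k * ln (u - s1) - K)"
    using c k by (intro mult_left_mono) auto
  then have "B \<le> k / c * (q s1 - c / k * ln (u - s1) - K)" using c k by simp
  moreover have "k / c * (q s1 - c / k * ln (u - s1) - K) + 1 \<le> B" by (simp add: B_def)
  ultimately show False by linarith
qed

lemma exp_decay_combine:
  fixes N :: "real \<Rightarrow> real"
  assumes c: "continuous_on UNIV N"
    and l: "\<And>x. x \<le> x0 \<Longrightarrow> N x \<le> A * exp x" and r: "\<And>x. x \<ge> x1 \<Longrightarrow> N x \<le> B * exp (- x)"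
  obtains C where "C \<ge> 0" "\<And>x. N x \<le> C * exp (- \<bar>x\<bar>)"
proof -
  define y0 y1 where "y0 = min x0 0" and "y1 = max x1 0"
  have "continuous_on {y0..y1} (\<lambda>x. N x * exp \<bar>x\<bar>)"
    by (intro continuous_intros continuous_on_subset[OF c]) auto
  moreover have "{y0..y1} \<noteq> {}" by (auto simp: y0_def y1_def)
  ultimately obtain M where M: "\<And>x. x \<in> {y0..y1} \<Longrightarrow> N x * exp \<bar>x\<bar> \<le> M"
    using continuous_attains_sup[of "{y0..y1}" "\<lambda>x. N x * exp \<bar>x\<bar>"] by fastforce
  define C where "C = max 0 (max M (max A B))"
  have "N x * exp \<bar>x\<bar> \<le> C" for x
  proof -
    consider "x \<le> y0" | "x \<ge> y1" | "x \<in> {y0..y1}" by fastforce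
    then show ?thesis
    proof cases
      case 1
      then have "N x * exp (- x) \<le> A * exp x * exp (- x)" using l by (intro mult_right_mono) (auto simp: y0_def)
      moreover have "\<dots> = A" by (simp add: exp_minus)
      ultimately show ?thesis using 1 by (simp add: C_def y0_def)
    next
      case 2
      then have "N x * exp x \<le> B * exp (- x) * exp x" using r by (intro mult_right_mono) (auto simp: y1_def)
      moreover have "\<dots> = B" by (simp add: exp_minus)
      ultimately show ?thesis using 2 by (simp add: C_def y1_def)
    next
      case 3
      then show ?thesis using M[of x] by (simp add: C_def le_max_iff_disj)
    qed
  qed
  then have "N x \<le> C * exp (- \<bar>x\<bar>)" for x by (simp add: exp_minus field_simps)
  moreover have "C \<ge> 0" by (simp add: C_def)
  ultimately show ?thesis using that by blast
qed

text \<open>Here m = d/2. Inverting \<eta> = 2 q(s) gives f' = 1/(2 q') = - p/d, and N = p(f) gets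
  its derivative from the chain rule and q (f y) = y/2. At a, where d(f) vanishes, these formulas
  break down, but D(f) and y f - 2 N have derivatives that extend continuously across a. The
  exponential decay comes from N' = - (y/(2 d)) N with d bounded on the range of f.\<close>

lemma similarity_profile:
  fixes D d :: "real \<Rightarrow> real"
  assumes l0: "l < 0" and u0: "0 < u"
    and D: "\<And>s. DERIV D s :> d s" and dc: "\<And>s. isCont d s"
    and d0: "d 0 = 0" and dpos: "\<And>s. s \<noteq> 0 \<Longrightarrow> d s > 0"
  obtains f N :: "real \<Rightarrow> real" and a C :: real where
    "\<And>y. f y \<in> {l<..<u}" "\<And>x y. x < y \<Longrightarrow> f y < f x" "f a = 0" "\<And>y. isCont f y"
    "(f \<longlongrightarrow> u) at_bot" "(f \<longlongrightarrow> l) at_top"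
    "\<And>y. y \<noteq> a \<Longrightarrow> DERIV f y :> - N y / d (f y)"
    "\<And>y. y \<noteq> a \<Longrightarrow> DERIV N y :> (y / 2) * (- N y / d (f y))"
    "\<And>y. N y > 0" "\<And>y. isCont N y"
    "\<And>y. DERIV (\<lambda>y. D (f y)) y :> - N y"
    "\<And>y. DERIV (\<lambda>y. y * f y - 2 * N y) y :> f y"
    "C \<ge> 0" "\<And>y. N y \<le> C * exp (- \<bar>y\<bar>)"
    "\<And>y. y \<le> 0 \<Longrightarrow> \<bar>D (f y) - D u\<bar> \<le> C * exp (- \<bar>y\<bar>)"
    "\<And>y. y \<ge> 0 \<Longrightarrow> \<bar>D (f y) - D l\<bar> \<le> C * exp (- \<bar>y\<bar>)"
proof -
  have dnn: "0 \<le> d s" for s using dpos[of s] d0 by (cases "s = 0") auto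
  have dcon: "continuous_on S d" for S using dc by (simp add: continuous_at_imp_continuous_on)
  have Dmono: "D x \<le> D y" if "x \<le> y" for x y
    using DERIV_nonneg_imp_nondecreasing[OF that, of D] D dnn by blast
  obtain p q where p: "\<And>s. s \<in> {l<..<u} \<Longrightarrow> p s > 0"
    and dp: "\<And>s. s \<in> {l<..<u} \<Longrightarrow> DERIV p s :> q s"
    and dq: "\<And>s. s \<in> {l<..<u} \<Longrightarrow> DERIV q s :> - (d s / 2) / p s"
    and p_lim: "(p \<longlongrightarrow> 0) (at_right l)" "(p \<longlongrightarrow> 0) (at_left u)"
  proof -
    have "l < u" "continuous_on {l..u} (\<lambda>s. d s / 2)" "\<And>s. s \<in> {l..u} \<Longrightarrow> 0 \<le> d s / 2"
      "u / 2 \<in> {l<..<u}" "d (u / 2) / 2 > 0"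
      using l0 u0 dnn dpos[of "u/2"] by (auto intro!: continuous_intros dcon)
    from singular_bvp[OF this] show thesis using that by blast
  qed
  \<comment> \<open>q' = - d/(2 p) vanishes at s = 0 only, so strict decrease is shown on each side
    first and then joined at 0.\<close>
  have q_dec_piece: "q t < q s" if "l < s" "s < t" "t < u" "s \<ge> 0 \<or> t \<le> 0" for s t
  proof (rule DERIV_neg_imp_decreasing_open[OF that(2)])
    fix x assume x: "s < x" "x < t"
    then have "d x > 0" using that by (intro dpos) auto
    moreover have "x \<in> {l<..<u}" using x that by auto
    ultimately show "\<exists>y. DERIV q x :> y \<and> y < 0"
      using dq[of x] p[of x] by (intro exI[of _ "- (d x / 2) / p x"]) auto
  next
    show "continuous_on {s..t} q"
      by (intro continuous_at_imp_continuous_on ballI DERIV_isCont[OF dq]) (use that in auto)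
  qed
  have q_dec: "q t < q s" if "l < s" "s < t" "t < u" for s t
  proof (cases "s < 0 \<and> 0 < t")
    case True
    then show ?thesis using q_dec_piece[of s 0] q_dec_piece[of 0 t] that by auto
  next
    case False
    then show ?thesis using q_dec_piece[of s t] that by auto
  qed
  have low: "\<exists>s\<in>{0<..<u}. q s < K" for K
  proof -
    \<comment> \<open>Away from its zero, d has a positive minimum; it serves as the constant c of
      \<open>bvp_slope_unbounded\<close>.\<close>
    obtain x where x: "x \<in> {u/2..u}" "\<And>y. y \<in> {u/2..u} \<Longrightarrow> d x \<le> d y"
      using continuous_attains_inf[of "{u/2..u}" d] dcon u0 by auto
    have "\<exists>s\<in>{u/2<..<u}. q s < K"
    proof (rule bvp_slope_unbounded[where p=p and m="\<lambda>s. d s / 2" and c="d x / 2"])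
      show "d x / 2 > 0" using dpos[of x] x u0 by auto
    qed (use x p dp dq p_lim u0 l0 in auto)
    then show ?thesis using u0 by force
  qed
  \<comment> \<open>The reflection s \<mapsto> - s turns the left end point into a right one. As p
    (- s) has slope - q (- s), unboundedness from below becomes unboundedness from above.\<close>
  have high: "\<exists>s\<in>{l<..<0}. q s > K" for K
  proof -
    obtain x where x: "x \<in> {-l/2..-l}" "\<And>y. y \<in> {-l/2..-l} \<Longrightarrow> d (- x) \<le> d (- y)"
    proof -
      have "continuous_on {-l/2..-l} (\<lambda>x. d (- x))"
        by (intro continuous_on_compose2[OF dcon[of UNIV]] continuous_intros) auto
      then show thesis using continuous_attains_inf[of "{-l/2..-l}" "\<lambda>x. d (- x)"] l0 that by auto
    qed
    have "\<exists>s\<in>{-l/2<..<-l}. - q (- s) < - K"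
    proof (rule bvp_slope_unbounded[where p="\<lambda>s. p (- s)" and m="\<lambda>s. d (- s) / 2" and c="d (- x) / 2"])
      show "d (- x) / 2 > 0" using dpos[of "-x"] x l0 by auto
      fix s assume s: "s \<in> {-l/2<..<-l}"
      then have s': "- s \<in> {l<..<u}" using l0 u0 by auto
      have m: "DERIV (\<lambda>s. - s) s :> - 1" by (auto intro!: derivative_eq_intros)
      show "DERIV (\<lambda>s. p (- s)) s :> - q (- s)"
        using DERIV_chain2[where f=p and g="\<lambda>s. - s", OF dp[OF s'] m] by simp
      show "DERIV (\<lambda>s. - q (- s)) s :> - (d (- s) / 2) / p (- s)"
        using DERIV_minus[OF DERIV_chain2[where f=q and g="\<lambda>s. - s", OF dq[OF s'] m]] by simp
      show "p (- s) > 0" using p[OF s'] .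
    next
      show "((\<lambda>s. p (- s)) \<longlongrightarrow> 0) (at_left (- l))"
        using p_lim(1) by (simp add: filterlim_at_left_to_right)
    qed (use x l0 in auto)
    then obtain s where "s \<in> {-l/2<..<-l}" "q (- s) > K" by auto
    then show ?thesis using l0 by (intro bexI[of _ "- s"]) auto
  qed
  have "\<exists>s\<in>{l<..<u}. 2 * q s = y" for y
  proof -
    obtain s t where s: "s \<in> {l<..<0}" "q s > y / 2" and t: "t \<in> {0<..<u}" "q t < y / 2"
      using low high by meson
    have "\<exists>x\<ge>s. x \<le> t \<and> q x = y / 2"
    proof (rule IVT2')
      show "continuous_on {s..t} q"
        by (intro continuous_at_imp_continuous_on ballI DERIV_isCont[OF dq]) (use s t in auto)
    qed (use s t in auto)
    then obtain x where "s \<le> x" "x \<le> t" "q x = y / 2" by blast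
    then show ?thesis using s t by (intro bexI[of _ x]) auto
  qed
  then obtain f where f: "\<And>y. f y \<in> {l<..<u}" and qf: "\<And>y. 2 * q (f y) = y" by metis
  have f_anti: "f y < f x" if "x < y" for x y
  proof (rule ccontr)
    assume "\<not> f y < f x"
    then have "f x < f y \<or> f x = f y" by auto
    then have "q (f y) \<le> q (f x)" using q_dec[of "f x" "f y"] f[of x] f[of y] by auto
    then show False using qf[of x] qf[of y] that by simp
  qed
  have f_inv: "f (2 * q s) = s" if "s \<in> {l<..<u}" for s
    using q_dec[of s "f (2 * q s)"] q_dec[of "f (2 * q s)" s] that f[of "2 * q s"] qf[of "2 * q s"]
    by (cases s "f (2 * q s)" rule: linorder_cases) auto
  define a where "a = 2 * q 0"
  have fa: "f a = 0" using f_inv[of 0] l0 u0 by (simp add: a_def)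
  have f_nz: "f y \<noteq> 0" if "y \<noteq> a" for y
    using f_anti[of y a] f_anti[of a y] that fa by (cases y a rule: linorder_cases) auto
  have fc: "isCont f y" for y
  proof -
    \<comment> \<open>A monotone function with open range has no jumps; this yields continuity of f,
      at the interface as well.\<close>
    have img: "range (\<lambda>y. - f y) = {-u<..<-l}"
    proof -
      have "range f = {l<..<u}" using f f_inv by (metis (no_types) image_subset_iff rangeI subsetI subset_antisym)
      then have "range (\<lambda>y. - f y) = uminus ` {l<..<u}" by (metis image_image)
      then show ?thesis by (simp add: image_uminus_greaterThanLessThan)
    qed
    have "continuous_on UNIV (\<lambda>y. - f y)"
    proof (rule continuous_onI_mono)
      show "open (range (\<lambda>y. - f y))" by (simp add: img)
      show "- f x \<le> - f y" if "x \<le> y" for x y using f_anti[of x y] that by (cases "x = y") auto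
    qed
    then have "continuous_on UNIV (\<lambda>y. - (- f y))" by (rule continuous_on_minus)
    then show ?thesis by (simp add: continuous_on_eq_continuous_at)
  qed
  define N where "N y = p (f y)" for y
  have Npos: "N y > 0" for y unfolding N_def by (rule p[OF f])
  have Nc: "isCont N y" for y
    unfolding N_def[abs_def] using isCont_o2[OF fc] DERIV_isCont[OF dp[OF f]] by blast
  have df: "DERIV f y :> - N y / d (f y)" if "y \<noteq> a" for y
  proof -
    have "DERIV f y :> inverse (2 * (- (d (f y) / 2) / p (f y)))"
    proof (rule DERIV_inverse_function[of "\<lambda>s. 2 * q s" _ _ _ "y - 1" "y + 1"])
      show "DERIV (\<lambda>s. 2 * q s) (f y) :> 2 * (- (d (f y) / 2) / p (f y))"
        by (rule DERIV_cmult[OF dq[OF f]])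
      show "2 * (- (d (f y) / 2) / p (f y)) \<noteq> 0"
        using dpos[OF f_nz[OF that]] p[OF f[of y]] by auto
    qed (auto simp: qf fc)
    then show ?thesis by (simp add: N_def)
  qed
  have dN: "DERIV N y :> (y / 2) * (- N y / d (f y))" if "y \<noteq> a" for y
  proof -
    have "DERIV (\<lambda>y. p (f y)) y :> q (f y) * (- N y / d (f y))"
      by (rule DERIV_chain2[OF dp[OF f] df[OF that]])
    moreover have "q (f y) = y / 2" using qf[of y] by simp
    ultimately show ?thesis by (simp add: N_def[abs_def])
  qed
  have dF: "DERIV (\<lambda>y. D (f y)) y :> - N y" for y
  proof (rule DERIV_removable_point[where a=a])
    show "DERIV (\<lambda>y. D (f y)) x :> - N x" if "x \<noteq> a" for x
      using DERIV_chain2[OF D df[OF that]] dpos[OF f_nz[OF that]] by simp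
    show "isCont (\<lambda>y. D (f y)) a" by (intro isCont_o2[OF fc] DERIV_isCont[OF D])
    show "isCont (\<lambda>y. - N y) x" for x by (intro continuous_intros Nc)
  qed
  \<comment> \<open>N' = (y/2) f' cancels the term y f', so no derivative of f is left and the
    identity survives at a. In the weak formulation this function acts as a potential of f.\<close>
  have dQ: "DERIV (\<lambda>y. y * f y - 2 * N y) y :> f y" for y
  proof (rule DERIV_removable_point[where a=a])
    show "DERIV (\<lambda>y. y * f y - 2 * N y) x :> f x" if "x \<noteq> a" for x
      by (rule derivative_eq_intros df[OF that] dN[OF that] refl)+ (simp add: algebra_simps)
    show "isCont (\<lambda>y. y * f y - 2 * N y) a" by (intro continuous_intros fc Nc)
  qed (rule fc)
  have f_bot: "(f \<longlongrightarrow> u) at_bot"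
  proof (rule order_tendstoI)
    fix e assume "e < u"
    define s where "s = (max e l + u) / 2"
    have s: "s \<in> {l<..<u}" "e < s" using \<open>e < u\<close> l0 u0 by (auto simp: s_def)
    have "\<forall>\<^sub>F y in at_bot. y < 2 * q s" by (rule eventually_gt_at_bot)
    then show "\<forall>\<^sub>F y in at_bot. e < f y"
      by eventually_elim (use f_anti f_inv[OF s(1)] s(2) in fastforce)
  next
    fix e assume "u < e"
    then show "\<forall>\<^sub>F y in at_bot. f y < e" using f by (intro always_eventually) (auto intro: less_trans)
  qed
  have f_top: "(f \<longlongrightarrow> l) at_top"
  proof (rule order_tendstoI)
    fix e assume "l < e"
    define s where "s = (min e u + l) / 2"
    have s: "s \<in> {l<..<u}" "s < e" using \<open>l < e\<close> l0 u0 by (auto simp: s_def min_def)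
    have "\<forall>\<^sub>F y in at_top. y > 2 * q s" by (rule eventually_gt_at_top)
    then show "\<forall>\<^sub>F y in at_top. f y < e"
      by eventually_elim (use f_anti f_inv[OF s(1)] s(2) in fastforce)
  next
    fix e assume "e < l"
    then show "\<forall>\<^sub>F y in at_top. e < f y" using f by (intro always_eventually) (auto intro: less_trans)
  qed
  obtain M where M: "\<And>s. s \<in> {l..u} \<Longrightarrow> d s \<le> M"
    using continuous_attains_sup[of "{l..u}" d] dcon l0 u0 by fastforce
  have dM: "d (f y) \<le> M" for y using M[of "f y"] f[of y] by auto
  \<comment> \<open>Beyond y0 and y1 the ratio |y|/(2 d(f y)) is at least 1, so N' = - (y/(2 d)) N
    forces N to decay at least like exp (- |y|). The margin 1 stays clear of the point a excluded
    from the derivative formulas.\<close>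
  define y0 where "y0 = min (- 2 * M) (a - 1)"
  define y1 where "y1 = max (2 * M) (a + 1)"
  have Nl: "N y \<le> N y0 * exp (- y0) * exp y" if "y \<le> y0" for y
  proof -
    have "N y * exp (- y) \<le> N y0 * exp (- y0)"
    proof (rule DERIV_nonneg_imp_nondecreasing[OF that, of "\<lambda>y. N y * exp (- y)"])
      fix x assume x: "y \<le> x" "x \<le> y0"
      then have xa: "x \<noteq> a" and xM: "2 * M \<le> - x" by (auto simp: y0_def)
      have dx: "d (f x) > 0" using dpos[OF f_nz[OF xa]] .
      have "1 \<le> (- x / 2) / d (f x)" using dx dM[of x] xM by (simp add: field_simps)
      then have "N x * 1 \<le> N x * ((- x / 2) / d (f x))" using Npos[of x] by (intro mult_left_mono) auto
      then have "0 \<le> (x / 2) * (- N x / d (f x)) - N x" by (simp add: mult_ac)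
      then have "0 \<le> ((x / 2) * (- N x / d (f x)) - N x) * exp (- x)" by (intro mult_nonneg_nonneg) auto
      moreover have "DERIV (\<lambda>y. N y * exp (- y)) x :> ((x / 2) * (- N x / d (f x)) - N x) * exp (- x)"
        by (rule derivative_eq_intros dN[OF xa] refl)+ (simp add: algebra_simps)
      ultimately show "\<exists>z. DERIV (\<lambda>y. N y * exp (- y)) x :> z \<and> 0 \<le> z" by blast
    qed
    then have "N y * exp (- y) * exp y \<le> N y0 * exp (- y0) * exp y" by (intro mult_right_mono) auto
    moreover have "N y * exp (- y) * exp y = N y" by (simp add: exp_minus)
    ultimately show ?thesis by linarith
  qed
  have Nr: "N y \<le> N y1 * exp y1 * exp (- y)" if "y \<ge> y1" for y
  proof -
    have "N y * exp y \<le> N y1 * exp y1"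
    proof (rule DERIV_nonpos_imp_nonincreasing[OF that, of "\<lambda>y. N y * exp y"])
      fix x assume x: "y1 \<le> x" "x \<le> y"
      then have xa: "x \<noteq> a" and xM: "2 * M \<le> x" by (auto simp: y1_def)
      have dx: "d (f x) > 0" using dpos[OF f_nz[OF xa]] .
      have "1 \<le> (x / 2) / d (f x)" using dx dM[of x] xM by (simp add: field_simps)
      then have "N x * 1 \<le> N x * ((x / 2) / d (f x))" using Npos[of x] by (intro mult_left_mono) auto
      then have "(x / 2) * (- N x / d (f x)) + N x \<le> 0" by (simp add: mult_ac)
      then have "((x / 2) * (- N x / d (f x)) + N x) * exp x \<le> 0" by (intro mult_nonpos_nonneg) auto
      moreover have "DERIV (\<lambda>y. N y * exp y) x :> ((x / 2) * (- N x / d (f x)) + N x) * exp x"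
        by (rule derivative_eq_intros dN[OF xa] refl)+ (simp add: algebra_simps)
      ultimately show "\<exists>z. DERIV (\<lambda>y. N y * exp y) x :> z \<and> z \<le> 0" by blast
    qed
    then have "N y * exp y * exp (- y) \<le> N y1 * exp y1 * exp (- y)" by (intro mult_right_mono) auto
    moreover have "N y * exp y * exp (- y) = N y" by (simp add: exp_minus)
    ultimately show ?thesis by linarith
  qed
  have "continuous_on UNIV N" using Nc by (simp add: continuous_at_imp_continuous_on)
  from exp_decay_combine[OF this Nl Nr] obtain C where C: "C \<ge> 0" "\<And>y. N y \<le> C * exp (- \<bar>y\<bar>)" by metis
  \<comment> \<open>For y \<le> 0 the bound on N makes D(f) + C exp nondecreasing; comparison with
    its limit D u at minus infinity bounds D u - D(f y).\<close>
  have Fl: "\<bar>D (f y) - D u\<bar> \<le> C * exp (- \<bar>y\<bar>)" if y: "y \<le> 0" for y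
  proof -
    have "D (f x) + C * exp x \<le> D (f y) + C * exp y" if "x \<le> y" for x
    proof (rule DERIV_nonneg_imp_nondecreasing[OF that, of "\<lambda>y. D (f y) + C * exp y"])
      fix z assume z: "x \<le> z" "z \<le> y"
      show "\<exists>w. DERIV (\<lambda>y. D (f y) + C * exp y) z :> w \<and> 0 \<le> w"
        using C(2)[of z] z y by (intro exI[of _ "- N z + C * exp z"]) (auto intro!: derivative_eq_intros dF)
    qed
    then have ev: "\<forall>\<^sub>F x in at_bot. D (f x) + C * exp x \<le> D (f y) + C * exp y"
      by (auto simp: eventually_at_bot_linorder)
    have "((\<lambda>x. D (f x) + C * exp x) \<longlongrightarrow> D u + C * 0) at_bot"
      by (intro tendsto_intros isCont_tendsto_compose[OF DERIV_isCont[OF D]] f_bot exp_at_bot)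
    then have "D u + C * 0 \<le> D (f y) + C * exp y"
      by (rule tendsto_upperbound[OF _ ev]) simp
    moreover have "D (f y) \<le> D u" using f[of y] by (intro Dmono) auto
    ultimately show ?thesis using y by simp
  qed
  have Fr: "\<bar>D (f y) - D l\<bar> \<le> C * exp (- \<bar>y\<bar>)" if y: "y \<ge> 0" for y
  proof -
    have "D (f y) - C * exp (- y) \<le> D (f x) - C * exp (- x)" if "y \<le> x" for x
    proof (rule DERIV_nonneg_imp_nondecreasing[OF that, of "\<lambda>y. D (f y) - C * exp (- y)"])
      fix z assume z: "y \<le> z" "z \<le> x"
      show "\<exists>w. DERIV (\<lambda>y. D (f y) - C * exp (- y)) z :> w \<and> 0 \<le> w"
        using C(2)[of z] z y by (intro exI[of _ "- N z + C * exp (- z)"]) (auto intro!: derivative_eq_intros dF)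
    qed
    then have ev: "\<forall>\<^sub>F x in at_top. D (f y) - C * exp (- y) \<le> D (f x) - C * exp (- x)"
      by (auto simp: eventually_at_top_linorder)
    have "((\<lambda>x. D (f x) - C * exp (- x)) \<longlongrightarrow> D l - C * 0) at_top"
      by (intro tendsto_intros isCont_tendsto_compose[OF DERIV_isCont[OF D]] f_top
          filterlim_compose[OF exp_at_bot] filterlim_uminus_at_bot_at_top)
    then have "D (f y) - C * exp (- y) \<le> D l - C * 0"
      by (rule tendsto_lowerbound[OF _ ev]) simp
    moreover have "D l \<le> D (f y)" using f[of y] by (intro Dmono) auto
    ultimately show ?thesis using y by simp
  qed
  show ?thesis
    by (rule that[OF f f_anti fa fc f_bot f_top df dN Npos Nc dF dQ C Fl Fr])
qed

text \<open>The formula for f' is a quotient of differentiable functions, so it can be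
  differentiated once more. Substituting N' = (y/2) f' into the quotient rule exhibits the result h
  as continuous.\<close>

lemma C2_on_profile:
  fixes f N e e' :: "real \<Rightarrow> real"
  assumes S: "open S"
    and f: "\<And>y. y \<in> S \<Longrightarrow> DERIV f y :> - N y / e (f y)"
    and N: "\<And>y. y \<in> S \<Longrightarrow> DERIV N y :> (y / 2) * (- N y / e (f y))"
    and nz: "\<And>y. y \<in> S \<Longrightarrow> e (f y) \<noteq> 0"
    and e: "\<And>s. DERIV e s :> e' s" and e': "\<And>s. isCont e' s"
  shows "C2_on S f"
proof -
  define g where "g y = - N y / e (f y)" for y
  define h where "h y = (- ((y / 2) * g y) * e (f y) - (- N y) * (e' (f y) * g y)) / (e (f y) * e (f y))" for y
  have fg: "DERIV f y :> g y" if "y \<in> S" for y using f[OF that] by (simp add: g_def)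
  then have df: "deriv f y = g y" if "y \<in> S" for y using that by (intro DERIV_imp_deriv)
  have gh: "DERIV g y :> h y" if "y \<in> S" for y
  proof -
    have "DERIV (\<lambda>y. - N y / e (f y)) y :> h y"
      unfolding h_def using DERIV_divide[OF DERIV_minus[OF N[OF that]] DERIV_chain2[OF e fg[OF that]] nz[OF that]]
      by (simp add: g_def)
    then show ?thesis by (simp add: g_def[abs_def])
  qed
  have dfh: "DERIV (deriv f) y :> h y" if "y \<in> S" for y
    by (rule DERIV_cong_open[OF gh[OF that] S that df])
  have cf: "isCont f y" "isCont g y" "isCont N y" if "y \<in> S" for y
    using that fg gh N DERIV_isCont by blast+
  have "isCont h y" if "y \<in> S" for y
    unfolding h_def[abs_def] using nz[OF that] e
    by (intro continuous_intros cf[OF that] isCont_o2[OF cf(1)[OF that] DERIV_isCont[OF e]]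
        isCont_o2[OF cf(1)[OF that] e']) auto
  then have "continuous_on S h" by (simp add: continuous_at_imp_continuous_on)
  moreover have "deriv (deriv f) y = h y" if "y \<in> S" for y using dfh[OF that] by (rule DERIV_imp_deriv)
  ultimately have "continuous_on S (deriv (deriv f))" by (simp cong: continuous_on_cong)
  then show ?thesis
    unfolding C2_on_def using fg dfh by (auto simp: real_differentiable_def)
qed

section \<open>The degenerate nonlinearity and the interface system\<close>

definition Dfun_deriv :: "(real \<Rightarrow> real) \<Rightarrow> real \<Rightarrow> real \<Rightarrow> real" where
  "Dfun_deriv \<phi> \<epsilon> s = (if s \<ge> 0 then deriv \<phi> s else \<epsilon> * deriv \<phi> (- s))"

locale degenerate_diffusion =
  fixes \<phi> :: "real \<Rightarrow> real" and \<epsilon> :: real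
  assumes C2: "C2_on UNIV \<phi>" and strict_mono_deriv: "strict_mono_on {0..} (deriv \<phi>)"
    and phi0: "\<phi> 0 = 0" and deriv_phi0: "deriv \<phi> 0 = 0" and eps: "\<epsilon> > 0"
begin

lemma DERIV_phi: "DERIV \<phi> s :> deriv \<phi> s" and DERIV_deriv_phi: "DERIV (deriv \<phi>) s :> deriv (deriv \<phi>) s"
  and isCont_deriv2_phi: "isCont (deriv (deriv \<phi>)) s"
  using C2 by (auto simp: C2_on_def DERIV_deriv_iff_real_differentiable continuous_on_eq_continuous_at)

lemma deriv_phi_pos: "s > 0 \<Longrightarrow> deriv \<phi> s > 0"
  using strict_mono_onD[OF strict_mono_deriv, of 0 s] deriv_phi0 by auto

lemma Dfun_deriv_pos: "s \<noteq> 0 \<Longrightarrow> Dfun_deriv \<phi> \<epsilon> s > 0"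
  using deriv_phi_pos[of s] deriv_phi_pos[of "-s"] eps by (auto simp: Dfun_deriv_def)

lemma isCont_Dfun_deriv: "isCont (Dfun_deriv \<phi> \<epsilon>) s"
proof -
  \<comment> \<open>Since \<phi>'(0) = 0, the branch that does not apply contributes 0, and the case
    distinction is absorbed into continuous maxima.\<close>
  have "Dfun_deriv \<phi> \<epsilon> = (\<lambda>s. deriv \<phi> (max s 0) + \<epsilon> * deriv \<phi> (max (- s) 0))"
    by (auto simp: Dfun_deriv_def deriv_phi0 fun_eq_iff max_def)
  moreover have m: "isCont (\<lambda>s. max s 0 :: real) s" "isCont (\<lambda>s. max (- s) 0 :: real) s"
    by (intro continuous_intros)+
  have "isCont (\<lambda>s. deriv \<phi> (max s 0) + \<epsilon> * deriv \<phi> (max (- s) 0)) s"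
    by (intro continuous_add continuous_mult continuous_const
        isCont_o2[OF m(1) DERIV_isCont[OF DERIV_deriv_phi]] isCont_o2[OF m(2) DERIV_isCont[OF DERIV_deriv_phi]])
  ultimately show ?thesis by simp
qed

lemma DERIV_Dfun: "DERIV (Dfun \<phi> \<epsilon>) s :> Dfun_deriv \<phi> \<epsilon> s"
proof (rule DERIV_removable_point[where a=0, OF _ _ isCont_Dfun_deriv])
  show "DERIV (Dfun \<phi> \<epsilon>) x :> Dfun_deriv \<phi> \<epsilon> x" if "x \<noteq> 0" for x
  proof (cases "x > 0")
    case True
    show ?thesis
      by (rule DERIV_cong_open[of \<phi> _ _ "{0<..}"]) (use True DERIV_phi in \<open>auto simp: Dfun_deriv_def Dfun_def\<close>)
  next
    case False
    have "DERIV (\<lambda>s. - \<epsilon> * \<phi> (- s)) x :> - \<epsilon> * (deriv \<phi> (- x) * - 1)"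
      by (intro DERIV_cmult DERIV_chain2[OF DERIV_phi]) (auto intro!: derivative_eq_intros)
    moreover have "- \<epsilon> * (deriv \<phi> (- x) * - 1) = Dfun_deriv \<phi> \<epsilon> x"
      using False that by (simp add: Dfun_deriv_def)
    ultimately have "DERIV (\<lambda>s. - \<epsilon> * \<phi> (- s)) x :> Dfun_deriv \<phi> \<epsilon> x" by metis
    then show ?thesis
    proof (rule DERIV_cong_open)
      show "open {..<0::real}" "x \<in> {..<0}" using False that by auto
      show "Dfun \<phi> \<epsilon> y = - \<epsilon> * \<phi> (- y)" if "y \<in> {..<0}" for y
        using that by (simp add: Dfun_def)
    qed
  qed
  have "Dfun \<phi> \<epsilon> = (\<lambda>s. \<phi> (max s 0) - \<epsilon> * \<phi> (max (- s) 0))"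
  proof
    show "Dfun \<phi> \<epsilon> s = \<phi> (max s 0) - \<epsilon> * \<phi> (max (- s) 0)" for s
      by (cases "s \<ge> 0") (simp_all add: Dfun_def phi0)
  qed
  moreover have m: "isCont (\<lambda>s. max s 0 :: real) 0" "isCont (\<lambda>s. max (- s) 0 :: real) 0"
    by (intro continuous_intros)+
  have "isCont (\<lambda>s. \<phi> (max s 0) - \<epsilon> * \<phi> (max (- s) 0)) 0"
    by (intro continuous_diff continuous_mult continuous_const
        isCont_o2[OF m(1) DERIV_isCont[OF DERIV_phi]] isCont_o2[OF m(2) DERIV_isCont[OF DERIV_phi]])
  ultimately show "isCont (Dfun \<phi> \<epsilon>) 0" by simp
qed

lemma Dfun_strict_mono: "x < y \<Longrightarrow> Dfun \<phi> \<epsilon> x < Dfun \<phi> \<epsilon> y"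
proof -
  have piece: "Dfun \<phi> \<epsilon> x < Dfun \<phi> \<epsilon> y" if "x < y" "x \<ge> 0 \<or> y \<le> 0" for x y
  proof (rule DERIV_pos_imp_increasing_open[OF that(1)])
    show "\<exists>z. DERIV (Dfun \<phi> \<epsilon>) s :> z \<and> 0 < z" if "x < s" "s < y" for s
      using DERIV_Dfun[of s] Dfun_deriv_pos[of s] that \<open>x \<ge> 0 \<or> y \<le> 0\<close> by fastforce
    show "continuous_on {x..y} (Dfun \<phi> \<epsilon>)"
      by (intro continuous_at_imp_continuous_on ballI DERIV_isCont[OF DERIV_Dfun])
  qed
  assume "x < y"
  then show ?thesis using piece[of x y] piece[of x 0] piece[of 0 y] by (cases "x < 0 \<and> 0 < y") auto
qed

text \<open>Both bracketed fluxes equal - N, so each equation is the formula for N', and the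
  interface condition is the continuity of N at a. In \<open>selfsimilar_system\<close> the limit
  from the right is taken without the factor \<epsilon>, hence its value - N a / \<epsilon>.\<close>

lemma selfsimilar_system_profile:
  fixes f N :: "real \<Rightarrow> real"
  assumes f_anti: "\<And>x y. x < y \<Longrightarrow> f y < f x" and fa: "f a = 0" and fc: "\<And>y. isCont f y"
    and lim: "(f \<longlongrightarrow> U0) at_bot" "(f \<longlongrightarrow> - V0) at_top"
    and df: "\<And>y. y \<noteq> a \<Longrightarrow> DERIV f y :> - N y / Dfun_deriv \<phi> \<epsilon> (f y)"
    and dN: "\<And>y. y \<noteq> a \<Longrightarrow> DERIV N y :> (y / 2) * (- N y / Dfun_deriv \<phi> \<epsilon> (f y))"
    and Nc: "\<And>y. isCont N y"
  shows "selfsimilar_system \<phi> \<epsilon> U0 V0 f a"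
proof -
  have pos: "f y > 0" if "y < a" for y using f_anti[OF that] fa by simp
  have neg: "f y < 0" if "y > a" for y using f_anti[OF that] fa by simp
  have dpos: "Dfun_deriv \<phi> \<epsilon> (f y) = deriv \<phi> (f y)" "deriv \<phi> (f y) > 0" if "y < a" for y
    using pos[OF that] deriv_phi_pos by (auto simp: Dfun_deriv_def)
  have dneg: "Dfun_deriv \<phi> \<epsilon> (f y) = \<epsilon> * deriv \<phi> (- f y)" "deriv \<phi> (- f y) > 0" if "y > a" for y
    using neg[OF that] deriv_phi_pos by (auto simp: Dfun_deriv_def)
  have dfy: "deriv f y = - N y / Dfun_deriv \<phi> \<epsilon> (f y)" if "y \<noteq> a" for y
    by (rule DERIV_imp_deriv[OF df[OF that]])
  have flux1: "deriv \<phi> (f y) * deriv f y = - N y" if "y < a" for y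
    using dfy[of y] dpos[OF that] that by auto
  have flux2: "\<epsilon> * deriv \<phi> (- f y) * deriv f y = - N y" if "y > a" for y
    using dfy[of y] dneg[OF that] that eps by auto
  have dNm: "DERIV (\<lambda>y. - N y) y :> - (1/2) * y * deriv f y" if "y \<noteq> a" for y
    using DERIV_minus[OF dN[OF that]] dfy[OF that] by simp
  have 1: "C2_on {..<a} f"
    by (rule C2_on_profile[where e="deriv \<phi>" and N=N, OF _ _ _ _ DERIV_deriv_phi isCont_deriv2_phi])
      (use df dN dpos in \<open>force+\<close>)
  have e: "DERIV (\<lambda>s. \<epsilon> * deriv \<phi> (- s)) s :> - \<epsilon> * deriv (deriv \<phi>) (- s)" for s
  proof -
    have "DERIV (\<lambda>s. \<epsilon> * deriv \<phi> (- s)) s :> \<epsilon> * (deriv (deriv \<phi>) (- s) * - 1)"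
      by (intro DERIV_cmult DERIV_chain2[OF DERIV_deriv_phi]) (auto intro!: derivative_eq_intros)
    then show ?thesis by simp
  qed
  have e': "isCont (\<lambda>s. - \<epsilon> * deriv (deriv \<phi>) (- s)) s" for s
    by (intro continuous_intros isCont_o2[OF _ isCont_deriv2_phi])
  have 2: "C2_on {a<..} f"
    by (rule C2_on_profile[where N=N, OF _ _ _ _ e e']) (use df dN dneg eps in \<open>force+\<close>)
  have 3: "DERIV (\<lambda>y. deriv \<phi> (f y) * deriv f y) y :> - (1/2) * y * deriv f y" if "y < a" for y
    by (rule DERIV_cong_open[OF dNm, of _ "{..<a}"]) (use that flux1 in auto)
  have 4: "DERIV (\<lambda>y. \<epsilon> * deriv \<phi> (- f y) * deriv f y) y :> - (1/2) * y * deriv f y" if "y > a" for y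
    by (rule DERIV_cong_open[OF dNm, of _ "{a<..}"]) (use that flux2 in auto)
  have fa': "(f \<longlongrightarrow> 0) (at a)" using fc[of a] fa by (simp add: isCont_def)
  have Na: "((\<lambda>y. - N y) \<longlongrightarrow> - N a) (at a)" using Nc[of a] by (intro tendsto_intros) (simp add: isCont_def)
  have 5: "((\<lambda>y. deriv \<phi> (f y) * deriv f y) \<longlongrightarrow> - N a) (at_left a)"
  proof (rule Lim_transform_eventually)
    show "((\<lambda>y. - N y) \<longlongrightarrow> - N a) (at_left a)" using Na by (simp add: filterlim_at_split)
    show "\<forall>\<^sub>F y in at_left a. - N y = deriv \<phi> (f y) * deriv f y"
      unfolding eventually_at_filter by (intro always_eventually) (simp add: flux1)
  qed
  have 6: "((\<lambda>y. deriv \<phi> (- f y) * deriv f y) \<longlongrightarrow> - N a / \<epsilon>) (at_right a)"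
  proof (rule Lim_transform_eventually)
    have "((\<lambda>y. - N y) \<longlongrightarrow> - N a) (at_right a)" using Na by (simp add: filterlim_at_split)
    then show "((\<lambda>y. - N y / \<epsilon>) \<longlongrightarrow> - N a / \<epsilon>) (at_right a)" using eps by (intro tendsto_divide tendsto_const) auto
    show "\<forall>\<^sub>F y in at_right a. - N y / \<epsilon> = deriv \<phi> (- f y) * deriv f y"
      unfolding eventually_at_filter
      by (intro always_eventually) (use eps in \<open>auto simp: flux2[symmetric]\<close>)
  qed
  have 7: "\<exists>l r. ((\<lambda>y. deriv \<phi> (f y) * deriv f y) \<longlongrightarrow> l) (at_left a) \<and>
      ((\<lambda>y. deriv \<phi> (- f y) * deriv f y) \<longlongrightarrow> r) (at_right a) \<and> l = \<epsilon> * r"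
    by (rule exI[of _ "- N a"], rule exI[of _ "- N a / \<epsilon>"]) (use 5 6 eps in simp)
  have 8: "(f \<longlongrightarrow> 0) (at_left a)" "(f \<longlongrightarrow> 0) (at_right a)" using fa' by (simp_all add: filterlim_at_split)
  have 9: "continuous_on UNIV f" using fc by (simp add: continuous_at_imp_continuous_on)
  show ?thesis
    unfolding selfsimilar_system_def
    by (intro conjI allI impI 1 2 3 4 7 8 9 lim pos neg)
qed

end

section \<open>Weak derivatives\<close>

text \<open>Recursing on \<open>deriv f\<close> instead of counting iterated derivatives makes
  products accessible to induction on the order: (f g)' is a sum of products of functions that are
  smooth to one order less.\<close>

primrec nsmooth :: "nat \<Rightarrow> (real \<Rightarrow> real) \<Rightarrow> bool" where
  "nsmooth 0 f \<longleftrightarrow> True"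
| "nsmooth (Suc n) f \<longleftrightarrow> (\<forall>x. f differentiable (at x)) \<and> nsmooth n (deriv f)"

lemma nsmooth_iff: "nsmooth n f \<longleftrightarrow> (\<forall>k<n. \<forall>x. (deriv ^^ k) f differentiable (at x))"
proof (induction n arbitrary: f)
  case (Suc n)
  have "(\<forall>k<Suc n. \<forall>x. (deriv ^^ k) f differentiable (at x)) \<longleftrightarrow>
     (\<forall>x. f differentiable (at x)) \<and> (\<forall>k<n. \<forall>x. (deriv ^^ k) (deriv f) differentiable (at x))"
    by (simp add: All_less_Suc2 funpow_Suc_right del: funpow.simps)
  then show ?case using Suc by simp
qed simp

lemma smooth_iff_nsmooth: "smooth f \<longleftrightarrow> (\<forall>n. nsmooth n f)"
  by (auto simp: smooth_def nsmooth_iff)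

lemma nsmooth_SucD: "nsmooth (Suc n) f \<Longrightarrow> nsmooth n f"
  by (simp add: nsmooth_iff)

lemma nsmooth_DERIV_I:
  assumes "\<And>x. DERIV f x :> g x" "nsmooth n g"
  shows "nsmooth (Suc n) f"
proof -
  have "deriv f = g" using assms(1) by (auto intro: DERIV_imp_deriv)
  then show ?thesis using assms by (auto simp: real_differentiable_def)
qed

lemma nsmooth_SucE: "nsmooth (Suc n) f \<Longrightarrow> DERIV f x :> deriv f x"
  by (simp add: DERIV_deriv_iff_real_differentiable)

lemma nsmooth_const: "nsmooth n (\<lambda>_. c)"
proof (induction n arbitrary: c)
  case (Suc n)
  show ?case by (rule nsmooth_DERIV_I[OF DERIV_const Suc])
qed simp

lemma nsmooth_add: "nsmooth n f \<Longrightarrow> nsmooth n g \<Longrightarrow> nsmooth n (\<lambda>x. f x + g x)"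
proof (induction n arbitrary: f g)
  case (Suc n)
  show ?case
  proof (rule nsmooth_DERIV_I)
    show "DERIV (\<lambda>x. f x + g x) x :> deriv f x + deriv g x" for x
      using Suc.prems by (intro DERIV_add nsmooth_SucE)
    show "nsmooth n (\<lambda>x. deriv f x + deriv g x)"
      using Suc.prems by (intro Suc.IH) auto
  qed
qed simp

lemma nsmooth_mult: "nsmooth n f \<Longrightarrow> nsmooth n g \<Longrightarrow> nsmooth n (\<lambda>x. f x * g x)"
proof (induction n arbitrary: f g)
  case (Suc n)
  show ?case
  proof (rule nsmooth_DERIV_I)
    show "DERIV (\<lambda>x. f x * g x) x :> deriv f x * g x + deriv g x * f x" for x
      using Suc.prems by (intro DERIV_mult nsmooth_SucE)
    show "nsmooth n (\<lambda>x. deriv f x * g x + deriv g x * f x)"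
      using Suc.prems nsmooth_SucD[OF Suc.prems(1)] nsmooth_SucD[OF Suc.prems(2)]
      by (intro nsmooth_add Suc.IH) auto
  qed
qed simp

lemma nsmooth_affine: "nsmooth n f \<Longrightarrow> nsmooth n (\<lambda>x. f (c * x + d))"
proof (induction n arbitrary: f)
  case (Suc n)
  show ?case
  proof (rule nsmooth_DERIV_I)
    show "DERIV (\<lambda>x. f (c * x + d)) x :> deriv f (c * x + d) * c" for x
      by (rule DERIV_chain2[OF nsmooth_SucE[OF Suc.prems]]) (auto intro!: derivative_eq_intros)
    show "nsmooth n (\<lambda>x. deriv f (c * x + d) * c)"
      using Suc by (intro nsmooth_mult nsmooth_const) auto
  qed
qed simp

text \<open>\<open>flat 0\<close> is the standard flat function exp (-1/x). The powers of 1/x close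
  the family under differentiation, so that smoothness is one induction for all k.\<close>

definition flat :: "nat \<Rightarrow> real \<Rightarrow> real" where
  "flat k x = (if x > 0 then inverse x ^ k * exp (- inverse x) else 0)"

lemma DERIV_flat: "DERIV (flat k) x :> flat (k + 2) x - real k * flat (k + 1) x"
proof -
  have off: "DERIV (flat k) x :> flat (k + 2) x - real k * flat (k + 1) x" if "x \<noteq> 0" for k x
  proof (cases "x > 0")
    case True
    have "DERIV (\<lambda>x. inverse x ^ k * exp (- inverse x)) x :>
       (real k * inverse x ^ (k - 1) * (- (inverse x)\<^sup>2)) * exp (- inverse x) + inverse x ^ k * (exp (- inverse x) * (inverse x)\<^sup>2)"
      using True by (auto intro!: derivative_eq_intros simp: power2_eq_square)
    moreover have "(real k * inverse x ^ (k - 1) * (- (inverse x)\<^sup>2)) * exp (- inverse x) + inverse x ^ k * (exp (- inverse x) * (inverse x)\<^sup>2)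
        = flat (k + 2) x - real k * flat (k + 1) x"
      using True by (cases k) (simp_all add: flat_def power2_eq_square algebra_simps)
    ultimately have "DERIV (\<lambda>x. inverse x ^ k * exp (- inverse x)) x :> flat (k + 2) x - real k * flat (k + 1) x"
      by simp
    then show ?thesis
      by (rule DERIV_cong_open[where S="{0<..}"]) (use True in \<open>auto simp: flat_def\<close>)
  next
    case False
    then have "flat (k + 2) x - real k * flat (k + 1) x = 0" by (simp add: flat_def)
    moreover have "DERIV (flat k) x :> 0"
      by (rule DERIV_cong_open[of "\<lambda>_. 0" _ _ "{..<0}"]) (use False that in \<open>auto simp: flat_def\<close>)
    ultimately show ?thesis by simp
  qed
  have c0: "isCont (flat k) 0" for k
  proof -
    have "((\<lambda>x. inverse x ^ k / exp (inverse x)) \<longlongrightarrow> 0) (at_right (0::real))"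
      by (rule filterlim_compose[OF tendsto_power_div_exp_0 filterlim_inverse_at_top_right])
    then have r: "(flat k \<longlongrightarrow> 0) (at_right 0)"
      by (rule Lim_transform_eventually)
        (auto simp: eventually_at_filter flat_def exp_minus divide_inverse)
    have "(flat k \<longlongrightarrow> 0) (at_left 0)"
      by (rule Lim_transform_eventually[OF tendsto_const]) (auto simp: eventually_at_filter flat_def)
    with r show ?thesis by (simp add: isCont_def filterlim_at_split flat_def)
  qed
  have c: "isCont (flat k) x" for k x
    using c0 DERIV_isCont[OF off] by (cases "x = 0") auto
  show ?thesis
  proof (rule DERIV_removable_point[where a=0 and f="flat k" and g="\<lambda>x. flat (k + 2) x - real k * flat (k + 1) x"])
    show "isCont (\<lambda>x. flat (k + 2) x - real k * flat (k + 1) x) x" for x by (intro continuous_intros c)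
    show "DERIV (flat k) x :> flat (k + 2) x - real k * flat (k + 1) x" if "x \<noteq> 0" for x
      by (rule off[OF that])
  qed (rule c)
qed

lemma nsmooth_flat: "nsmooth n (flat k)"
proof (induction n arbitrary: k)
  case (Suc n)
  have "nsmooth n (\<lambda>x. flat (k + 2) x + (- real k) * flat (k + 1) x)"
    by (intro nsmooth_add nsmooth_mult nsmooth_const Suc)
  then show ?case by (intro nsmooth_DERIV_I[OF DERIV_flat]) simp
qed simp

text \<open>The factor n + 1 steepens the flanks without moving the support. The bumps stay below 1
  and tend to the indicator of (a,b); they play the role of mollified indicators.\<close>

definition bump :: "real \<Rightarrow> real \<Rightarrow> nat \<Rightarrow> real \<Rightarrow> real" where
  "bump a b n x = flat 0 (real (Suc n) * (x - a)) * flat 0 (real (Suc n) * (b - x))"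

lemma nsmooth_bump: "nsmooth k (bump a b n)"
proof -
  have "nsmooth k (\<lambda>x. flat 0 (real (Suc n) * x + real (Suc n) * - a) * flat 0 ((- real (Suc n)) * x + real (Suc n) * b))"
    by (intro nsmooth_mult nsmooth_affine nsmooth_flat)
  moreover have "bump a b n = (\<lambda>x. flat 0 (real (Suc n) * x + real (Suc n) * - a) * flat 0 ((- real (Suc n)) * x + real (Suc n) * b))"
    by (rule ext) (simp add: bump_def algebra_simps)
  ultimately show ?thesis by simp
qed

lemma flat0_bounds: "0 \<le> flat 0 x" "flat 0 x \<le> 1"
  by (auto simp: flat_def)

lemma bump_nonneg: "0 \<le> bump a b n x" and bump_le_1: "bump a b n x \<le> 1"
  unfolding bump_def by (auto intro!: mult_nonneg_nonneg mult_le_one flat0_bounds)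

lemma bump_outside: "x \<notin> {a<..<b} \<Longrightarrow> bump a b n x = 0"
  by (auto simp: bump_def flat_def zero_less_mult_iff)

lemma bump_pos: "x \<in> {a<..<b} \<Longrightarrow> bump a b n x > 0"
  by (auto simp: bump_def flat_def zero_less_mult_iff)

lemma isCont_bump: "isCont (bump a b n) x"
  using nsmooth_SucE[OF nsmooth_bump[of "Suc 0"]] DERIV_isCont by blast

lemma continuous_on_bump: "continuous_on S (bump a b n)"
  by (simp add: continuous_at_imp_continuous_on isCont_bump)

lemma flat0_LIMSEQ: "y > 0 \<Longrightarrow> (\<lambda>n. flat 0 (real (Suc n) * y)) \<longlonglongrightarrow> 1"
proof -
  assume y: "y > 0"
  have "(\<lambda>n. exp (- (inverse (real (Suc n)) * inverse y))) \<longlonglongrightarrow> exp (- (0 * inverse y))"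
    by (intro tendsto_intros LIMSEQ_inverse_real_of_nat)
  then show ?thesis using y by (simp add: flat_def zero_less_mult_iff)
qed

lemma bump_LIMSEQ: "(\<lambda>n. bump a b n x) \<longlonglongrightarrow> indicator {a<..<b} x"
proof (cases "x \<in> {a<..<b}")
  case True
  then have "(\<lambda>n. bump a b n x) \<longlonglongrightarrow> 1 * 1"
    unfolding bump_def by (intro tendsto_mult flat0_LIMSEQ) auto
  then show ?thesis using True by simp
qed (simp add: bump_outside)

text \<open>The sign makes this the oriented integral from 0 to x; \<open>integral {0..x} f\<close>
  alone is 0 for x < 0.\<close>

definition prim :: "(real \<Rightarrow> real) \<Rightarrow> real \<Rightarrow> real" where
  "prim f x = (if x \<ge> 0 then integral {0..x} f else - integral {x..0} f)"

lemma prim_diff: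
  assumes f: "\<And>a b. f integrable_on {a..b}" and "a \<le> b"
  shows "prim f b - prim f a = integral {a..b} f"
proof -
  have comb: "integral {a..c} f + integral {c..b} f = integral {a..b} f" if "a \<le> c" "c \<le> b" for a b c
    by (rule Henstock_Kurzweil_Integration.integral_combine[OF that f])
  consider "0 \<le> a" | "b < 0" | "a < 0" "0 \<le> b" using \<open>a \<le> b\<close> by linarith
  then show ?thesis
    by cases (use comb[of 0 a b] comb[of a b 0] comb[of a 0 b] \<open>a \<le> b\<close> in \<open>auto simp: prim_def\<close>)
qed

lemma isCont_prim:
  assumes f: "\<And>a b. f integrable_on {a..b}"
  shows "isCont (prim f) x"
proof -
  have eq: "prim f y = prim f (x - 1) + integral {x-1..y} f" if "x - 1 \<le> y" for y
    using prim_diff[OF f that] by simp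
  have "continuous_on {x-1..x+1} (\<lambda>y. prim f (x - 1) + integral {x-1..y} f)"
    by (intro continuous_intros indefinite_integral_continuous_1 f)
  moreover have "continuous_on {x-1..x+1} (prim f) = continuous_on {x-1..x+1} (\<lambda>y. prim f (x - 1) + integral {x-1..y} f)"
    by (rule continuous_on_cong[OF refl eq]) simp
  ultimately show ?thesis by (auto intro: continuous_on_interior)
qed

lemma DERIV_prim:
  assumes f: "\<And>x. isCont f x"
  shows "DERIV (prim f) x :> f x"
proof -
  have c: "continuous_on S f" for S using f by (simp add: continuous_at_imp_continuous_on)
  have i: "f integrable_on {a..b}" for a b by (intro integrable_continuous_interval c)
  have "((\<lambda>y. integral {x-1..y} f) has_real_derivative f x) (at x within {x-1..x+1})"
    by (rule integral_has_real_derivative[OF c]) auto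
  moreover have "at x within {x-1..x+1} = at x" by (intro at_within_interior) auto
  ultimately have "DERIV (\<lambda>y. prim f (x - 1) + integral {x-1..y} f) x :> 0 + f x"
    by (intro derivative_intros) auto
  then have d: "DERIV (\<lambda>y. prim f (x - 1) + integral {x-1..y} f) x :> f x" by simp
  show ?thesis
  proof (rule DERIV_cong_open[OF d])
    show "open {x-1<..<x+1}" "x \<in> {x-1<..<x+1}" by auto
    show "prim f y = prim f (x - 1) + integral {x-1..y} f" if "y \<in> {x-1<..<x+1}" for y
      using prim_diff[OF i, of "x - 1" y] that by auto
  qed
qed

definition bump_mass :: "real \<Rightarrow> real \<Rightarrow> nat \<Rightarrow> real" where
  "bump_mass a b n = integral UNIV (bump a b n)"

lemma bump_integral:
  assumes "L \<le> a" "b \<le> R"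
  shows "integral {L..R} (bump a b n) = bump_mass a b n"
proof -
  have "integral {L..R} (bump a b n) = integral UNIV (\<lambda>x. if x \<in> {L..R} then bump a b n x else 0)"
    by (rule integral_restrict_UNIV[symmetric])
  also have "(\<lambda>x. if x \<in> {L..R} then bump a b n x else 0) = bump a b n"
    using assms bump_outside[of _ a b n] by fastforce
  finally show ?thesis by (simp add: bump_mass_def)
qed

lemma bump_mass_pos: "a < b \<Longrightarrow> bump_mass a b n > 0"
proof -
  assume ab: "a < b"
  have "0 \<le> integral {a..b} (bump a b n)"
    by (intro integral_nonneg integrable_continuous_interval continuous_on_bump bump_nonneg)
  moreover have "integral {a..b} (bump a b n) \<noteq> 0"
  proof
    assume "integral {a..b} (bump a b n) = 0"
    then have "(bump a b n has_integral 0) {a..b}"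
      using integrable_continuous_interval[OF continuous_on_bump] by (metis integrable_integral)
    then have "bump a b n ((a + b) / 2) = 0"
      using has_integral_0_cbox_imp_0[of a b "bump a b n" "(a+b)/2"] continuous_on_bump bump_nonneg ab by auto
    then show False using bump_pos[of "(a+b)/2" a b n] ab by auto
  qed
  ultimately show ?thesis using bump_integral[of a a b b n] by simp
qed

lemma bump_mass_LIMSEQ: "a < b \<Longrightarrow> bump_mass a b \<longlonglongrightarrow> b - a"
proof -
  assume ab: "a < b"
  have "(\<lambda>n. integral {a..b} (bump a b n)) \<longlonglongrightarrow> integral {a..b} (indicator {a<..<b})"
  proof (rule dominated_convergence(2))
    show "bump a b n integrable_on {a..b}" for n
      by (intro integrable_continuous_interval continuous_on_bump)
    show "(\<lambda>_. 1 :: real) integrable_on {a..b}" by (rule integrable_const_ivl)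
    show "norm (bump a b n x) \<le> 1" for n x using bump_nonneg[of a b n x] bump_le_1[of a b n x] by simp
  qed (rule bump_LIMSEQ)
  moreover have "integral {a..b} (indicator {a<..<b} :: real \<Rightarrow> real) = b - a"
  proof -
    have "((\<lambda>x. 1::real) has_integral (b - a)) {a..b}" using has_integral_const_real[of "1::real" a b] ab by simp
    then have "(indicator {a<..<b} has_integral (b - a)) {a..b}"
      by (rule has_integral_spike_finite[of "{a,b}", rotated 2]) auto
    then show ?thesis by (rule integral_unique)
  qed
  ultimately show ?thesis using bump_integral[of a a b b] by simp
qed

text \<open>A countable family of test functions rich enough to identify primitives: their
  derivatives approximate indicator functions of intervals, corrected by a multiple of a fixed
  bump so that the integral vanishes.\<close>
definition test_deriv :: "real \<Rightarrow> real \<Rightarrow> nat \<Rightarrow> real \<Rightarrow> real" where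
  "test_deriv a b n x = bump a b n x - bump_mass a b n / bump_mass 0 1 0 * bump 0 1 0 x"

text \<open>The constant is fixed at the left end of both bumps, so the function vanishes to the
  left of it; it vanishes to the right because the two masses in \<open>test_deriv\<close>
  cancel.\<close>

definition test_fun :: "real \<Rightarrow> real \<Rightarrow> nat \<Rightarrow> real \<Rightarrow> real" where
  "test_fun a b n x = prim (test_deriv a b n) x - prim (test_deriv a b n) (min a 0)"

lemma nsmooth_test_deriv: "nsmooth k (test_deriv a b n)"
proof -
  have "nsmooth k (\<lambda>x. bump a b n x + (- (bump_mass a b n / bump_mass 0 1 0)) * bump 0 1 0 x)"
    by (intro nsmooth_add nsmooth_mult nsmooth_const nsmooth_bump)
  then show ?thesis by (simp add: test_deriv_def[abs_def])
qed

lemma isCont_test_deriv: "isCont (test_deriv a b n) x"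
  unfolding test_deriv_def[abs_def] by (intro continuous_intros isCont_bump)

lemma DERIV_test_fun: "DERIV (test_fun a b n) x :> test_deriv a b n x"
proof -
  have "DERIV (\<lambda>x. prim (test_deriv a b n) x - prim (test_deriv a b n) (min a 0)) x :> test_deriv a b n x - 0"
    by (intro derivative_intros DERIV_prim isCont_test_deriv)
  then show ?thesis by (simp add: test_fun_def[abs_def])
qed

lemma smooth_test_fun: "smooth (test_fun a b n)"
proof -
  have "nsmooth k (test_fun a b n)" for k
    by (rule nsmooth_SucD[OF nsmooth_DERIV_I[OF DERIV_test_fun nsmooth_test_deriv]])
  then show ?thesis by (simp add: smooth_iff_nsmooth)
qed

lemma isCont_test_fun: "isCont (test_fun a b n) x"
  by (rule DERIV_isCont[OF DERIV_test_fun])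

lemma test_deriv_outside: "x \<notin> {min a 0..max b 1} \<Longrightarrow> test_deriv a b n x = 0"
proof -
  assume "x \<notin> {min a 0..max b 1}"
  then have "x \<notin> {a<..<b}" "x \<notin> {0<..<1}" by auto
  then show ?thesis by (simp add: test_deriv_def bump_outside)
qed

lemma test_fun_outside:
  assumes "x \<notin> {min a 0..max b 1}"
  shows "test_fun a b n x = 0"
proof -
  let ?k = "test_deriv a b n"
  have i: "?k integrable_on {x..y}" for x y
    by (intro integrable_continuous_interval continuous_at_imp_continuous_on ballI isCont_test_deriv)
  consider "x < min a 0" | "x > max b 1" "min a 0 \<le> x" using assms by fastforce
  then show ?thesis
  proof cases
    case 1
    have "integral {x..min a 0} ?k = integral {x..min a 0} (\<lambda>_. 0)"
      using 1 bump_outside[of _ a b n] bump_outside[of _ 0 1 0] by (intro integral_cong) (auto simp: test_deriv_def)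
    then show ?thesis using prim_diff[OF i, of x "min a 0"] 1 by (simp add: test_fun_def)
  next
    case 2
    have "integral {min a 0..x} ?k = integral {min a 0..x} (bump a b n)
        - bump_mass a b n / bump_mass 0 1 0 * integral {min a 0..x} (bump 0 1 0)"
      unfolding test_deriv_def
      by (simp only: Henstock_Kurzweil_Integration.integral_diff integrable_continuous_interval
          integrable_on_mult_right continuous_on_bump integral_mult_right)
    also have "\<dots> = 0"
      using bump_integral[of "min a 0" a b x n] bump_integral[of "min a 0" 0 1 x 0] 2 bump_mass_pos[of 0 1 0] by simp
    finally show ?thesis using prim_diff[OF i, of "min a 0" x] 2 by (simp add: test_fun_def)
  qed
qed

section \<open>Locally integrable functions and their primitives\<close>

lemma absolutely_integrable_on_Icc_iff:
  "f absolutely_integrable_on {a..b::real} \<longleftrightarrow> integrable (lebesgue_on {a..b}) f"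
  by (simp add: set_integrable_def integrable_restrict_space)

lemma locally_integrableD:
  assumes "locally_integrable u"
  shows "integrable (lebesgue_on {a..b}) u" "u absolutely_integrable_on {a..b}" "u integrable_on {a..b}"
proof -
  define J where "J = max \<bar>a\<bar> \<bar>b\<bar>"
  have "integrable (lebesgue_on {-J..J}) u" using assms by (simp add: locally_integrable_def)
  then have "u absolutely_integrable_on {-J..J}" by (simp add: absolutely_integrable_on_Icc_iff)
  then show "u absolutely_integrable_on {a..b}"
    by (rule absolutely_integrable_on_subinterval) (auto simp: J_def)
  then show "integrable (lebesgue_on {a..b}) u" "u integrable_on {a..b}"
    by (auto simp: absolutely_integrable_imp_integrable set_lebesgue_integral_eq_integral)
qed

lemma locally_integrableI: "(\<And>a b. u absolutely_integrable_on {a..b}) \<Longrightarrow> locally_integrable u"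
  by (simp add: locally_integrable_def absolutely_integrable_imp_integrable)

lemma locally_integrable_continuous: "(\<And>x. isCont u x) \<Longrightarrow> locally_integrable u"
  by (intro locally_integrableI absolutely_integrable_continuous_real) (simp add: continuous_at_imp_continuous_on)

lemma locally_integrable_diff: "locally_integrable u \<Longrightarrow> locally_integrable v \<Longrightarrow> locally_integrable (\<lambda>x. u x - v x)"
  by (simp add: locally_integrable_def)

lemma locally_integrable_measurable:
  assumes "locally_integrable u"
  shows "u \<in> borel_measurable lebesgue"
proof (rule borel_measurable_LIMSEQ_metric)
  show "(\<lambda>x. if x \<in> {-real n..real n} then u x else 0) \<in> borel_measurable lebesgue" for n
  proof -
    have "integrable lebesgue (\<lambda>x. if x \<in> {-real n..real n} then u x else 0)"
      using locally_integrableD(1)[OF assms] by (subst Lebesgue_Measure.integrable_restrict_UNIV) simp_all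
    then show ?thesis by (rule borel_measurable_integrable)
  qed
  show "(\<lambda>n. if x \<in> {-real n..real n} then u x else 0) \<longlonglongrightarrow> u x" for x
  proof (rule tendsto_eventually)
    obtain N where N: "\<bar>x\<bar> \<le> real N" using real_arch_simple by blast
    show "\<forall>\<^sub>F n in sequentially. (if x \<in> {-real n..real n} then u x else 0) = u x"
      using eventually_ge_at_top[of N] by eventually_elim (use N in auto)
  qed
qed

lemma locally_integrable_mult_continuous:
  assumes u: "locally_integrable u" and \<psi>: "\<And>x. isCont \<psi> x"
  shows "locally_integrable (\<lambda>x. u x * \<psi> x)"
proof (rule locally_integrableI)
  fix a b :: real
  have c: "continuous_on {a..b} \<psi>" using \<psi> by (simp add: continuous_at_imp_continuous_on)
  then have "(\<lambda>x. \<psi> x * u x) absolutely_integrable_on {a..b}"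
    by (intro absolutely_integrable_bounded_measurable_product_real locally_integrableD[OF u]
        continuous_imp_measurable_on_sets_lebesgue compact_imp_bounded compact_continuous_image) auto
  then show "(\<lambda>x. u x * \<psi> x) absolutely_integrable_on {a..b}" by (simp add: mult.commute)
qed

lemma compact_support_integral:
  assumes u: "locally_integrable u" and z: "\<And>x. x \<notin> {a..b} \<Longrightarrow> u x = 0"
  shows "integrable lebesgue u" "(\<integral>x. u x \<partial>lebesgue) = integral {a..b} u"
proof -
  have eq: "(\<lambda>x. if x \<in> {a..b} then u x else 0) = u" using z by fastforce
  have i: "integrable (lebesgue_on {a..b}) u" using locally_integrableD[OF u] by auto
  show "integrable lebesgue u"
    using Lebesgue_Measure.integrable_restrict_UNIV[of "{a..b}" u] i unfolding eq by simp
  show "(\<integral>x. u x \<partial>lebesgue) = integral {a..b} u"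
    using Lebesgue_Measure.integral_restrict_UNIV[of "{a..b}" u] lebesgue_integral_eq_integral[OF i]
    unfolding eq by simp
qed

text \<open>Lebesgue differentiation: outside a null set the averages of k over [x, x + h] converge
  to k x, and here they are all 0.\<close>

lemma AE_eq_0_of_integral_eq_0:
  fixes k :: "real \<Rightarrow> real"
  assumes k: "\<And>a b. k integrable_on {a..b}" and z: "\<And>a b. a < b \<Longrightarrow> integral {a..b} k = 0"
  shows "AE x in lebesgue. k x = 0"
proof -
  obtain N where N: "negligible N"
    and lim: "\<And>x e. x \<notin> N \<Longrightarrow> 0 < e \<Longrightarrow> \<exists>d>0. \<forall>h. 0 < h \<and> h < d \<longrightarrow>
      norm (integral (cbox x (x + h *\<^sub>R One)) k /\<^sub>R h ^ DIM(real) - k x) < e"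
    using integrable_ccontinuous_explicit[of k] k by (auto simp: box_real)
  have "k x = 0" if xN: "x \<notin> N" for x
  proof (rule ccontr)
    assume "k x \<noteq> 0"
    then obtain d where d: "d > 0" "\<And>h. 0 < h \<Longrightarrow> h < d \<Longrightarrow>
      norm (integral (cbox x (x + h *\<^sub>R One)) k /\<^sub>R h ^ DIM(real) - k x) < \<bar>k x\<bar>"
      using lim[OF xN, of "\<bar>k x\<bar>"] by auto
    have "integral (cbox x (x + (d/2) *\<^sub>R One)) k = 0" using z[of x "x + d/2"] d by simp
    then show False using d(2)[of "d/2"] d(1) by simp
  qed
  then have "{x. k x \<noteq> 0} \<subseteq> N" by auto
  then have "negligible {x. k x \<noteq> 0}" using N negligible_subset by blast
  then show ?thesis by (simp add: negligible_iff_null_sets eventually_ae_filter) (metis (mono_tags) mem_Collect_eq subsetI)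
qed

lemma bump_integral_LIMSEQ:
  assumes k: "locally_integrable k"
  shows "(\<lambda>n. \<integral>x. k x * bump a b n x \<partial>lebesgue) \<longlonglongrightarrow> integral {a..b} k"
proof -
  have li: "locally_integrable (\<lambda>x. k x * bump a b n x)" for n
    by (rule locally_integrable_mult_continuous[OF k isCont_bump])
  have eq: "(\<integral>x. k x * bump a b n x \<partial>lebesgue) = integral {a..b} (\<lambda>x. k x * bump a b n x)" for n
    by (rule compact_support_integral[OF li]) (auto simp: bump_outside)
  have "(\<lambda>n. integral {a..b} (\<lambda>x. k x * bump a b n x)) \<longlonglongrightarrow> integral {a..b} (\<lambda>x. k x * indicator {a<..<b} x)"
  proof (rule dominated_convergence(2))
    show "(\<lambda>x. k x * bump a b n x) integrable_on {a..b}" for n by (rule locally_integrableD[OF li])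
    show "(\<lambda>x. \<bar>k x\<bar>) integrable_on {a..b}"
      using locally_integrableD(2)[OF k, of a b] by (simp add: absolutely_integrable_on_def)
    show "norm (k x * bump a b n x) \<le> \<bar>k x\<bar>" for n x
      using mult_left_mono[OF bump_le_1[of a b n x], of "\<bar>k x\<bar>"] bump_nonneg[of a b n x] by (simp add: abs_mult)
    show "(\<lambda>n. k x * bump a b n x) \<longlonglongrightarrow> k x * indicator {a<..<b} x" for x
      by (intro tendsto_intros bump_LIMSEQ)
  qed
  moreover have "integral {a..b} (\<lambda>x. k x * indicator {a<..<b} x) = integral {a..b} k"
    by (rule integral_spike[of "{a,b}"]) auto
  ultimately show ?thesis by (simp add: eq)
qed

text \<open>Fubini for u(x) v(y) on the square [a,b]^2: the diagonal cuts it into two triangles,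
  whose integrals are those of u times the primitive of v and of v times the primitive of u;
  together they give the product of the total masses. This works for merely integrable u and
  v.\<close>

lemma AC_integration_by_parts:
  fixes u v A B :: "real \<Rightarrow> real"
  assumes ab: "a \<le> b" and u: "integrable (lebesgue_on {a..b}) u" and v: "integrable (lebesgue_on {a..b}) v"
    and A: "\<And>x. x \<in> {a..b} \<Longrightarrow> A x = A a + integral {a..x} u"
    and B: "\<And>x. x \<in> {a..b} \<Longrightarrow> B x = B a + integral {a..x} v"
  shows "integrable (lebesgue_on {a..b}) (\<lambda>x. u x * B x + A x * v x)"
    "(\<integral>x. u x * B x + A x * v x \<partial>lebesgue_on {a..b}) = A b * B b - A a * B a"
proof -
  define M where "M = lebesgue_on {a..b}"
  interpret M: finite_measure M unfolding M_def by (intro finite_measure_lebesgue_on) auto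
  interpret P: pair_sigma_finite M M ..
  have sp: "space M = {a..b}" by (simp add: M_def)
  have uM: "integrable M u" and vM: "integrable M v" using u v by (auto simp: M_def)
  have idM: "(\<lambda>x. x) \<in> borel_measurable M"
    unfolding M_def by (intro measurable_restrict_space1) (simp add: measurable_completion)
  have [measurable]: "u \<in> borel_measurable M" "v \<in> borel_measurable M" "(\<lambda>x. x) \<in> borel_measurable M"
    using uM vM idM by auto
  have fst_m: "(\<lambda>p. fst p) \<in> borel_measurable (M \<Otimes>\<^sub>M M)" "(\<lambda>p. snd p) \<in> borel_measurable (M \<Otimes>\<^sub>M M)"
    using measurable_compose[OF measurable_fst idM] measurable_compose[OF measurable_snd idM] by auto
  have le_set: "Measurable.pred (M \<Otimes>\<^sub>M M) (\<lambda>p. snd p \<le> fst p)"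
    using fst_m by measurable
  have prod_int: "integrable (M \<Otimes>\<^sub>M M) (\<lambda>(x, y). u x * v y)"
  proof (rule P.Fubini_integrable)
    have "(\<lambda>x. \<integral>y. norm (case (x, y) of (x, y) \<Rightarrow> u x * v y) \<partial>M) = (\<lambda>x. \<bar>u x\<bar> * (\<integral>y. \<bar>v y\<bar> \<partial>M))"
      by (simp add: abs_mult)
    then show "integrable M (\<lambda>x. \<integral>y. norm (case (x, y) of (x, y) \<Rightarrow> u x * v y) \<partial>M)"
      using uM by simp
  qed (use vM in auto)
  \<comment> \<open>The diagonal belongs to the first triangle. In the second, the strict inequality
    costs one point of each slice, a null set.\<close>
  let ?f = "\<lambda>(x, y). u x * v y * (if y \<le> x then 1 else 0)"
  let ?g = "\<lambda>(x, y). u x * v y * (if y \<le> x then 0 else 1)"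
  have fi: "integrable (M \<Otimes>\<^sub>M M) ?f"
    by (rule Bochner_Integration.integrable_bound[OF prod_int]) (use le_set in \<open>auto simp: case_prod_beta\<close>)
  have gi: "integrable (M \<Otimes>\<^sub>M M) ?g"
    by (rule Bochner_Integration.integrable_bound[OF prod_int]) (use le_set in \<open>auto simp: case_prod_beta\<close>)
  have int_le: "(\<integral>y. k y * (if y \<le> x then 1 else 0) \<partial>M) = integral {a..x} k"
    if k: "integrable M k" and x: "x \<in> {a..b}" for k :: "real \<Rightarrow> real" and x :: real
  proof -
    have "integrable M (\<lambda>y. k y * (if y \<le> x then 1 else 0))"
      by (rule Bochner_Integration.integrable_bound[OF k]) (use k in auto)
    then have "(\<integral>y. k y * (if y \<le> x then 1 else 0) \<partial>M) = integral {a..b} (\<lambda>y. k y * (if y \<le> x then 1 else 0))"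
      unfolding M_def by (intro lebesgue_integral_eq_integral) auto
    also have "\<dots> = integral {a..b} (\<lambda>y. if y \<in> {a..x} then k y else 0)"
      by (intro integral_cong) auto
    also have "\<dots> = integral {a..x} k"
    proof -
      have e: "{a..x} \<inter> {a..b} = {a..x}" using x by auto
      show ?thesis using Henstock_Kurzweil_Integration.integral_restrict_Int[of "{a..b}" "{a..x}" k] unfolding e .
    qed
    finally show ?thesis .
  qed
  have int_lt: "(\<integral>y. k y * (if x \<le> y then 0 else 1) \<partial>M) = integral {a..x} k"
    if k: "integrable M k" and x: "x \<in> {a..b}" for k :: "real \<Rightarrow> real" and x :: real
  proof -
    have "integrable M (\<lambda>y. k y * (if x \<le> y then 0 else 1))"
      by (rule Bochner_Integration.integrable_bound[OF k]) (use k in auto)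
    then have "(\<integral>y. k y * (if x \<le> y then 0 else 1) \<partial>M) = integral {a..b} (\<lambda>y. k y * (if x \<le> y then 0 else 1))"
      unfolding M_def by (intro lebesgue_integral_eq_integral) auto
    also have "\<dots> = integral {a..b} (\<lambda>y. if y \<in> {a..x} then k y else 0)"
      by (rule integral_spike[of "{x}"]) auto
    also have "\<dots> = integral {a..x} k"
    proof -
      have e: "{a..x} \<inter> {a..b} = {a..x}" using x by auto
      show ?thesis using Henstock_Kurzweil_Integration.integral_restrict_Int[of "{a..b}" "{a..x}" k] unfolding e .
    qed
    finally show ?thesis .
  qed
  have F1: "integrable M (\<lambda>x. u x * integral {a..x} v)"
    "(\<integral>x. u x * integral {a..x} v \<partial>M) = (\<integral>p. ?f p \<partial>(M \<Otimes>\<^sub>M M))"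
  proof -
    have eq: "(\<integral>y. u x * v y * (if y \<le> x then 1 else 0) \<partial>M) = u x * integral {a..x} v" if "x \<in> space M" for x
      using int_le[OF vM, of x] that by (simp add: sp mult.assoc)
    have "integrable M (\<lambda>x. \<integral>y. ?f (x, y) \<partial>M)" by (rule P.integrable_fst'[OF fi])
    then show "integrable M (\<lambda>x. u x * integral {a..x} v)"
      using eq by (subst Bochner_Integration.integrable_cong[OF refl, symmetric]) auto
    show "(\<integral>x. u x * integral {a..x} v \<partial>M) = (\<integral>p. ?f p \<partial>(M \<Otimes>\<^sub>M M))"
      using P.integral_fst'[OF fi] eq by (simp cong: Bochner_Integration.integral_cong)
  qed
  have F2: "integrable M (\<lambda>y. v y * integral {a..y} u)"
    "(\<integral>y. v y * integral {a..y} u \<partial>M) = (\<integral>p. ?g p \<partial>(M \<Otimes>\<^sub>M M))"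
  proof -
    have eq: "(\<integral>x. u x * v y * (if y \<le> x then 0 else 1) \<partial>M) = v y * integral {a..y} u" if "y \<in> space M" for y
    proof -
      have "(\<integral>x. u x * v y * (if y \<le> x then 0 else 1) \<partial>M) = (\<integral>x. v y * (u x * (if y \<le> x then 0 else 1)) \<partial>M)"
        by (simp add: mult_ac)
      also have "\<dots> = v y * (\<integral>x. u x * (if y \<le> x then 0 else 1) \<partial>M)" by (rule integral_mult_right_zero)
      finally show ?thesis using int_lt[OF uM, of y] that by (simp add: sp)
    qed
    have "integrable M (\<lambda>y. \<integral>x. ?g (x, y) \<partial>M)"
      by (rule P.integrable_snd) (use gi in simp)
    then show "integrable M (\<lambda>y. v y * integral {a..y} u)"
      using eq by (subst Bochner_Integration.integrable_cong[OF refl, symmetric]) auto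
    have "(\<integral>y. (\<integral>x. ?g (x, y) \<partial>M) \<partial>M) = (\<integral>p. ?g p \<partial>(M \<Otimes>\<^sub>M M))"
      using P.integral_snd[of "\<lambda>x y. ?g (x, y)"] gi by simp
    then show "(\<integral>y. v y * integral {a..y} u \<partial>M) = (\<integral>p. ?g p \<partial>(M \<Otimes>\<^sub>M M))"
      using eq by (simp cong: Bochner_Integration.integral_cong)
  qed
  have sum: "(\<integral>p. ?f p \<partial>(M \<Otimes>\<^sub>M M)) + (\<integral>p. ?g p \<partial>(M \<Otimes>\<^sub>M M)) = (\<integral>x. u x \<partial>M) * (\<integral>y. v y \<partial>M)"
  proof -
    have "(\<integral>p. ?f p \<partial>(M \<Otimes>\<^sub>M M)) + (\<integral>p. ?g p \<partial>(M \<Otimes>\<^sub>M M)) = (\<integral>p. ?f p + ?g p \<partial>(M \<Otimes>\<^sub>M M))"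
      using fi gi by simp
    also have "\<dots> = (\<integral>(x, y). u x * v y \<partial>(M \<Otimes>\<^sub>M M))"
      by (intro Bochner_Integration.integral_cong) auto
    also have "\<dots> = (\<integral>x. (\<integral>y. u x * v y \<partial>M) \<partial>M)"
      using P.integral_fst'[OF prod_int] by simp
    finally show ?thesis by simp
  qed
  have tot: "(\<integral>x. u x \<partial>M) = A b - A a" "(\<integral>x. v x \<partial>M) = B b - B a"
    using A[of b] B[of b] ab lebesgue_integral_eq_integral[OF u] lebesgue_integral_eq_integral[OF v]
    by (auto simp: M_def)
  have rep: "u x * B x + A x * v x = B a * u x + u x * integral {a..x} v + (A a * v x + v x * integral {a..x} u)"
    if "x \<in> space M" for x
    using that A[of x] B[of x] by (simp add: sp algebra_simps)
  have I: "integrable M (\<lambda>x. B a * u x + u x * integral {a..x} v + (A a * v x + v x * integral {a..x} u))"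
    using uM vM F1(1) F2(1) by auto
  show "integrable (lebesgue_on {a..b}) (\<lambda>x. u x * B x + A x * v x)"
    using I rep unfolding M_def[symmetric] by (subst Bochner_Integration.integrable_cong[OF refl rep]) auto
  have "(\<integral>x. u x * B x + A x * v x \<partial>M) =
     (\<integral>x. B a * u x + u x * integral {a..x} v + (A a * v x + v x * integral {a..x} u) \<partial>M)"
    by (intro Bochner_Integration.integral_cong refl rep)
  also have "\<dots> = B a * (\<integral>x. u x \<partial>M) + (\<integral>x. u x * integral {a..x} v \<partial>M)
      + (A a * (\<integral>x. v x \<partial>M) + (\<integral>x. v x * integral {a..x} u \<partial>M))"
    using uM vM F1(1) F2(1) by simp
  also have "\<dots> = A b * B b - A a * B a"
  proof -
    have "(\<integral>x. u x * integral {a..x} v \<partial>M) + (\<integral>x. v x * integral {a..x} u \<partial>M) = (A b - A a) * (B b - B a)"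
      using sum unfolding F1(2)[symmetric] F2(2)[symmetric] tot .
    then show ?thesis unfolding tot by (simp add: algebra_simps)
  qed
  finally show "(\<integral>x. u x * B x + A x * v x \<partial>lebesgue_on {a..b}) = A b * B b - A a * B a"
    by (simp add: M_def)
qed

lemma prim_integrable_diff:
  assumes "locally_integrable u" "a \<le> b"
  shows "prim u b = prim u a + integral {a..b} u"
  using prim_diff[of u a b] locally_integrableD(3)[OF assms(1)] assms(2) by simp

lemma isCont_prim_locally_integrable: "locally_integrable u \<Longrightarrow> isCont (prim u) x"
  by (rule isCont_prim) (rule locally_integrableD)

lemma prim_parts_test_fun:
  assumes u: "locally_integrable u" and B: "\<And>x. DERIV B x :> v x" and v: "\<And>x. isCont v x"
    and A: "\<And>x y. x \<le> y \<Longrightarrow> A y = A x + integral {x..y} u"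
    and z: "\<And>x. x \<notin> {L..R} \<Longrightarrow> B x = 0"
  shows "(\<integral>x. A x * v x \<partial>lebesgue) = - (\<integral>x. u x * B x \<partial>lebesgue)"
proof -
  \<comment> \<open>The margin 1 makes B vanish at l and r, and gives every point outside [l,r] a
    neighbourhood on which B is 0, so that v = B' vanishes there too.\<close>
  define l r where "l = min L R - 1" and "r = max L R + 1"
  have lr: "l \<le> r" "B l = 0" "B r = 0" by (auto simp: l_def r_def intro!: z)
  have vz: "v x = 0" if x: "x \<notin> {l..r}" for x
  proof -
    have "DERIV B x :> 0"
      by (rule DERIV_cong_open[of "\<lambda>_. 0" _ _ "- {L..R}"]) (use x z in \<open>auto simp: l_def r_def\<close>)
    then show ?thesis using B DERIV_unique by blast
  qed
  have Bc: "isCont B x" for x by (rule DERIV_isCont[OF B])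
  have Ac: "isCont A x" for x
  proof -
    have "A y = A 0 - prim u 0 + prim u y" for y
    proof (cases "0 \<le> y")
      case True then show ?thesis using A[of 0 y] prim_integrable_diff[OF u, of 0 y] by simp
    next
      case False then show ?thesis using A[of y 0] prim_integrable_diff[OF u, of y 0] by simp
    qed
    then have "A = (\<lambda>y. A 0 - prim u 0 + prim u y)" by (rule ext)
    moreover have "isCont (\<lambda>y. A 0 - prim u 0 + prim u y) x"
      by (intro continuous_intros isCont_prim_locally_integrable u)
    ultimately show ?thesis by metis
  qed
  have vl: "integrable (lebesgue_on {l..r}) v"
    by (rule locally_integrableD[OF locally_integrable_continuous[OF v]])
  have "(v has_integral (B x - B l)) {l..x}" if "x \<in> {l..r}" for x
    by (rule fundamental_theorem_of_calculus)
      (use that B in \<open>auto simp: has_real_derivative_iff_has_vector_derivative[symmetric] intro: has_field_derivative_at_within\<close>)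
  then have Bi: "B x = B l + integral {l..x} v" if "x \<in> {l..r}" for x
    using that integral_unique[of v "B x - B l" "{l..x}"] by simp
  have "(\<integral>x. u x * B x + A x * v x \<partial>lebesgue_on {l..r}) = 0"
    using AC_integration_by_parts(2)[OF lr(1) locally_integrableD(1)[OF u] vl _ Bi, of A] A lr by simp
  moreover have li: "locally_integrable (\<lambda>x. u x * B x)" "locally_integrable (\<lambda>x. A x * v x)"
    by (intro locally_integrable_mult_continuous u Bc v locally_integrable_continuous Ac)+
  ultimately have "(\<integral>x. u x * B x \<partial>lebesgue_on {l..r}) + (\<integral>x. A x * v x \<partial>lebesgue_on {l..r}) = 0"
    using Bochner_Integration.integral_add[OF locally_integrableD(1)[OF li(1)] locally_integrableD(1)[OF li(2)], of l r] by simp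
  then have "integral {l..r} (\<lambda>x. u x * B x) + integral {l..r} (\<lambda>x. A x * v x) = 0"
    by (simp add: lebesgue_integral_eq_integral locally_integrableD[OF li(1)] locally_integrableD[OF li(2)])
  moreover have "(\<integral>x. u x * B x \<partial>lebesgue) = integral {l..r} (\<lambda>x. u x * B x)"
    by (rule compact_support_integral[OF li(1)]) (auto simp: l_def r_def intro!: z)
  moreover have "(\<integral>x. A x * v x \<partial>lebesgue) = integral {l..r} (\<lambda>x. A x * v x)"
    by (rule compact_support_integral[OF li(2)]) (simp add: vz)
  ultimately show ?thesis by simp
qed

text \<open>The du Bois-Reymond lemma for countably many test functions. K = P -
  \<open>prim u\<close> is orthogonal to each \<open>test_deriv\<close>, so its mean against every
  bump is the same number; as the bumps steepen, this becomes its mean over each rational interval.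
  Countability is what later allows H to be checked for almost every time at once.\<close>

lemma weak_primitive:
  assumes u: "locally_integrable u" and P: "locally_integrable P"
    and H: "\<And>a b n. a \<in> \<rat> \<Longrightarrow> b \<in> \<rat> \<Longrightarrow> a < b \<Longrightarrow>
      (\<integral>x. P x * test_deriv a b n x \<partial>lebesgue) = - (\<integral>x. u x * test_fun a b n x \<partial>lebesgue)"
  shows "\<exists>c. AE x in lebesgue. P x = c + prim u x"
proof -
  define K where "K x = P x - prim u x" for x
  have pu: "locally_integrable (prim u)"
    by (intro locally_integrable_continuous isCont_prim_locally_integrable u)
  have K: "locally_integrable K" unfolding K_def[abs_def] by (intro locally_integrable_diff P pu)
  have bint: "integrable lebesgue (\<lambda>x. k x * bump a b n x)" if "locally_integrable k" for k a b n
    by (rule compact_support_integral[OF locally_integrable_mult_continuous[OF that isCont_bump], of a b])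
      (auto simp: bump_outside)
  have tint: "integrable lebesgue (\<lambda>x. k x * test_deriv a b n x)" if "locally_integrable k" for k a b n
    by (rule compact_support_integral[OF locally_integrable_mult_continuous[OF that isCont_test_deriv], of "min a 0" "max b 1"])
      (auto simp: test_deriv_outside)
  \<comment> \<open>The mean of K against the fixed correcting bump: orthogonality to
    \<open>test_deriv\<close> forces all other means to agree with it, and it turns out to be the
    additive constant c.\<close>
  define \<gamma> where "\<gamma> = (\<integral>x. K x * bump 0 1 0 x \<partial>lebesgue) / bump_mass 0 1 0"
  have eq: "(\<integral>x. K x * bump a b n x \<partial>lebesgue) = bump_mass a b n * \<gamma>" if ab: "a \<in> \<rat>" "b \<in> \<rat>" "a < b" for a b n
  proof -
    have "(\<integral>x. prim u x * test_deriv a b n x \<partial>lebesgue) = - (\<integral>x. u x * test_fun a b n x \<partial>lebesgue)"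
      by (rule prim_parts_test_fun[OF u DERIV_test_fun isCont_test_deriv prim_integrable_diff[OF u] test_fun_outside])
    then have "(\<integral>x. K x * test_deriv a b n x \<partial>lebesgue) = 0"
      using H[OF ab] tint[OF P] tint[OF pu] by (simp add: K_def left_diff_distrib)
    moreover have "(\<integral>x. K x * test_deriv a b n x \<partial>lebesgue) =
        (\<integral>x. K x * bump a b n x - bump_mass a b n / bump_mass 0 1 0 * (K x * bump 0 1 0 x) \<partial>lebesgue)"
      by (intro Bochner_Integration.integral_cong refl) (simp add: test_deriv_def algebra_simps)
    moreover have "\<dots> = (\<integral>x. K x * bump a b n x \<partial>lebesgue) - bump_mass a b n / bump_mass 0 1 0 * (\<integral>x. K x * bump 0 1 0 x \<partial>lebesgue)"
      using bint[OF K] by (subst Bochner_Integration.integral_diff) auto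
    ultimately show ?thesis by (simp add: \<gamma>_def)
  qed
  have int_eq: "integral {a..b} K = (b - a) * \<gamma>" if ab: "a \<in> \<rat>" "b \<in> \<rat>" "a < b" for a b
  proof (rule LIMSEQ_unique[OF bump_integral_LIMSEQ[OF K]])
    have "(\<lambda>n. bump_mass a b n * \<gamma>) \<longlonglongrightarrow> (b - a) * \<gamma>" by (intro tendsto_intros bump_mass_LIMSEQ ab)
    then show "(\<lambda>n. \<integral>x. K x * bump a b n x \<partial>lebesgue) \<longlonglongrightarrow> (b - a) * \<gamma>" by (simp add: eq[OF ab])
  qed
  define Z where "Z x = K x - \<gamma>" for x
  have Z: "locally_integrable Z" unfolding Z_def[abs_def] by (intro locally_integrable_diff K locally_integrable_continuous) auto
  have Zi: "integral {a..b} Z = 0" if ab: "a \<in> \<rat>" "b \<in> \<rat>" "a < b" for a b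
    unfolding Z_def using int_eq[OF ab] ab(3) locally_integrableD(3)[OF K]
    by (subst Henstock_Kurzweil_Integration.integral_diff) auto
  have cR: "prim Z x = prim Z 0" if "x \<in> \<rat>" for x
  proof (cases x "0::real" rule: linorder_cases)
    case less
    then show ?thesis using prim_integrable_diff[OF Z less_imp_le[OF less]] Zi[OF that Rats_0 less] by linarith
  next
    case greater
    then show ?thesis using prim_integrable_diff[OF Z less_imp_le[OF greater]] Zi[OF Rats_0 that greater] by linarith
  qed simp
  \<comment> \<open>The primitive of Z = K - \<gamma> is constant on the rationals and continuous,
    hence constant.\<close>
  have cc: "continuous_on (closure \<rat>) (prim Z)"
    by (intro continuous_at_imp_continuous_on ballI isCont_prim_locally_integrable Z)
  have const: "prim Z x = prim Z 0" for x
    by (rule continuous_constant_on_closure[OF cc cR]) (simp_all add: Rats_closure_real)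
  have "AE x in lebesgue. Z x = 0"
  proof (rule AE_eq_0_of_integral_eq_0[OF locally_integrableD(3)[OF Z]])
    show "integral {a..b} Z = 0" if "a < b" for a b
      using prim_integrable_diff[OF Z less_imp_le[OF that]] const[of a] const[of b] by linarith
  qed
  then show ?thesis by (intro exI[of _ \<gamma>]) (auto simp: Z_def K_def algebra_simps elim!: eventually_mono)
qed

section \<open>Calculus of weak derivatives\<close>

lemma smooth_isCont:
  assumes "smooth \<psi>"
  shows "isCont \<psi> x" "isCont (deriv \<psi>) x" "DERIV \<psi> x :> deriv \<psi> x"
proof -
  have n: "nsmooth (Suc (Suc 0)) \<psi>" using assms by (simp add: smooth_iff_nsmooth del: nsmooth.simps)
  show d: "DERIV \<psi> x :> deriv \<psi> x" by (rule nsmooth_SucE[OF n])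
  then show "isCont \<psi> x" by (rule DERIV_isCont)
  have "nsmooth (Suc 0) (deriv \<psi>)" using n by simp
  then show "isCont (deriv \<psi>) x" by (rule DERIV_isCont[OF nsmooth_SucE])
qed

lemma smooth_bump: "smooth (bump a b n)"
  by (simp add: smooth_iff_nsmooth nsmooth_bump)

lemma compact_support_deriv:
  assumes "\<And>x. \<bar>x\<bar> > J \<Longrightarrow> \<psi> x = 0" "\<bar>x\<bar> > J"
  shows "deriv \<psi> x = (0::real)"
proof -
  have "DERIV \<psi> x :> 0"
    by (rule DERIV_cong_open[of "\<lambda>_. 0" _ _ "{x. \<bar>x\<bar> > J}"])
      (use assms in \<open>auto intro!: open_Collect_less continuous_intros\<close>)
  then show ?thesis by (rule DERIV_imp_deriv)
qed

lemma integrable_mult_test: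
  assumes "locally_integrable u" "smooth \<psi>" "\<And>x. \<bar>x\<bar> > J \<Longrightarrow> \<psi> x = 0"
  shows "integrable lebesgue (\<lambda>x. u x * \<psi> x)" "integrable lebesgue (\<lambda>x. u x * deriv \<psi> x)"
proof -
  have d: "deriv \<psi> x = 0" if "\<bar>x\<bar> > J" for x by (rule compact_support_deriv[OF assms(3) that])
  show "integrable lebesgue (\<lambda>x. u x * \<psi> x)"
    by (rule compact_support_integral(1)[OF locally_integrable_mult_continuous[OF assms(1) smooth_isCont(1)[OF assms(2)]], of "-J" J])
      (auto intro!: assms(3))
  show "integrable lebesgue (\<lambda>x. u x * deriv \<psi> x)"
    by (rule compact_support_integral(1)[OF locally_integrable_mult_continuous[OF assms(1) smooth_isCont(2)[OF assms(2)]], of "-J" J])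
      (auto intro!: d)
qed

lemma has_weak_derivD:
  assumes "has_weak_deriv u g" "smooth \<psi>" "\<And>x. \<bar>x\<bar> > J \<Longrightarrow> \<psi> x = 0"
  shows "(\<integral>x. u x * deriv \<psi> x \<partial>lebesgue) = - (\<integral>x. g x * \<psi> x \<partial>lebesgue)"
  using assms unfolding has_weak_deriv_def by blast

lemma has_weak_deriv_locally_integrable:
  assumes "has_weak_deriv u g"
  shows "locally_integrable u" "locally_integrable g"
  using assms by (auto simp: has_weak_deriv_def)

lemma has_weak_deriv_primitive:
  assumes "has_weak_deriv u g"
  shows "\<exists>c. AE x in lebesgue. u x = c + prim g x"
proof (rule weak_primitive)
  show "(\<integral>x. u x * test_deriv a b n x \<partial>lebesgue) = - (\<integral>x. g x * test_fun a b n x \<partial>lebesgue)" for a b n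
  proof -
    have "deriv (test_fun a b n) = test_deriv a b n"
      by (intro ext DERIV_imp_deriv DERIV_test_fun)
    moreover have "test_fun a b n x = 0" if "\<bar>x\<bar> > \<bar>a\<bar> + \<bar>b\<bar> + 1" for x
      by (rule test_fun_outside) (use that in auto)
    ultimately show ?thesis using has_weak_derivD[OF assms smooth_test_fun, of "\<bar>a\<bar> + \<bar>b\<bar> + 1" a b n] by simp
  qed
qed (use assms has_weak_deriv_locally_integrable in auto)

lemma has_weak_deriv_unique:
  assumes "has_weak_deriv u g" "has_weak_deriv u h"
  shows "AE x in lebesgue. g x = h x"
proof -
  have li: "locally_integrable g" "locally_integrable h"
    using assms has_weak_deriv_locally_integrable by auto
  then have d: "locally_integrable (\<lambda>x. g x - h x)" by (rule locally_integrable_diff)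
  have "(\<integral>x. (g x - h x) * bump a b n x \<partial>lebesgue) = 0" for a b n
  proof -
    have z: "bump a b n x = 0" if "\<bar>x\<bar> > \<bar>a\<bar> + \<bar>b\<bar>" for x using that by (intro bump_outside) auto
    have "(\<integral>x. g x * bump a b n x \<partial>lebesgue) = (\<integral>x. h x * bump a b n x \<partial>lebesgue)"
      using has_weak_derivD[OF assms(1) smooth_bump z] has_weak_derivD[OF assms(2) smooth_bump z] by simp
    then show ?thesis
      using integrable_mult_test(1)[OF li(1) smooth_bump z] integrable_mult_test(1)[OF li(2) smooth_bump z]
      by (simp add: left_diff_distrib)
  qed
  then have "integral {a..b} (\<lambda>x. g x - h x) = 0" for a b
    using bump_integral_LIMSEQ[OF d, of a b] LIMSEQ_unique[OF tendsto_const] by fastforce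
  then have "AE x in lebesgue. g x - h x = 0"
    by (intro AE_eq_0_of_integral_eq_0 locally_integrableD[OF d])
  then show ?thesis by simp
qed

lemma has_weak_deriv_C1:
  assumes d: "\<And>x. DERIV F x :> G x" and c: "\<And>x. isCont G x"
  shows "has_weak_deriv F G"
proof -
  have G: "locally_integrable G" by (rule locally_integrable_continuous[OF c])
  have F: "locally_integrable F" by (rule locally_integrable_continuous[OF DERIV_isCont[OF d]])
  have "(G has_integral (F y - F x)) {x..y}" if "x \<le> y" for x y
    by (rule fundamental_theorem_of_calculus)
      (use that d in \<open>auto simp: has_real_derivative_iff_has_vector_derivative[symmetric] intro: has_field_derivative_at_within\<close>)
  then have FG: "F y = F x + integral {x..y} G" if "x \<le> y" for x y
    using that integral_unique[of G "F y - F x" "{x..y}"] by simp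
  show ?thesis unfolding has_weak_deriv_def
  proof (intro conjI allI impI F G, elim conjE exE)
    fix \<psi> J assume \<psi>: "smooth \<psi>" "\<forall>x. \<bar>x\<bar> > J \<longrightarrow> \<psi> x = 0"
    show "(\<integral>x. F x * deriv \<psi> x \<partial>lebesgue) = - (\<integral>x. G x * \<psi> x \<partial>lebesgue)"
      by (rule prim_parts_test_fun[OF G smooth_isCont(3)[OF \<psi>(1)] smooth_isCont(2)[OF \<psi>(1)] FG, of "-J" J])
        (use \<psi>(2) in auto)
  qed
qed

lemma has_weak_deriv_cong_AE:
  assumes w: "has_weak_deriv u g" and u: "AE x in lebesgue. u x = u' x" and g: "AE x in lebesgue. g x = g' x"
    and li: "locally_integrable u'" "locally_integrable g'"
  shows "has_weak_deriv u' g'"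
  unfolding has_weak_deriv_def
proof (intro conjI allI impI li, elim conjE exE)
  fix \<psi> J assume \<psi>: "smooth \<psi>" "\<forall>x. \<bar>x\<bar> > J \<longrightarrow> \<psi> x = 0"
  have c: "\<psi> x = 0" if "\<bar>x\<bar> > J" for x using \<psi>(2) that by blast
  note li0 = has_weak_deriv_locally_integrable[OF w]
  have "(\<integral>x. u' x * deriv \<psi> x \<partial>lebesgue) = (\<integral>x. u x * deriv \<psi> x \<partial>lebesgue)"
    by (rule integral_cong_AE)
      (use u borel_measurable_integrable[OF integrable_mult_test(2)[OF li(1) \<psi>(1) c]]
        borel_measurable_integrable[OF integrable_mult_test(2)[OF li0(1) \<psi>(1) c]] in auto)
  moreover have "(\<integral>x. g' x * \<psi> x \<partial>lebesgue) = (\<integral>x. g x * \<psi> x \<partial>lebesgue)"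
    by (rule integral_cong_AE)
      (use g borel_measurable_integrable[OF integrable_mult_test(1)[OF li(2) \<psi>(1) c]]
        borel_measurable_integrable[OF integrable_mult_test(1)[OF li0(2) \<psi>(1) c]] in auto)
  ultimately show "(\<integral>x. u' x * deriv \<psi> x \<partial>lebesgue) = - (\<integral>x. g' x * \<psi> x \<partial>lebesgue)"
    using has_weak_derivD[OF w \<psi>(1) c] by simp
qed

lemma has_weak_deriv_diff:
  assumes "has_weak_deriv u g" "has_weak_deriv v h"
  shows "has_weak_deriv (\<lambda>x. u x - v x) (\<lambda>x. g x - h x)"
proof -
  note li = has_weak_deriv_locally_integrable[OF assms(1)] has_weak_deriv_locally_integrable[OF assms(2)]
  show ?thesis unfolding has_weak_deriv_def
  proof (intro conjI allI impI locally_integrable_diff li, elim conjE exE)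
    fix \<psi> J assume \<psi>: "smooth \<psi>" "\<forall>x. \<bar>x\<bar> > J \<longrightarrow> \<psi> x = 0"
    have c: "\<psi> x = 0" if "\<bar>x\<bar> > J" for x using \<psi>(2) that by blast
    show "(\<integral>x. (u x - v x) * deriv \<psi> x \<partial>lebesgue) = - (\<integral>x. (g x - h x) * \<psi> x \<partial>lebesgue)"
      using has_weak_derivD[OF assms(1) \<psi>(1) c] has_weak_derivD[OF assms(2) \<psi>(1) c]
        integrable_mult_test[OF li(1) \<psi>(1) c] integrable_mult_test[OF li(2) \<psi>(1) c]
        integrable_mult_test[OF li(3) \<psi>(1) c] integrable_mult_test[OF li(4) \<psi>(1) c]
      by (simp add: left_diff_distrib)
  qed
qed

lemma W12_norm_eq:
  assumes "has_weak_deriv v g"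
  shows "W12_norm v = sqrt ((\<integral>x. (v x)\<^sup>2 \<partial>lebesgue) + (\<integral>x. (g x)\<^sup>2 \<partial>lebesgue))"
proof -
  define h where "h = (SOME g. has_weak_deriv v g)"
  have h: "has_weak_deriv v h" unfolding h_def by (rule someI[of "has_weak_deriv v", OF assms])
  have "(\<integral>x. (h x)\<^sup>2 \<partial>lebesgue) = (\<integral>x. (g x)\<^sup>2 \<partial>lebesgue)"
  proof (rule integral_cong_AE)
    show "AE x in lebesgue. (h x)\<^sup>2 = (g x)\<^sup>2" using has_weak_deriv_unique[OF h assms] by auto
  qed (use has_weak_deriv_locally_integrable[OF h] has_weak_deriv_locally_integrable[OF assms]
      locally_integrable_measurable in \<open>auto intro!: borel_measurable_power\<close>)
  then show ?thesis by (simp add: W12_norm_def h_def)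
qed

section \<open>Uniqueness\<close>

lemma borel_slice:
  fixes F :: "real \<times> real \<Rightarrow> real"
  assumes "F \<in> borel_measurable borel"
  shows "(\<lambda>t. F (x, t)) \<in> borel_measurable borel" "(\<lambda>x. F (x, t)) \<in> borel_measurable borel"
  by (rule measurable_compose[OF _ assms], intro borel_measurable_continuous_onI continuous_intros)+

lemma borel_fst_snd:
  fixes k :: "real \<Rightarrow> real"
  assumes "k \<in> borel_measurable borel"
  shows "(\<lambda>p::real \<times> real. k (fst p)) \<in> borel_measurable borel"
    "(\<lambda>p::real \<times> real. k (snd p)) \<in> borel_measurable borel"
  by (rule measurable_compose[OF _ assms], intro borel_measurable_continuous_onI continuous_intros)+

lemma AE_lborel_slices:
  assumes "AE p in lborel. Q (p :: real \<times> real)"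
  shows "AE x in lborel. AE t in lborel. Q (x, t)" "AE t in lborel. AE x in lborel. Q (x, t)"
proof -
  show "AE x in lborel. AE t in lborel. Q (x, t)"
    using lborel_pair.AE_pair[of Q] assms unfolding lborel_prod by blast
  \<comment> \<open>Exchanging the order of the two quantifiers requires a measurable set, so Q is
    replaced by the complement of a Borel null set containing all exceptions.\<close>
  obtain N where N: "{p. \<not> Q p} \<subseteq> N" "N \<in> null_sets lborel"
    using assms unfolding eventually_ae_filter by auto
  then have Nb: "N \<in> sets borel" by auto
  have "AE p in lborel. p \<notin> N" using N(2) by (rule AE_not_in)
  then have "AE x in lborel. AE t in lborel. (x, t) \<notin> N"
    using lborel_pair.AE_pair[of "\<lambda>p. p \<notin> N"] unfolding lborel_prod by blast
  moreover have "{p \<in> space (lborel \<Otimes>\<^sub>M lborel). (fst p, snd p) \<notin> N} \<in> sets (lborel \<Otimes>\<^sub>M lborel :: (real \<times> real) measure)"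
  proof -
    have "{p \<in> space (lborel :: (real \<times> real) measure). (fst p, snd p) \<notin> N} = - N" by auto
    then show ?thesis unfolding lborel_prod using Nb by (metis borel_comp sets_lborel)
  qed
  ultimately have "AE t in lborel. AE x in lborel. (x, t) \<notin> N"
    using lborel_pair.AE_commute[of "\<lambda>x t. (x, t) \<notin> N"] by simp
  then show "AE t in lborel. AE x in lborel. Q (x, t)"
    by (rule eventually_mono) (erule eventually_mono, use N(1) in auto)
qed

lemma AE_lebesgue_lborel: "AE x in lebesgue. Q x \<Longrightarrow> AE x in lborel. Q x"
  by (simp add: AE_completion_iff)

lemma AE_lborel_prodI:
  fixes Q :: "real \<times> real \<Rightarrow> bool"
  assumes "{p. Q p} \<in> sets borel" "AE x in lborel. AE t in lborel. Q (x, t)"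
  shows "AE p in lborel. Q p"
proof -
  have "{p \<in> space (lborel :: (real \<times> real) measure). Q p} \<in> sets lborel" using assms(1) by simp
  then show ?thesis using lborel_pair.AE_pair_measure[of Q] assms(2) unfolding lborel_prod by blast
qed

lemma lborel_Fubini:
  fixes F :: "real \<times> real \<Rightarrow> real"
  assumes F: "integrable lborel F"
  shows "AE x in lborel. integrable lborel (\<lambda>t. F (x, t))" "AE t in lborel. integrable lborel (\<lambda>x. F (x, t))"
    "integrable lborel (\<lambda>x. \<integral>t. F (x, t) \<partial>lborel)" "integrable lborel (\<lambda>t. \<integral>x. F (x, t) \<partial>lborel)"
    "(\<integral>x. (\<integral>t. F (x, t) \<partial>lborel) \<partial>lborel) = (\<integral>p. F p \<partial>lborel)"
    "(\<integral>t. (\<integral>x. F (x, t) \<partial>lborel) \<partial>lborel) = (\<integral>p. F p \<partial>lborel)"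
proof -
  have F': "integrable (lborel \<Otimes>\<^sub>M lborel) F" using F by (simp add: lborel_prod)
  have F'': "integrable (lborel \<Otimes>\<^sub>M lborel) (\<lambda>(x, t). F (x, t))" using F' by simp
  show "AE x in lborel. integrable lborel (\<lambda>t. F (x, t))" "integrable lborel (\<lambda>x. \<integral>t. F (x, t) \<partial>lborel)"
    "(\<integral>x. (\<integral>t. F (x, t) \<partial>lborel) \<partial>lborel) = (\<integral>p. F p \<partial>lborel)"
    using lborel_pair.AE_integrable_fst'[OF F'] lborel_pair.integrable_fst'[OF F'] lborel_pair.integral_fst'[OF F']
    by (simp_all add: lborel_prod)
  show "AE t in lborel. integrable lborel (\<lambda>x. F (x, t))" "integrable lborel (\<lambda>t. \<integral>x. F (x, t) \<partial>lborel)"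
    "(\<integral>t. (\<integral>x. F (x, t) \<partial>lborel) \<partial>lborel) = (\<integral>p. F p \<partial>lborel)"
    using lborel_pair.AE_integrable_snd[OF F''] lborel_pair.integrable_snd[OF F''] lborel_pair.integral_snd[OF F'']
    by (simp_all add: lborel_prod)
qed

lemma integrable_lborel_prodI:
  fixes F :: "real \<times> real \<Rightarrow> real"
  assumes "F \<in> borel_measurable borel" "AE x in lborel. integrable lborel (\<lambda>t. F (x, t))"
    "integrable lborel (\<lambda>x. \<integral>t. \<bar>F (x, t)\<bar> \<partial>lborel)"
  shows "integrable lborel F"
  using lborel_pair.Fubini_integrable[of F] assms by (simp add: lborel_prod)

lemma integrable_tensor:
  fixes k l :: "real \<Rightarrow> real"
  assumes k: "integrable lborel k" and l: "integrable lborel l"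
  shows "integrable lborel (\<lambda>p. k (fst p) * l (snd p))"
proof (rule integrable_lborel_prodI)
  have m: "k \<in> borel_measurable borel" "l \<in> borel_measurable borel"
    using borel_measurable_integrable[OF k] borel_measurable_integrable[OF l] by simp_all
  show "(\<lambda>p. k (fst p) * l (snd p)) \<in> borel_measurable borel"
    by (intro borel_measurable_times borel_fst_snd m)
  show "AE x in lborel. integrable lborel (\<lambda>t. k (fst (x, t)) * l (snd (x, t)))" using l by simp
  show "integrable lborel (\<lambda>x. \<integral>t. \<bar>k (fst (x, t)) * l (snd (x, t))\<bar> \<partial>lborel)"
    using k by (simp add: abs_mult)
qed

lemma integrable_lborel_lebesgue:
  fixes f :: "'a::euclidean_space \<Rightarrow> real"
  assumes "f \<in> borel_measurable borel"
  shows "integrable lebesgue f \<longleftrightarrow> integrable lborel f" "(\<integral>x. f x \<partial>lebesgue) = (\<integral>x. f x \<partial>lborel)"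
  using assms by (simp_all add: integrable_completion integral_completion)

lemma integral_lebesgue_on_lborel:
  fixes f :: "real \<Rightarrow> real"
  assumes f: "f \<in> borel_measurable borel"
  shows "integrable (lebesgue_on {a..b}) f \<longleftrightarrow> integrable lborel (\<lambda>x. indicator {a..b} x * f x)"
    "(\<integral>x. f x \<partial>lebesgue_on {a..b}) = (\<integral>x. indicator {a..b} x * f x \<partial>lborel)"
proof -
  have m: "(\<lambda>x. indicator {a..b} x * f x) \<in> borel_measurable borel" using f by measurable
  show "integrable (lebesgue_on {a..b}) f \<longleftrightarrow> integrable lborel (\<lambda>x. indicator {a..b} x * f x)"
    by (simp add: integrable_restrict_space integrable_lborel_lebesgue[OF m])
  show "(\<integral>x. f x \<partial>lebesgue_on {a..b}) = (\<integral>x. indicator {a..b} x * f x \<partial>lborel)"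
    by (simp add: integral_restrict_space integrable_lborel_lebesgue[OF m])
qed

lemma locally_integrable_lborelI:
  assumes "f \<in> borel_measurable borel" "\<And>a b. integrable lborel (\<lambda>x. indicator {a..b} x * f x)"
  shows "locally_integrable f"
  using assms by (simp add: locally_integrable_def integral_lebesgue_on_lborel)

lemma integrable_indicator_Icc: "integrable lborel (indicator {a..b} :: real \<Rightarrow> real)"
  by (rule integrable_real_indicator) (auto simp: emeasure_lborel_Icc_eq)

lemma locally_integrable_of_square:
  assumes f: "f \<in> borel_measurable borel" and f2: "integrable lborel (\<lambda>x. (f x)\<^sup>2)"
  shows "locally_integrable f"
proof (rule locally_integrable_lborelI[OF f])
  fix a b :: real
  have "integrable lborel (\<lambda>x. indicator {a..b} x + (f x)\<^sup>2 :: real)"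
    by (intro Bochner_Integration.integrable_add integrable_indicator_Icc f2)
  then show "integrable lborel (\<lambda>x. indicator {a..b} x * f x)"
  proof (rule Bochner_Integration.integrable_bound)
    show "AE x in lborel. norm (indicator {a..b} x * f x) \<le> norm (indicator {a..b} x + (f x)\<^sup>2 :: real)"
    proof (rule AE_I2)
      fix x
      have "\<bar>f x\<bar> \<le> 1 + (f x)\<^sup>2" using zero_le_power2[of "\<bar>f x\<bar> - 1"] by (simp add: power2_diff power2_abs) 
      then show "norm (indicator {a..b} x * f x) \<le> norm (indicator {a..b} x + (f x)\<^sup>2 :: real)"
        by (auto simp: indicator_def)
    qed
  qed (use f in measurable)
qed

lemma locally_integrable_bounded:
  assumes f: "f \<in> borel_measurable borel" and b: "\<And>x. \<bar>f x\<bar> \<le> M"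
  shows "locally_integrable f"
proof (rule locally_integrable_lborelI[OF f])
  fix c d :: real
  have "integrable lborel (\<lambda>x. M * indicator {c..d} x :: real)"
    by (intro integrable_mult_right integrable_indicator_Icc)
  then show "integrable lborel (\<lambda>x. indicator {c..d} x * f x)"
    by (rule Bochner_Integration.integrable_bound)
      (use f b order_trans[OF abs_ge_zero b] in \<open>auto simp: indicator_def intro!: AE_I2\<close>)
qed

text \<open>The integral of (p h \<omega>)' vanishes by compact support. As p and h equal primitives
  only almost everywhere, the product rule is used on the continuous representatives A and H: once
  for H \<omega>, once for A times that product.\<close>

lemma weighted_parts:
  fixes u G p h \<omega> \<omega>' :: "real \<Rightarrow> real"
  assumes u: "locally_integrable u" and G: "locally_integrable G"
    and pu: "AE x in lebesgue. p x = c + prim u x" and hG: "AE x in lebesgue. h x = d + prim G x"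
    and m: "p \<in> borel_measurable borel" "h \<in> borel_measurable borel" "u \<in> borel_measurable borel" "G \<in> borel_measurable borel"
    and \<omega>: "\<And>x. DERIV \<omega> x :> \<omega>' x" "\<And>x. isCont \<omega>' x" and z: "\<And>x. \<bar>x\<bar> > r \<Longrightarrow> \<omega> x = 0"
    and i: "integrable lborel (\<lambda>x. u x * h x * \<omega> x)" "integrable lborel (\<lambda>x. p x * G x * \<omega> x)"
      "integrable lborel (\<lambda>x. p x * h x * \<omega>' x)"
  shows "(\<integral>x. u x * h x * \<omega> x \<partial>lborel) + (\<integral>x. p x * G x * \<omega> x \<partial>lborel) + (\<integral>x. p x * h x * \<omega>' x \<partial>lborel) = 0"
proof -
  define A where "A x = c + prim u x" for x
  define H where "H x = d + prim G x" for x
  define R where "R = \<bar>r\<bar> + 1"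
  have A: "A y = A x + integral {x..y} u" if "x \<le> y" for x y
    using prim_integrable_diff[OF u that] by (simp add: A_def)
  have H: "H y = H x + integral {x..y} G" if "x \<le> y" for x y
    using prim_integrable_diff[OF G that] by (simp add: H_def)
  have Ac: "isCont A x" and Hc: "isCont H x" for x
    unfolding A_def[abs_def] H_def[abs_def] by (intro continuous_intros isCont_prim_locally_integrable u G)+
  have \<omega>c: "isCont \<omega> x" for x by (rule DERIV_isCont[OF \<omega>(1)])
  have \<omega>'l: "locally_integrable \<omega>'" by (rule locally_integrable_continuous[OF \<omega>(2)])
  have "(\<omega>' has_integral (\<omega> y - \<omega> x)) {x..y}" if "x \<le> y" for x y
    by (rule fundamental_theorem_of_calculus)
      (use that \<omega>(1) in \<open>auto simp: has_real_derivative_iff_has_vector_derivative[symmetric] intro: has_field_derivative_at_within\<close>)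
  then have \<omega>i: "\<omega> y = \<omega> x + integral {x..y} \<omega>'" if "x \<le> y" for x y
    using that integral_unique[of \<omega>' "\<omega> y - \<omega> x" "{x..y}"] by simp
  define v where "v x = G x * \<omega> x + H x * \<omega>' x" for x
  have v1: "locally_integrable (\<lambda>x. G x * \<omega> x)" "locally_integrable (\<lambda>x. H x * \<omega>' x)"
    by (intro locally_integrable_mult_continuous G \<omega>c \<omega>(2) locally_integrable_continuous Hc)+
  have v: "locally_integrable v"
    using v1 by (simp add: locally_integrable_def v_def[abs_def])
  have B: "H y * \<omega> y = H x * \<omega> x + integral {x..y} v" if "x \<le> y" for x y
  proof -
    have "(\<integral>s. G s * \<omega> s + H s * \<omega>' s \<partial>lebesgue_on {x..y}) = H y * \<omega> y - H x * \<omega> x"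
      by (rule AC_integration_by_parts(2)[OF that locally_integrableD(1)[OF G] locally_integrableD(1)[OF \<omega>'l]])
        (auto intro: H \<omega>i)
    moreover have "(\<integral>s. v s \<partial>lebesgue_on {x..y}) = integral {x..y} v"
      by (rule lebesgue_integral_eq_integral[OF locally_integrableD(1)[OF v]]) simp
    ultimately show ?thesis by (simp add: v_def)
  qed
  have R: "- R \<le> R" "\<omega> R = 0" "\<omega> (- R) = 0" by (auto simp: R_def intro!: z)
  have \<omega>'z: "\<omega>' x = 0" if "\<bar>x\<bar> > r" for x
    using compact_support_deriv[of r \<omega> x, OF z that] DERIV_imp_deriv[OF \<omega>(1)[of x]] by simp
  have "(\<integral>x. u x * (H x * \<omega> x) + A x * v x \<partial>lebesgue_on {-R..R}) = A R * (H R * \<omega> R) - A (-R) * (H (-R) * \<omega> (-R))"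
    by (rule AC_integration_by_parts(2)[OF R(1) locally_integrableD(1)[OF u] locally_integrableD(1)[OF v]])
      (auto intro: A B)
  then have e: "(\<integral>x. u x * (H x * \<omega> x) + A x * v x \<partial>lebesgue_on {-R..R}) = 0" by (simp add: R)
  have Hm: "H \<in> borel_measurable borel" "A \<in> borel_measurable borel" "\<omega> \<in> borel_measurable borel" "\<omega>' \<in> borel_measurable borel"
    using Hc Ac \<omega>c \<omega>(2) by (auto intro!: borel_measurable_continuous_onI continuous_at_imp_continuous_on)
  note [measurable] = Hm m
  have vm: "(\<lambda>x. u x * (H x * \<omega> x) + A x * v x) \<in> borel_measurable borel"
    unfolding v_def by measurable
  have "(\<integral>x. indicator {-R..R} x * (u x * (H x * \<omega> x) + A x * v x) \<partial>lborel) = 0"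
    using e integral_lebesgue_on_lborel(2)[OF vm] by simp
  moreover have "indicator {-R..R} x * (u x * (H x * \<omega> x) + A x * v x) = u x * (H x * \<omega> x) + A x * v x" for x
  proof (cases "\<bar>x\<bar> > r")
    case True
    then show ?thesis using z \<omega>'z by (simp add: v_def)
  next
    case False
    then show ?thesis by (auto simp: R_def indicator_def)
  qed
  ultimately have e2: "(\<integral>x. u x * (H x * \<omega> x) + A x * v x \<partial>lborel) = 0" by simp
  have pA: "AE x in lborel. p x = A x" and hH: "AE x in lborel. h x = H x"
    using AE_lebesgue_lborel[OF pu] AE_lebesgue_lborel[OF hG] unfolding A_def H_def by auto
  have "(\<integral>x. u x * h x * \<omega> x + p x * G x * \<omega> x + p x * h x * \<omega>' x \<partial>lborel) =
      (\<integral>x. u x * (H x * \<omega> x) + A x * v x \<partial>lborel)"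
  proof (rule integral_cong_AE)
    show "AE x in lborel. u x * h x * \<omega> x + p x * G x * \<omega> x + p x * h x * \<omega>' x = u x * (H x * \<omega> x) + A x * v x"
      using pA hH by eventually_elim (simp add: v_def algebra_simps)
  qed (use vm in measurable)
  then show ?thesis using e2 i by simp
qed

section \<open>Square integrable functions and the energy argument\<close>

lemma abs_mult_le_squares: "\<bar>a * b\<bar> \<le> a\<^sup>2 + b\<^sup>2" for a b :: real
proof -
  have "2 * (\<bar>a\<bar> * \<bar>b\<bar>) \<le> a\<^sup>2 + b\<^sup>2" using sum_squares_bound[of "\<bar>a\<bar>" "\<bar>b\<bar>"] by (simp add: mult.assoc)
  moreover have "0 \<le> \<bar>a\<bar> * \<bar>b\<bar>" by simp
  ultimately show ?thesis unfolding abs_mult by linarith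
qed

lemma integrable_mult_L2:
  fixes f g :: "'a \<Rightarrow> real"
  assumes "f \<in> borel_measurable M" "g \<in> borel_measurable M"
    "integrable M (\<lambda>x. (f x)\<^sup>2)" "integrable M (\<lambda>x. (g x)\<^sup>2)"
  shows "integrable M (\<lambda>x. f x * g x)"
proof (rule Bochner_Integration.integrable_bound)
  show "integrable M (\<lambda>x. (f x)\<^sup>2 + (g x)\<^sup>2)" using assms by simp
  show "AE x in M. norm (f x * g x) \<le> norm ((f x)\<^sup>2 + (g x)\<^sup>2)"
    using abs_mult_le_squares by (intro AE_I2) simp
qed (use assms in auto)

lemma integrable_mult_bounded:
  fixes f g :: "'a \<Rightarrow> real"
  assumes f: "integrable M f" and g: "g \<in> borel_measurable M" "\<And>x. \<bar>g x\<bar> \<le> B"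
  shows "integrable M (\<lambda>x. f x * g x)"
proof (rule Bochner_Integration.integrable_bound)
  show "integrable M (\<lambda>x. B * f x)" using f by simp
  show "AE x in M. norm (f x * g x) \<le> norm (B * f x)"
  proof (rule AE_I2)
    fix x
    have "\<bar>f x\<bar> * \<bar>g x\<bar> \<le> \<bar>f x\<bar> * \<bar>B\<bar>" using g(2)[of x] by (intro mult_left_mono) auto
    then show "norm (f x * g x) \<le> norm (B * f x)" by (simp add: abs_mult mult.commute)
  qed
qed (use f g in auto)

text \<open>The second claim is the Cauchy-Schwarz inequality, obtained by expanding the integral of
  (g - m)^2 over (0,T) with m the mean of g. It bounds time primitives independently of t.\<close>

lemma integral_square_le:
  fixes f :: "real \<Rightarrow> real"
  assumes T: "T > 0" and f: "f \<in> borel_measurable borel" "integrable lborel (\<lambda>t. (f t)\<^sup>2)"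
    and z: "\<And>t. t \<notin> {0<..<T} \<Longrightarrow> f t = 0"
  shows "integrable lborel f" "(\<integral>s. f s * (if s \<le> t then 1 else 0) \<partial>lborel)\<^sup>2 \<le> T * (\<integral>s. (f s)\<^sup>2 \<partial>lborel)"
proof -
  let ?i = "indicator {0<..<T} :: real \<Rightarrow> real"
  have i: "integrable lborel ?i" by (rule integrable_real_indicator) (use T in auto)
  have intg: "integrable lborel g" if "g \<in> borel_measurable borel" "integrable lborel (\<lambda>t. (g t)\<^sup>2)"
    "\<And>t. t \<notin> {0<..<T} \<Longrightarrow> g t = 0" for g :: "real \<Rightarrow> real"
  proof -
    have "integrable lborel (\<lambda>t. g t * ?i t)"
      by (rule integrable_mult_L2) (use that i in \<open>simp_all add: power2_eq_square flip: indicator_inter_arith\<close>)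
    moreover have "g t * ?i t = g t" for t using that(3)[of t] by (auto simp: indicator_def)
    ultimately show ?thesis by simp
  qed
  show "integrable lborel f" by (rule intg[OF f z])
  define g where "g s = f s * (if s \<le> t then 1 else 0)" for s
  have gm[measurable]: "g \<in> borel_measurable borel" unfolding g_def using f(1) by measurable
  have gf: "(g s)\<^sup>2 \<le> (f s)\<^sup>2" for s by (simp add: g_def)
  have g2: "integrable lborel (\<lambda>s. (g s)\<^sup>2)"
    by (rule Bochner_Integration.integrable_bound[OF f(2)]) (use gf in auto)
  have gz: "g s = 0" if "s \<notin> {0<..<T}" for s using z[OF that] by (simp add: g_def)
  have gi: "integrable lborel g" by (rule intg[OF gm g2 gz])
  define m where "m = (\<integral>s. g s \<partial>lborel) / T"
  have "0 \<le> (\<integral>s. (g s - m * ?i s)\<^sup>2 \<partial>lborel)" by simp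
  also have "\<dots> = (\<integral>s. (g s)\<^sup>2 - 2 * m * g s + m\<^sup>2 * ?i s \<partial>lborel)"
    by (intro Bochner_Integration.integral_cong refl) (auto simp: power2_diff indicator_def gz)
  also have "\<dots> = (\<integral>s. (g s)\<^sup>2 \<partial>lborel) - 2 * m * (\<integral>s. g s \<partial>lborel) + m\<^sup>2 * (\<integral>s. ?i s \<partial>lborel)"
    using g2 gi i by simp
  also have "(\<integral>s. ?i s \<partial>lborel) = T" using T by simp
  also have "(\<integral>s. g s \<partial>lborel) = m * T" using T by (simp add: m_def)
  finally have "m\<^sup>2 * T \<le> (\<integral>s. (g s)\<^sup>2 \<partial>lborel)" by (simp add: power2_eq_square mult_ac)
  also have "\<dots> \<le> (\<integral>s. (f s)\<^sup>2 \<partial>lborel)" by (intro integral_mono g2 f gf)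
  finally have "T * (m\<^sup>2 * T) \<le> T * (\<integral>s. (f s)\<^sup>2 \<partial>lborel)" using T by (intro mult_left_mono) auto
  moreover have "T * (m\<^sup>2 * T) = (\<integral>s. g s \<partial>lborel)\<^sup>2"
    using T by (simp add: m_def power2_eq_square)
  ultimately show "(\<integral>s. f s * (if s \<le> t then 1 else 0) \<partial>lborel)\<^sup>2 \<le> T * (\<integral>s. (f s)\<^sup>2 \<partial>lborel)"
    by (simp add: g_def)
qed

lemma borel_partial_integral:
  fixes G :: "real \<times> real \<Rightarrow> real"
  assumes G: "G \<in> borel_measurable borel"
  shows "(\<lambda>p. \<integral>s. G (fst p, s) * (if s \<le> snd p then 1 else 0) \<partial>lborel) \<in> borel_measurable borel"
proof -
  have s: "sets (borel \<Otimes>\<^sub>M lborel) = sets (borel :: ((real \<times> real) \<times> real) measure)"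
    by (simp add: borel_prod[symmetric] cong: sets_pair_measure_cong)
  have m: "(\<lambda>q. G (fst (fst q), snd q)) \<in> borel_measurable (borel :: ((real \<times> real) \<times> real) measure)"
    by (rule measurable_compose[OF _ G]) (intro borel_measurable_continuous_onI continuous_intros)
  have "{q :: (real \<times> real) \<times> real. snd q \<le> snd (fst q)} \<in> sets borel"
    by (intro borel_closed closed_Collect_le continuous_intros)
  then have "(\<lambda>q. if snd q \<le> snd (fst q) then 1 else 0 :: real) \<in> borel_measurable (borel :: ((real \<times> real) \<times> real) measure)"
    by (intro measurable_If) (auto simp: pred_def)
  with m have "(\<lambda>q. G (fst (fst q), snd q) * (if snd q \<le> snd (fst q) then 1 else 0)) \<in> borel_measurable (borel :: ((real \<times> real) \<times> real) measure)"
    by (rule borel_measurable_times)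
  then have "(\<lambda>(p, s). G (fst p, s) * (if s \<le> snd p then 1 else 0)) \<in> borel_measurable (borel \<Otimes>\<^sub>M lborel)"
    by (simp add: measurable_cong_sets[OF s refl] case_prod_beta)
  then show ?thesis by (rule lborel.borel_measurable_lebesgue_integral)
qed

text \<open>Oleinik's test function \<open>\<integral>\<^sub>t\<^sup>T h\<close>, in dual form: the primitive \<open>P\<close> of \<open>G = h\<^sub>x\<close> in time
  satisfies \<open>P\<^sub>x = u\<close> by the weak formulation, so that \<open>\<integral>\<integral> u h = - \<integral>\<integral> P P\<^sub>t \<le> 0\<close>.\<close>
lemma dual_energy:
  fixes u h G :: "real \<times> real \<Rightarrow> real" and T M :: real
  assumes T: "T > 0"
    and um: "u \<in> borel_measurable borel" and hm: "h \<in> borel_measurable borel" and Gm: "G \<in> borel_measurable borel"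
    and zu: "\<And>x t. t \<notin> {0<..<T} \<Longrightarrow> u (x, t) = 0" and zG: "\<And>x t. t \<notin> {0<..<T} \<Longrightarrow> G (x, t) = 0"
    and ub: "\<And>p. \<bar>u p\<bar> \<le> M" and hb: "\<And>p. \<bar>h p\<bar> \<le> M'" and uh: "\<And>p. 0 \<le> u p * h p"
    and G2: "integrable lborel (\<lambda>p. (G p)\<^sup>2)" and h2: "integrable lborel (\<lambda>p. (h p)\<^sup>2)"
    and slice: "AE t in lborel. t \<in> {0<..<T} \<longrightarrow> (\<exists>d. AE x in lebesgue. h (x, t) = d + prim (\<lambda>x. G (x, t)) x)"
    and weak: "\<And>a b n k. (\<And>t. isCont k t) \<Longrightarrow>
      (\<integral>p. u p * test_fun a b n (fst p) * k (snd p) \<partial>lborel) =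
      (\<integral>p. G p * test_deriv a b n (fst p) * (prim k (snd p) - prim k T) \<partial>lborel)"
  shows "AE p in lborel. u p * h p = 0"
proof -
  define i where "i t = (indicator {0<..<T} t :: real)" for t
  have im[measurable]: "i \<in> borel_measurable borel" unfolding i_def[abs_def] by measurable
  have iint: "integrable lborel i" unfolding i_def[abs_def] by (rule integrable_real_indicator) (use T in auto)
  have i01: "i t = 0 \<or> i t = 1" "\<bar>i t\<bar> \<le> 1" for t by (auto simp: i_def indicator_def)
  \<comment> \<open>The factor i keeps P inside the strip; the bare time primitive would in general
    stay at a nonzero constant after T and leave L^2.\<close>
  define P where "P p = (\<integral>s. G (fst p, s) * (if s \<le> snd p then 1 else 0) \<partial>lborel) * i (snd p)" for p
  have Pm: "P \<in> borel_measurable borel"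
    unfolding P_def[abs_def] by (intro borel_measurable_times borel_partial_integral Gm borel_fst_snd im)
  have Mnn: "0 \<le> M" using ub[of "(0,0)"] by linarith
  note [measurable] = um hm Gm Pm
  note Gs = borel_slice[OF Gm] and us = borel_slice[OF um] and hs = borel_slice[OF hm] and Ps = borel_slice[OF Pm]
  have contm: "k \<in> borel_measurable borel" if "\<And>x. isCont k x" for k :: "real \<Rightarrow> real"
    using that by (intro borel_measurable_continuous_onI continuous_at_imp_continuous_on) auto
  define E where "E x = (\<integral>s. (G (x, s))\<^sup>2 \<partial>lborel)" for x
  have Eint: "integrable lborel E" unfolding E_def[abs_def] by (rule lborel_Fubini(3)[OF G2])
  have goodx: "AE x in lborel. integrable lborel (\<lambda>t. (G (x, t))\<^sup>2)" by (rule lborel_Fubini(1)[OF G2])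
  have Pbound: "(P (x, t))\<^sup>2 \<le> T * E x * i t" if "integrable lborel (\<lambda>t. (G (x, t))\<^sup>2)" for x t
    using integral_square_le(2)[OF T Gs(1) that zG, of t] i01(1)[of t] by (auto simp: P_def E_def)
  \<comment> \<open>The majorant is a product of an integrable function of x and an indicator in t.
    Square integrability of P also makes P h and P G integrable.\<close>
  have P2: "integrable lborel (\<lambda>p. (P p)\<^sup>2)"
  proof (rule Bochner_Integration.integrable_bound)
    show "integrable lborel (\<lambda>p. (T * E (fst p)) * i (snd p))"
      by (rule integrable_tensor) (use Eint iint in auto)
    have Em: "E \<in> borel_measurable borel" using borel_measurable_integrable[OF Eint] by simp
    have K: "(\<lambda>p::real\<times>real. T * E (fst p) * i (snd p)) \<in> borel_measurable borel"
      by (intro borel_measurable_times borel_fst_snd Em im borel_measurable_const)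
    have "AE p in lborel. (P p)\<^sup>2 \<le> T * E (fst p) * i (snd p)"
    proof (rule AE_lborel_prodI)
      show "{p. (P p)\<^sup>2 \<le> T * E (fst p) * i (snd p)} \<in> sets borel"
        using borel_measurable_le[of "\<lambda>p. (P p)\<^sup>2" borel "\<lambda>p. T * E (fst p) * i (snd p)"] K by simp
      show "AE x in lborel. AE t in lborel. (P (x, t))\<^sup>2 \<le> T * E (fst (x, t)) * i (snd (x, t))"
        using goodx by eventually_elim (simp add: Pbound)
    qed
    then show "AE p in lborel. norm ((P p)\<^sup>2) \<le> norm (T * E (fst p) * i (snd p))"
      by eventually_elim simp
  qed measurable
  have partial_eq: "(\<integral>s. G (x, s) * (if s \<le> t then 1 else 0) \<partial>lborel) = integral {0..t} (\<lambda>t. G (x, t))"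
    if g: "integrable lborel (\<lambda>t. (G (x, t))\<^sup>2)" for x t
  proof -
    have gl: "locally_integrable (\<lambda>t. G (x, t))" by (rule locally_integrable_of_square[OF Gs(1) g])
    have "(\<integral>s. G (x, s) * (if s \<le> t then 1 else 0) \<partial>lborel) = (\<integral>s. indicator {0..t} s * G (x, s) \<partial>lborel)"
      by (intro Bochner_Integration.integral_cong refl) (auto simp: indicator_def zG)
    also have "\<dots> = (\<integral>s. G (x, s) \<partial>lebesgue_on {0..t})"
      using integral_lebesgue_on_lborel(2)[OF Gs(1)] by simp
    also have "\<dots> = integral {0..t} (\<lambda>t. G (x, t))"
      by (rule lebesgue_integral_eq_integral[OF locally_integrableD(1)[OF gl]]) simp
    finally show ?thesis .
  qed
  have Pprim: "integrable (lebesgue_on {0..T}) (\<lambda>t. G (x, t))"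
    "\<And>t. t \<in> {0<..<T} \<Longrightarrow> P (x, t) = integral {0..t} (\<lambda>t. G (x, t))"
    if g: "integrable lborel (\<lambda>t. (G (x, t))\<^sup>2)" for x
  proof -
    have gl: "locally_integrable (\<lambda>t. G (x, t))"
      by (rule locally_integrable_of_square[OF Gs(1) g])
    then show "integrable (lebesgue_on {0..T}) (\<lambda>t. G (x, t))" by (rule locally_integrableD)
    show "P (x, t) = integral {0..t} (\<lambda>t. G (x, t))" if "t \<in> {0<..<T}" for t
      using partial_eq[OF g] that by (simp add: P_def i_def)
  qed
  \<comment> \<open>Integration by parts in time for fixed x. P agrees with the continuous primitive
    A inside (0,T), and A starts at 0, so only the boundary term at T remains.\<close>
  have tparts: "(\<integral>t. G (x, t) * B t + P (x, t) * v t \<partial>lborel) = integral {0..T} (\<lambda>t. G (x, t)) * B T"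
    if g: "integrable lborel (\<lambda>t. (G (x, t))\<^sup>2)"
      and v: "integrable (lebesgue_on {0..T}) v" and B: "\<And>t. t \<in> {0..T} \<Longrightarrow> B t = B 0 + integral {0..t} v"
      and Bm: "B \<in> borel_measurable borel" "v \<in> borel_measurable borel" for x B v
  proof -
    define A where "A t = integral {0..t} (\<lambda>t. G (x, t))" for t
    have A0: "A 0 = 0" by (simp add: A_def)
    have AP: "A t = P (x, t)" if "t \<in> {0<..<T}" for t using Pprim(2)[OF g that] by (simp add: A_def)
    have "(\<integral>t. G (x, t) * B t + A t * v t \<partial>lebesgue_on {0..T}) = A T * B T - A 0 * B 0"
      by (rule AC_integration_by_parts(2)[OF _ Pprim(1)[OF g] v _ B]) (use T in \<open>auto simp: A_def\<close>)
    then have e: "(\<integral>t. G (x, t) * B t + A t * v t \<partial>lebesgue_on {0..T}) = A T * B T" by (simp add: A0)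
    have intA: "integrable (lebesgue_on {0..T}) (\<lambda>t. G (x, t) * B t + A t * v t)"
      by (rule AC_integration_by_parts(1)[OF _ Pprim(1)[OF g] v _ B]) (use T in \<open>auto simp: A_def\<close>)
    have m: "(\<lambda>t. G (x, t) * B t + P (x, t) * v t) \<in> borel_measurable borel"
      by (intro borel_measurable_add borel_measurable_times Gs Ps Bm)
    have ml: "(\<lambda>t. G (x, t) * B t + P (x, t) * v t) \<in> borel_measurable (lebesgue_on {0..T})"
      using m by (intro measurable_restrict_space1 measurable_completion) simp
    have "AE t in lebesgue_on {0..T}. t \<noteq> 0 \<and> t \<noteq> T"
    proof -
      have "AE t in lborel. t \<noteq> 0 \<and> t \<noteq> T" using AE_lborel_singleton[of 0] AE_lborel_singleton[of T] by eventually_elim auto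
      then show ?thesis by (auto simp: AE_restrict_space_iff AE_completion_iff)
    qed
    moreover have "AE t in lebesgue_on {0..T}. t \<in> {0..T}" by (rule AE_I2) simp
    ultimately have "AE t in lebesgue_on {0..T}. G (x, t) * B t + A t * v t = G (x, t) * B t + P (x, t) * v t"
      by eventually_elim (use AP in \<open>auto simp: less_le\<close>)
    then have "(\<integral>t. G (x, t) * B t + A t * v t \<partial>lebesgue_on {0..T}) = (\<integral>t. G (x, t) * B t + P (x, t) * v t \<partial>lebesgue_on {0..T})"
      by (intro integral_cong_AE borel_measurable_integrable[OF intA] ml)
    also have "\<dots> = (\<integral>t. indicator {0..T} t * (G (x, t) * B t + P (x, t) * v t) \<partial>lborel)"
      by (rule integral_lebesgue_on_lborel(2)[OF m])
    also have "\<dots> = (\<integral>t. G (x, t) * B t + P (x, t) * v t \<partial>lborel)"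
      by (intro Bochner_Integration.integral_cong refl) (auto simp: indicator_def zG P_def i_def)
    finally show ?thesis using e by (simp add: A_def)
  qed
  \<comment> \<open>For one test function in x, K t is the defect in the identity P_x = u. The weak
    formulation with the time factor \<open>prim k t - prim k T\<close>, integrated by parts in t,
    says that K is orthogonal to every bounded continuous k; bumps in t then give K = 0 almost
    everywhere.\<close>
  have AE_t: "AE t in lborel. t \<in> {0<..<T} \<longrightarrow>
      (\<integral>x. P (x, t) * test_deriv a b n x \<partial>lebesgue) = - (\<integral>x. u (x, t) * test_fun a b n x \<partial>lebesgue)" for a b n
  proof -
    let ?f = "test_fun a b n" and ?d = "test_deriv a b n"
    have fdm: "?f \<in> borel_measurable borel" "?d \<in> borel_measurable borel"
      by (intro contm isCont_test_fun isCont_test_deriv)+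
    have fint: "integrable lborel (\<lambda>x. (?f x)\<^sup>2)" "integrable lborel (\<lambda>x. (?d x)\<^sup>2)" "integrable lborel ?f"
    proof -
      have *: "integrable lborel q" if q: "\<And>x. isCont q x" "\<And>x. x \<notin> {min a 0..max b 1} \<Longrightarrow> q x = 0" for q :: "real \<Rightarrow> real"
        using compact_support_integral(1)[OF locally_integrable_continuous[OF q(1)] q(2)]
          integrable_lborel_lebesgue(1)[OF contm[OF q(1)]] by simp
      show "integrable lborel (\<lambda>x. (?f x)\<^sup>2)" "integrable lborel (\<lambda>x. (?d x)\<^sup>2)" "integrable lborel ?f"
        by (intro * continuous_intros isCont_test_fun isCont_test_deriv; simp add: test_fun_outside test_deriv_outside)+
    qed
    define F where "F p = u p * ?f (fst p) + P p * ?d (fst p)" for p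
    define F1 where "F1 p = u p * ?f (fst p)" for p
    define F2 where "F2 p = P p * ?d (fst p)" for p
    have Fm: "F1 \<in> borel_measurable borel" "F2 \<in> borel_measurable borel"
      unfolding F1_def[abs_def] F2_def[abs_def] by (intro borel_measurable_times um Pm borel_fst_snd fdm)+
    have dtens: "integrable lborel (\<lambda>p. (?d (fst p) * i (snd p))\<^sup>2)"
    proof -
      have "integrable lborel (\<lambda>p. (?d (fst p))\<^sup>2 * i (snd p))" by (rule integrable_tensor[OF fint(2) iint])
      moreover have "(?d (fst p) * i (snd p))\<^sup>2 = (?d (fst p))\<^sup>2 * i (snd p)" for p
        using i01(1)[of "snd p"] by auto
      ultimately show ?thesis by simp
    qed
    have dm2: "(\<lambda>p. ?d (fst p) * i (snd p)) \<in> borel_measurable borel"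
      by (intro borel_measurable_times borel_fst_snd fdm im)
    have F1i: "integrable lborel F1"
    proof (rule Bochner_Integration.integrable_bound)
      show "integrable lborel (\<lambda>p. M * (?f (fst p) * i (snd p)))"
        by (intro integrable_mult_right integrable_tensor fint iint)
      show "AE p in lborel. norm (F1 p) \<le> norm (M * (?f (fst p) * i (snd p)))"
      proof (rule AE_I2)
        fix p :: "real \<times> real"
        obtain x t where p: "p = (x, t)" by (cases p)
        have "\<bar>u (x, t)\<bar> \<le> M * i t" using ub[of "(x, t)"] zu[of t x] by (cases "t \<in> {0<..<T}") (auto simp: i_def)
        then have "\<bar>u (x, t)\<bar> * \<bar>?f x\<bar> \<le> M * i t * \<bar>?f x\<bar>" by (intro mult_right_mono) auto
        then show "norm (F1 p) \<le> norm (M * (?f (fst p) * i (snd p)))"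
          using Mnn i01(1)[of t] by (auto simp: F1_def p abs_mult mult_ac)
      qed
    qed (use Fm in simp)
    have F2i: "integrable lborel F2"
    proof -
      have "integrable lborel (\<lambda>p. P p * (?d (fst p) * i (snd p)))"
        by (rule integrable_mult_L2) (use Pm dm2 P2 dtens in simp_all)
      moreover have "P p * (?d (fst p) * i (snd p)) = F2 p" for p
        using i01(1)[of "snd p"] by (auto simp: F2_def P_def)
      ultimately show ?thesis by simp
    qed
    have F_eq: "F p = F1 p + F2 p" for p by (simp add: F_def F1_def F2_def)
    have Fi: "integrable lborel F" using F1i F2i by (simp add: F_eq[abs_def])
    define K where "K t = (\<integral>x. F (x, t) \<partial>lborel)" for t
    have Ki: "integrable lborel K" unfolding K_def[abs_def] by (rule lborel_Fubini(4)[OF Fi])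
    have Km: "K \<in> borel_measurable borel" using borel_measurable_integrable[OF Ki] by simp
    have Kl: "locally_integrable K"
      by (rule locally_integrable_lborelI[OF Km])
        (use integrable_mult_bounded[OF Ki, of "indicator {a..b}" 1 for a b] in \<open>auto simp: mult.commute indicator_def\<close>)
    have Kk: "(\<integral>t. K t * k t \<partial>lborel) = 0" if k: "\<And>t. isCont k t" and kb: "\<And>t. \<bar>k t\<bar> \<le> B" for k B
    proof -
      have km: "k \<in> borel_measurable borel" by (rule contm[OF k])
      define th where "th t = prim k t - prim k T" for t
      have thd: "DERIV th t :> k t" for t
      proof -
        have "DERIV (\<lambda>t. prim k t - prim k T) t :> k t - 0" by (intro derivative_intros DERIV_prim k)
        then show ?thesis by (simp add: th_def[abs_def])
      qed
      have thc: "isCont th t" for t by (rule DERIV_isCont[OF thd])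
      have thmeas: "th \<in> borel_measurable borel" by (rule contm[OF thc])
      obtain C where C: "\<And>t. t \<in> {0..T} \<Longrightarrow> \<bar>th t\<bar> \<le> C"
        using continuous_attains_sup[of "{0..T}" "\<lambda>t. \<bar>th t\<bar>"] T thc
        by (force intro!: continuous_at_imp_continuous_on continuous_intros)
      have Fk: "integrable lborel (\<lambda>p. F1 p * k (snd p))" "integrable lborel (\<lambda>p. F2 p * k (snd p))"
        "integrable lborel (\<lambda>p. F p * k (snd p))"
        by (intro integrable_mult_bounded[where B=B] F1i F2i Fi; simp add: borel_fst_snd(2)[OF km] kb)+
      have Gth: "integrable lborel (\<lambda>p. G p * ?d (fst p) * th (snd p))"
      proof -
        have 1: "integrable lborel (\<lambda>p. G p * (?d (fst p) * i (snd p)))"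
          by (rule integrable_mult_L2) (use Gm dm2 G2 dtens in simp_all)
        have ithm: "(\<lambda>t. i t * th t) \<in> borel_measurable borel" using im thmeas by measurable
        have "integrable lborel (\<lambda>p. G p * (?d (fst p) * i (snd p)) * (i (snd p) * th (snd p)))"
          by (rule integrable_mult_bounded[OF 1, of _ "\<bar>C\<bar>"])
            (use borel_fst_snd(2)[OF ithm] C in \<open>auto simp: i_def indicator_def intro: order_trans[OF _ abs_ge_self]\<close>)
        moreover have "G p * (?d (fst p) * i (snd p)) * (i (snd p) * th (snd p)) = G p * ?d (fst p) * th (snd p)" for p
          using zG[of "snd p" "fst p"] by (cases "snd p \<in> {0<..<T}") (auto simp: i_def)
        ultimately show ?thesis by simp
      qed
      \<comment> \<open>For fixed x this is integration by parts in t; \<open>th\<close> vanishes at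
        T and the primitive of G at 0, so no boundary term is left.\<close>
      have sum0: "(\<integral>p. G p * ?d (fst p) * th (snd p) + F2 p * k (snd p) \<partial>lborel) = 0"
      proof -
        have I: "integrable lborel (\<lambda>p. G p * ?d (fst p) * th (snd p) + F2 p * k (snd p))" using Gth Fk(2) by simp
        have "AE x in lborel. (\<integral>t. G (x, t) * ?d (fst (x, t)) * th (snd (x, t)) + F2 (x, t) * k (snd (x, t)) \<partial>lborel) = 0"
          using goodx
        proof eventually_elim
          case (elim x)
          have "(k has_integral (th t - th 0)) {0..t}" if "0 \<le> t" for t
            by (rule fundamental_theorem_of_calculus)
              (use that thd in \<open>auto simp: has_real_derivative_iff_has_vector_derivative[symmetric] intro: has_field_derivative_at_within\<close>)
          then have B: "th t = th 0 + integral {0..t} k" if "t \<in> {0..T}" for t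
            using that integral_unique[of k "th t - th 0" "{0..t}"] by simp
          have "(\<integral>t. G (x, t) * th t + P (x, t) * k t \<partial>lborel) = integral {0..T} (\<lambda>t. G (x, t)) * th T"
            by (rule tparts[OF elim locally_integrableD(1)[OF locally_integrable_continuous[OF k]] B thmeas km])
          then have z: "(\<integral>t. G (x, t) * th t + P (x, t) * k t \<partial>lborel) = 0" by (simp add: th_def)
          have "(\<integral>t. G (x, t) * ?d (fst (x, t)) * th (snd (x, t)) + F2 (x, t) * k (snd (x, t)) \<partial>lborel) =
             (\<integral>t. ?d x * (G (x, t) * th t + P (x, t) * k t) \<partial>lborel)"
            by (intro Bochner_Integration.integral_cong refl) (simp add: F2_def algebra_simps)
          also have "\<dots> = ?d x * (\<integral>t. G (x, t) * th t + P (x, t) * k t \<partial>lborel)" by (rule integral_mult_right_zero)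
          finally show ?case using z by simp
        qed
        then have "(\<integral>x. (\<integral>t. G (x, t) * ?d (fst (x, t)) * th (snd (x, t)) + F2 (x, t) * k (snd (x, t)) \<partial>lborel) \<partial>lborel) = 0"
          by (rule integral_eq_zero_AE)
        then show ?thesis using lborel_Fubini(5)[OF I] by simp
      qed
      have "(\<integral>p. F1 p * k (snd p) \<partial>lborel) = (\<integral>p. G p * ?d (fst p) * th (snd p) \<partial>lborel)"
        using weak[OF k, of a b n] by (simp add: F1_def th_def)
      then have "(\<integral>p. F p * k (snd p) \<partial>lborel) = 0"
        using sum0 Gth Fk(1,2) by (simp add: F_eq distrib_right)
      then show ?thesis using lborel_Fubini(6)[OF Fk(3)] by (simp add: K_def)
    qed
    have "AE t in lebesgue. K t = 0"
    proof (rule AE_eq_0_of_integral_eq_0[OF locally_integrableD(3)[OF Kl]])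
      fix c d :: real
      have "(\<integral>t. K t * bump c d m t \<partial>lebesgue) = 0" for m
      proof -
        have bm: "(\<lambda>t. K t * bump c d m t) \<in> borel_measurable borel"
          by (intro borel_measurable_times Km contm isCont_bump)
        have "(\<integral>t. K t * bump c d m t \<partial>lborel) = 0"
          by (rule Kk[OF isCont_bump, of _ _ _ 1]) (use bump_nonneg bump_le_1 in simp)
        then show ?thesis using integrable_lborel_lebesgue(2)[OF bm] by simp
      qed
      then show "integral {c..d} K = 0"
        using bump_integral_LIMSEQ[OF Kl, of c d] LIMSEQ_unique[OF tendsto_const] by fastforce
    qed
    then have K0: "AE t in lborel. K t = 0" by (rule AE_lebesgue_lborel)
    have "AE t in lborel. integrable lborel (\<lambda>x. F1 (x, t))" "AE t in lborel. integrable lborel (\<lambda>x. F2 (x, t))"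
      by (rule lborel_Fubini(2)[OF F1i], rule lborel_Fubini(2)[OF F2i])
    with K0 show ?thesis
    proof eventually_elim
      case (elim t)
      have "(\<integral>x. F1 (x, t) \<partial>lborel) + (\<integral>x. F2 (x, t) \<partial>lborel) = 0"
        using elim by (simp add: K_def F_eq)
      moreover have "(\<integral>x. F1 (x, t) \<partial>lebesgue) = (\<integral>x. F1 (x, t) \<partial>lborel)"
        "(\<integral>x. F2 (x, t) \<partial>lebesgue) = (\<integral>x. F2 (x, t) \<partial>lborel)"
        by (rule integrable_lborel_lebesgue(2)[OF borel_slice(2)[OF Fm(1)]],
            rule integrable_lborel_lebesgue(2)[OF borel_slice(2)[OF Fm(2)]])
      ultimately show ?case by (simp add: F1_def F2_def)
    qed
  qed
  have P2t: "AE t in lborel. integrable lborel (\<lambda>x. (P (x, t))\<^sup>2)" by (rule lborel_Fubini(2)[OF P2])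
  have G2t: "AE t in lborel. integrable lborel (\<lambda>x. (G (x, t))\<^sup>2)" by (rule lborel_Fubini(2)[OF G2])
  \<comment> \<open>The exceptional null set of times depends on the test function; with rational a,
    b and natural n the union of these sets is still null.\<close>
  have AE_all: "AE t in lborel. \<forall>a\<in>\<rat>. \<forall>b\<in>\<rat>. \<forall>n. t \<in> {0<..<T} \<longrightarrow>
      (\<integral>x. P (x, t) * test_deriv a b n x \<partial>lebesgue) = - (\<integral>x. u (x, t) * test_fun a b n x \<partial>lebesgue)"
    by (intro AE_ball_countable' countable_rat AE_t) (simp only: AE_all_countable, blast intro: AE_t)
  have Pslice: "AE t in lborel. t \<in> {0<..<T} \<longrightarrow> (\<exists>c. AE x in lebesgue. P (x, t) = c + prim (\<lambda>x. u (x, t)) x)"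
    using AE_all P2t
  proof eventually_elim
    case (elim t)
    show ?case
    proof
      assume t: "t \<in> {0<..<T}"
      show "\<exists>c. AE x in lebesgue. P (x, t) = c + prim (\<lambda>x. u (x, t)) x"
        by (rule weak_primitive[OF locally_integrable_bounded[OF us(2) ub] locally_integrable_of_square[OF Ps(2) elim(2)]])
          (use elim(1) t in blast)
    qed
  qed
  \<comment> \<open>P and h are merely square integrable in x, so the energy identity is localized
    by w (x / r). Near the origin w is at least c0 > 0, and the derivative of the rescaled cutoff is
    bounded by B/r.\<close>
  define w where "w = bump (-1) 1 0"
  define w' where "w' = deriv w"
  have ws: "smooth w" unfolding w_def by (rule smooth_bump)
  have wd: "DERIV w x :> w' x" and wc: "isCont w x" and w'c: "isCont w' x" for x
    using smooth_isCont[OF ws] by (auto simp: w'_def)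
  have wz: "w x = 0" if "\<bar>x\<bar> > 1" for x using that by (auto simp: w_def intro!: bump_outside)
  have w'z: "w' x = 0" if "\<bar>x\<bar> > 1" for x unfolding w'_def by (rule compact_support_deriv[OF wz that])
  have w01: "0 \<le> w x" "w x \<le> 1" for x by (auto simp: w_def bump_nonneg bump_le_1)
  obtain B where B: "\<And>x. x \<in> {-1..1} \<Longrightarrow> \<bar>w' x\<bar> \<le> B"
    using continuous_attains_sup[of "{-1..1::real}" "\<lambda>x. \<bar>w' x\<bar>"] w'c
    by (force intro!: continuous_at_imp_continuous_on continuous_intros)
  have B0: "0 \<le> B" using B[of 0] by auto
  have w'B: "\<bar>w' x\<bar> \<le> B" for x
  proof (cases "\<bar>x\<bar> > 1")
    case False
    then have "x \<in> {-1..1}" by auto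
    then show ?thesis by (rule B)
  qed (simp add: w'z B0)
  obtain c0 where c0: "c0 > 0" "\<And>x. x \<in> {-1/2..1/2} \<Longrightarrow> c0 \<le> w x"
  proof -
    have "continuous_on {-1/2..1/2} w" using wc by (simp add: continuous_at_imp_continuous_on)
    then obtain y where y: "y \<in> {-1/2..1/2}" "\<And>x. x \<in> {-1/2..1/2} \<Longrightarrow> w y \<le> w x"
      using continuous_attains_inf[of "{-1/2..1/2::real}" w] by auto
    have "w y > 0" unfolding w_def by (rule bump_pos) (use y in auto)
    with y show thesis using that by blast
  qed
  define C where "C = (\<integral>p. \<bar>P p * h p\<bar> \<partial>lborel)"
  have Phi: "integrable lborel (\<lambda>p. P p * h p)" by (rule integrable_mult_L2) (use Pm hm P2 h2 in simp_all)
  have PGi: "integrable lborel (\<lambda>p. P p * G p)" by (rule integrable_mult_L2) (use Pm Gm P2 G2 in simp_all)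
  have main: "integrable lborel (\<lambda>p. u p * h p * w (fst p / r))"
    "(\<integral>p. u p * h p * w (fst p / r) \<partial>lborel) \<le> B / r * C" if r: "r > 0" for r
  proof -
    define X where "X x = w (x / r)" for x
    define X' where "X' x = w' (x / r) / r" for x
    have Xc: "isCont X x" "isCont X' x" for x
      unfolding X_def[abs_def] X'_def[abs_def] using r by (intro continuous_intros isCont_o2[OF _ wc] isCont_o2[OF _ w'c]; simp)+
    have Xd: "DERIV X x :> X' x" for x
    proof -
      have "DERIV (\<lambda>x. w (x / r)) x :> w' (x / r) * (1 / r)"
        by (rule DERIV_chain2[OF wd]) (use r in \<open>auto intro!: derivative_eq_intros\<close>)
      then show ?thesis by (simp add: X_def[abs_def] X'_def)
    qed
    have Xz: "X x = 0" if "\<bar>x\<bar> > r" for x unfolding X_def using that r by (intro wz) (simp add: less_divide_eq_1_pos)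
    have Xm: "X \<in> borel_measurable borel" "X' \<in> borel_measurable borel" by (intro contm Xc)+
    have X01: "0 \<le> X x" "\<bar>X x\<bar> \<le> 1" "\<bar>X' x\<bar> \<le> B / r" for x
      using w01[of "x / r"] w'B[of "x / r"] r by (simp_all add: X_def X'_def divide_right_mono)
    have Xi: "integrable lborel X"
    proof -
      have "integrable lebesgue X"
        by (rule compact_support_integral(1)[OF locally_integrable_continuous[OF Xc(1)], of "-r" r]) (auto intro!: Xz)
      then show ?thesis using integrable_lborel_lebesgue(1)[OF Xm(1)] by simp
    qed
    have I1: "integrable lborel (\<lambda>p. u p * h p * X (fst p))"
    proof (rule Bochner_Integration.integrable_bound)
      show "integrable lborel (\<lambda>p. (M * M') * (X (fst p) * i (snd p)))"
        by (intro integrable_mult_right integrable_tensor Xi iint)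
      show "AE p in lborel. norm (u p * h p * X (fst p)) \<le> norm ((M * M') * (X (fst p) * i (snd p)))"
      proof (rule AE_I2)
        fix p :: "real \<times> real"
        obtain x t where p: "p = (x, t)" by (cases p)
        have "\<bar>u p\<bar> * \<bar>h p\<bar> \<le> M * M'" using ub[of p] hb[of p] Mnn by (intro mult_mono) auto
        moreover have "u p = 0" if "i t = 0" using zu[of t x] that by (auto simp: i_def p indicator_def split: if_splits)
        ultimately have "\<bar>u p\<bar> * \<bar>h p\<bar> \<le> M * M' * i t" using i01(1)[of t] by auto
        then have "\<bar>u p\<bar> * \<bar>h p\<bar> * X x \<le> M * M' * i t * X x" using X01(1) by (intro mult_right_mono) auto
        then show "norm (u p * h p * X (fst p)) \<le> norm ((M * M') * (X (fst p) * i (snd p)))"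
          using X01(1)[of x] abs_ge_self[of "M * M' * (X x * i t)"] by (simp add: p abs_mult mult_ac)
      qed
    qed (intro borel_measurable_times um hm borel_fst_snd Xm, simp_all add: um hm borel_fst_snd Xm)
    then show "integrable lborel (\<lambda>p. u p * h p * w (fst p / r))" by (simp add: X_def)
    have I2: "integrable lborel (\<lambda>p. P p * G p * X (fst p))"
      by (rule integrable_mult_bounded[OF PGi, of _ 1]) (use borel_fst_snd(1)[OF Xm(1)] X01 in simp_all)
    have I3: "integrable lborel (\<lambda>p. P p * h p * X' (fst p))"
      by (rule integrable_mult_bounded[OF Phi, of _ "B / r"]) (use borel_fst_snd(1)[OF Xm(2)] X01 in simp_all)
    \<comment> \<open>On almost every time slice P_x = u and h_x = G, so the three integrands add up
      to the derivative of P h X.\<close>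
    have "AE t in lborel. (\<integral>x. u (x, t) * h (x, t) * X x \<partial>lborel) + (\<integral>x. P (x, t) * G (x, t) * X x \<partial>lborel)
         + (\<integral>x. P (x, t) * h (x, t) * X' x \<partial>lborel) = 0"
      using Pslice slice P2t G2t lborel_Fubini(2)[OF I1] lborel_Fubini(2)[OF I2] lborel_Fubini(2)[OF I3]
    proof eventually_elim
      case (elim t)
      show ?case
      proof (cases "t \<in> {0<..<T}")
        case True
        obtain c d where cd: "AE x in lebesgue. P (x, t) = c + prim (\<lambda>x. u (x, t)) x"
          "AE x in lebesgue. h (x, t) = d + prim (\<lambda>x. G (x, t)) x"
          using elim(1,2) True by blast
        show ?thesis
          by (rule weighted_parts[OF locally_integrable_bounded[OF us(2) ub] locally_integrable_of_square[OF Gs(2) elim(4)]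
                cd Ps(2) hs(2) us(2) Gs(2) Xd Xc(2) Xz])
            (use elim(5-7) in simp_all)
      next
        case False
        then show ?thesis by (simp add: zu zG P_def i_def)
      qed
    qed
    then have "(\<integral>t. (\<integral>x. u (x, t) * h (x, t) * X x \<partial>lborel) + (\<integral>x. P (x, t) * G (x, t) * X x \<partial>lborel)
         + (\<integral>x. P (x, t) * h (x, t) * X' x \<partial>lborel) \<partial>lborel) = 0"
      by (rule integral_eq_zero_AE)
    then have tot: "(\<integral>p. u p * h p * X (fst p) \<partial>lborel) + (\<integral>p. P p * G p * X (fst p) \<partial>lborel)
         + (\<integral>p. P p * h p * X' (fst p) \<partial>lborel) = 0"
      using lborel_Fubini(4)[OF I1] lborel_Fubini(4)[OF I2] lborel_Fubini(4)[OF I3]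
        lborel_Fubini(6)[OF I1] lborel_Fubini(6)[OF I2] lborel_Fubini(6)[OF I3] by simp
    \<comment> \<open>For fixed x, P_t = G, so 2 \<integral>P G dt is the square of the primitive at
      T. It comes from \<open>tparts\<close> by pairing G with its own primitive B, left without the
      cutoff in time because the primitive identity must hold up to t = T.\<close>
    have PGnn: "0 \<le> (\<integral>p. P p * G p * X (fst p) \<partial>lborel)"
    proof -
      have "AE x in lborel. 0 \<le> (\<integral>t. P (x, t) * G (x, t) * X (fst (x, t)) \<partial>lborel)"
        using goodx
      proof eventually_elim
        case (elim x)
        define B where "B t = (\<integral>s. G (x, s) * (if s \<le> t then 1 else 0) \<partial>lborel)" for t
        have Bt: "B t = integral {0..t} (\<lambda>t. G (x, t))" for t unfolding B_def by (rule partial_eq[OF elim])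
        have Bm: "B \<in> borel_measurable borel"
          unfolding B_def using borel_slice(1)[OF borel_partial_integral[OF Gm], of x] by simp
        have PB: "G (x, t) * B t + P (x, t) * G (x, t) = 2 * (P (x, t) * G (x, t))" for t
          using zG[of t x] by (cases "t \<in> {0<..<T}") (auto simp: P_def B_def i_def)
        have "(\<integral>t. G (x, t) * B t + P (x, t) * G (x, t) \<partial>lborel) = integral {0..T} (\<lambda>t. G (x, t)) * B T"
          by (rule tparts[OF elim Pprim(1)[OF elim] _ Bm Gs(1)]) (simp add: Bt)
        also have "\<dots> = (B T)\<^sup>2" by (simp add: Bt power2_eq_square)
        finally have "2 * (\<integral>t. P (x, t) * G (x, t) \<partial>lborel) = (B T)\<^sup>2" unfolding PB by simp
        then have "0 \<le> (\<integral>t. P (x, t) * G (x, t) \<partial>lborel)" using zero_le_power2[of "B T"] by linarith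
        then show ?case using X01(1)[of x] by simp
      qed
      then have "0 \<le> (\<integral>x. (\<integral>t. P (x, t) * G (x, t) * X (fst (x, t)) \<partial>lborel) \<partial>lborel)"
        by (rule integral_nonneg_AE)
      then show ?thesis using lborel_Fubini(5)[OF I2] by simp
    qed
    \<comment> \<open>The only term without a sign is the one with X', and it is O(1/r) because P h
      is integrable.\<close>
    have "- (\<integral>p. P p * h p * X' (fst p) \<partial>lborel) \<le> \<bar>\<integral>p. P p * h p * X' (fst p) \<partial>lborel\<bar>" by simp
    also have "\<dots> \<le> (\<integral>p. \<bar>P p * h p * X' (fst p)\<bar> \<partial>lborel)" by (rule integral_abs_bound)
    also have "\<dots> \<le> (\<integral>p. B / r * \<bar>P p * h p\<bar> \<partial>lborel)"
    proof (rule integral_mono)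
      show "\<bar>P p * h p * X' (fst p)\<bar> \<le> B / r * \<bar>P p * h p\<bar>" for p
        using mult_left_mono[OF X01(3)[of "fst p"], of "\<bar>P p * h p\<bar>"] by (simp add: abs_mult mult.commute)
    qed (use I3 Phi in auto)
    also have "\<dots> = B / r * C" by (simp add: C_def)
    finally show "(\<integral>p. u p * h p * w (fst p / r) \<partial>lborel) \<le> B / r * C"
      using tot PGnn by (simp add: X_def)
  qed
  \<comment> \<open>For r \<ge> 2 k the slab |x| \<le> k is scaled into [-1/2,1/2], so c0 times the
    integral of u h over the slab is at most B C / r for all such r, hence 0.\<close>
  have zero: "AE p in lborel. \<bar>fst p\<bar> \<le> real k \<longrightarrow> u p * h p = 0" for k :: nat
  proof -
    define S where "S p = (if \<bar>fst p\<bar> \<le> real k then u p * h p else 0)" for p :: "real \<times> real"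
    have "{p :: real \<times> real. \<bar>fst p\<bar> \<le> real k} \<in> sets borel"
      by (intro borel_closed closed_Collect_le continuous_intros)
    then have Sm: "S \<in> borel_measurable borel"
      unfolding S_def by (intro measurable_If borel_measurable_times um hm) (auto simp: pred_def)
    have Snn: "0 \<le> S p" for p using uh by (simp add: S_def)
    have le: "c0 * S p \<le> u p * h p * w (fst p / r)" if "r > 0" "r \<ge> 2 * real k" for p r
    proof (cases "\<bar>fst p\<bar> \<le> real k")
      case True
      then have "\<bar>fst p / r\<bar> \<le> 1/2" using that by (simp add: field_simps)
      then have "fst p / r \<in> {-1/2..1/2}" unfolding atLeastAtMost_iff by linarith
      then have "c0 \<le> w (fst p / r)" by (rule c0)
      then have "(u p * h p) * c0 \<le> (u p * h p) * w (fst p / r)" using uh by (intro mult_left_mono)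
      then show ?thesis using True by (simp add: S_def mult.commute)
    next
      case False
      then show ?thesis using uh[of p] w01(1) by (simp add: S_def)
    qed
    have Si: "integrable lborel S"
    proof -
      have "integrable lborel (\<lambda>p. c0 * S p)"
      proof (rule Bochner_Integration.integrable_bound[OF main(1)[of "2 * real k + 1"]])
        show "AE p in lborel. norm (c0 * S p) \<le> norm (u p * h p * w (fst p / (2 * real k + 1)))"
        proof (rule AE_I2)
          fix p
          have "norm (c0 * S p) = c0 * S p" using Snn[of p] c0(1) by simp
          also have "\<dots> \<le> u p * h p * w (fst p / (2 * real k + 1))" by (rule le) auto
          finally show "norm (c0 * S p) \<le> norm (u p * h p * w (fst p / (2 * real k + 1)))" by simp
        qed
      qed (use Sm in auto)
      then show ?thesis using c0(1) by simp
    qed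
    have bound: "c0 * (\<integral>p. S p \<partial>lborel) \<le> B / r * C" if "r > 0" "r \<ge> 2 * real k" for r
    proof -
      have "(\<integral>p. c0 * S p \<partial>lborel) \<le> (\<integral>p. u p * h p * w (fst p / r) \<partial>lborel)"
        by (rule integral_mono[OF _ main(1)[OF that(1)] le[OF that]]) (use Si in simp)
      then show ?thesis using main(2)[OF that(1)] by simp
    qed
    have "((\<lambda>r. B / r * C) \<longlongrightarrow> 0 * C) at_top"
      by (intro tendsto_mult tendsto_const tendsto_divide_0[OF tendsto_const] filterlim_at_top_imp_at_infinity filterlim_ident)
    then have "c0 * (\<integral>p. S p \<partial>lborel) \<le> 0 * C"
    proof (rule tendsto_lowerbound)
      show "\<forall>\<^sub>F r in at_top. c0 * (\<integral>p. S p \<partial>lborel) \<le> B / r * C"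
        using eventually_gt_at_top[of 0] eventually_ge_at_top[of "2 * real k"] by eventually_elim (rule bound)
    qed simp
    then have "(\<integral>p. S p \<partial>lborel) \<le> 0" using c0(1) by (simp add: mult_le_0_iff)
    moreover have "0 \<le> (\<integral>p. S p \<partial>lborel)" by (intro Bochner_Integration.integral_nonneg Snn)
    ultimately have "(\<integral>p. S p \<partial>lborel) = 0" by linarith
    then have "AE p in lborel. S p = 0" using integral_nonneg_eq_0_iff_AE[OF Si] Snn by simp
    then show ?thesis by eventually_elim (simp add: S_def split: if_splits)
  qed
  have "AE p in lborel. \<forall>k::nat. \<bar>fst p\<bar> \<le> real k \<longrightarrow> u p * h p = 0"
    unfolding AE_all_countable by (intro allI zero)
  then show ?thesis
  proof eventually_elim
    case (elim p)
    then show ?case using real_arch_simple[of "\<bar>fst p\<bar>"] by blast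
  qed
qed

section \<open>Representatives, energy bounds and test functions on the strip\<close>

lemma QT_sets: "QT T \<in> sets borel" "QT T \<in> sets lebesgue"
proof -
  have "open (QT T)" unfolding QT_def by (intro open_Times) auto
  then show "QT T \<in> sets borel" by (rule borel_open)
  then show "QT T \<in> sets lebesgue" by (simp add: sets_completionI_sets)
qed

lemma AE_lebesgue_on_iff_lborel:
  fixes S :: "'a::euclidean_space set"
  assumes "S \<in> sets lebesgue"
  shows "(AE p in lebesgue_on S. Q p) \<longleftrightarrow> (AE p in lborel. p \<in> S \<longrightarrow> Q p)"
  using assms by (simp add: AE_restrict_space_iff AE_completion_iff)

text \<open>A Borel function extended by 0 off the strip has measurable slices at every time and
  lets Fubini be applied over the whole plane.\<close>

lemma borel_representative:
  fixes f :: "real \<times> real \<Rightarrow> real"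
  assumes f: "f \<in> borel_measurable (lebesgue_on (QT T))"
  obtains r where "r \<in> borel_measurable borel" "\<And>x t. t \<notin> {0<..<T} \<Longrightarrow> r (x, t) = 0"
    "AE p in lborel. p \<in> QT T \<longrightarrow> r p = f p"
proof -
  have "(\<lambda>p. if p \<in> QT T then f p else 0) \<in> borel_measurable lebesgue"
    using f QT_sets(2) by (intro borel_measurable_if_I)
  then obtain r where r: "r \<in> borel_measurable lborel" "AE p in lborel. (if p \<in> QT T then f p else 0) = r p"
    using completion_ex_borel_measurable_real by blast
  have rm: "r \<in> borel_measurable borel" using r(1) by simp
  show thesis
  proof (rule that)
    show "(\<lambda>p. indicator (QT T) p * r p) \<in> borel_measurable borel"
      using rm QT_sets(1) by (intro borel_measurable_times borel_measurable_indicator) auto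
    show "indicator (QT T) (x, t) * r (x, t) = 0" if "t \<notin> {0<..<T}" for x t
      using that by (simp add: QT_def indicator_def)
    show "AE p in lborel. p \<in> QT T \<longrightarrow> indicator (QT T) p * r p = f p"
      using r(2) by eventually_elim auto
  qed
qed

text \<open>Truncating at |M| changes the representative on a null set of the strip and turns the
  essential bound into one at every point, the form that \<open>dual_energy\<close> uses.\<close>

lemma borel_representative_bounded:
  fixes f :: "real \<times> real \<Rightarrow> real"
  assumes f: "f \<in> L_infinity (QT T)"
  obtains r M where "r \<in> borel_measurable borel" "\<And>x t. t \<notin> {0<..<T} \<Longrightarrow> r (x, t) = 0"
    "AE p in lborel. p \<in> QT T \<longrightarrow> r p = f p" "\<And>p. \<bar>r p\<bar> \<le> M"
proof -
  obtain M where M: "AE p in lborel. p \<in> QT T \<longrightarrow> \<bar>f p\<bar> \<le> M"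
    using f QT_sets(2) by (auto simp: L_infinity_def AE_lebesgue_on_iff_lborel)
  obtain r where r: "r \<in> borel_measurable borel" "\<And>x t. t \<notin> {0<..<T} \<Longrightarrow> r (x, t) = 0"
    "AE p in lborel. p \<in> QT T \<longrightarrow> r p = f p"
    using f borel_representative[of f T] by (auto simp: L_infinity_def)
  show thesis
  proof (rule that)
    show "(\<lambda>p. max (- \<bar>M\<bar>) (min \<bar>M\<bar> (r p))) \<in> borel_measurable borel" using r(1) by measurable
    show "max (- \<bar>M\<bar>) (min \<bar>M\<bar> (r (x, t))) = 0" if "t \<notin> {0<..<T}" for x t using r(2)[OF that] by simp
    show "AE p in lborel. p \<in> QT T \<longrightarrow> max (- \<bar>M\<bar>) (min \<bar>M\<bar> (r p)) = f p"
      using r(3) M by eventually_elim auto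
    show "\<bar>max (- \<bar>M\<bar>) (min \<bar>M\<bar> (r p))\<bar> \<le> \<bar>M\<bar>" for p by auto
  qed
qed

lemma integrable_lborel_prodI':
  fixes F :: "real \<times> real \<Rightarrow> real"
  assumes F: "F \<in> borel_measurable borel" and i: "AE t in lborel. integrable lborel (\<lambda>x. F (x, t))"
    "integrable lborel (\<lambda>t. \<integral>x. \<bar>F (x, t)\<bar> \<partial>lborel)"
  shows "integrable lborel F"
proof -
  have m: "(\<lambda>p. F (snd p, fst p)) \<in> borel_measurable borel"
    by (rule measurable_compose[OF _ F]) (intro borel_measurable_continuous_onI continuous_intros)
  have "integrable lborel (\<lambda>p. F (snd p, fst p))"
    by (rule integrable_lborel_prodI[OF m]) (use i in simp_all)
  then have "integrable (lborel \<Otimes>\<^sub>M lborel) (\<lambda>(x, y). F (y, x))"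
    unfolding lborel_prod case_prod_beta .
  then show ?thesis
    using lborel_pair.integrable_product_swap_iff[of F] unfolding lborel_prod by blast
qed

lemma locally_integrable_cong_AE:
  assumes u: "locally_integrable u" and v: "v \<in> borel_measurable borel" and ae: "AE x in lebesgue. u x = v x"
  shows "locally_integrable v"
  unfolding locally_integrable_def
proof
  fix J
  have "v \<in> borel_measurable (lebesgue_on {-J..J})"
    using v by (intro measurable_restrict_space1 measurable_completion) simp
  moreover have "AE x in lebesgue. x \<in> {-J..J} \<longrightarrow> u x = v x" using ae by eventually_elim simp
  then have "AE x in lebesgue_on {-J..J}. u x = v x" by (simp add: AE_restrict_space_iff)
  moreover have "integrable (lebesgue_on {-J..J}) u" using u by (simp add: locally_integrable_def)
  ultimately show "integrable (lebesgue_on {-J..J}) v"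
    using integrable_cong_AE[of u "lebesgue_on {-J..J}" v] by auto
qed

lemma W12_square_bounds:
  assumes "V \<in> W12"
  obtains v where "has_weak_deriv V v" "v \<in> L2" "V \<in> L2"
    "(W12_norm V)\<^sup>2 = (\<integral>x. (V x)\<^sup>2 \<partial>lebesgue) + (\<integral>x. (v x)\<^sup>2 \<partial>lebesgue)"
proof -
  obtain v where v: "has_weak_deriv V v" "v \<in> L2" "V \<in> L2" using assms by (auto simp: W12_def)
  have "(W12_norm V)\<^sup>2 = (\<integral>x. (V x)\<^sup>2 \<partial>lebesgue) + (\<integral>x. (v x)\<^sup>2 \<partial>lebesgue)"
    unfolding W12_norm_eq[OF v(1)] by simp
  with v show thesis using that by blast
qed

lemma square_diff_L2_bound:
  fixes f v1 v2 :: "real \<Rightarrow> real"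
  assumes f: "f \<in> borel_measurable borel" and v: "v1 \<in> L2" "v2 \<in> L2" and ae: "AE x in lebesgue. f x = v1 x - v2 x"
  shows "integrable lborel (\<lambda>x. (f x)\<^sup>2)"
    "(\<integral>x. (f x)\<^sup>2 \<partial>lborel) \<le> 2 * (\<integral>x. (v1 x)\<^sup>2 \<partial>lebesgue) + 2 * (\<integral>x. (v2 x)\<^sup>2 \<partial>lebesgue)"
proof -
  have m: "(\<lambda>x. (f x)\<^sup>2) \<in> borel_measurable borel" using f by measurable
  have i: "integrable lebesgue (\<lambda>x. 2 * (v1 x)\<^sup>2 + 2 * (v2 x)\<^sup>2)" using v by (simp add: L2_def)
  have le: "AE x in lebesgue. (f x)\<^sup>2 \<le> 2 * (v1 x)\<^sup>2 + 2 * (v2 x)\<^sup>2"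
    using ae
  proof eventually_elim
    case (elim x)
    have "(v1 x - v2 x)\<^sup>2 + (v1 x + v2 x)\<^sup>2 = 2 * (v1 x)\<^sup>2 + 2 * (v2 x)\<^sup>2" by (simp add: power2_eq_square algebra_simps)
    then show ?case using zero_le_power2[of "v1 x + v2 x"] unfolding elim by linarith
  qed
  have il: "integrable lebesgue (\<lambda>x. (f x)\<^sup>2)"
    by (rule Bochner_Integration.integrable_bound[OF i])
      (use le m in \<open>auto intro: measurable_completion elim: eventually_mono\<close>)
  then show "integrable lborel (\<lambda>x. (f x)\<^sup>2)" using integrable_lborel_lebesgue(1)[OF m] by simp
  have "(\<integral>x. (f x)\<^sup>2 \<partial>lebesgue) \<le> (\<integral>x. 2 * (v1 x)\<^sup>2 + 2 * (v2 x)\<^sup>2 \<partial>lebesgue)"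
    by (rule integral_mono_AE[OF il i le])
  then show "(\<integral>x. (f x)\<^sup>2 \<partial>lborel) \<le> 2 * (\<integral>x. (v1 x)\<^sup>2 \<partial>lebesgue) + 2 * (\<integral>x. (v2 x)\<^sup>2 \<partial>lebesgue)"
    using integrable_lborel_lebesgue(2)[OF m] v by (simp add: L2_def)
qed

text \<open>N is integrable for the completed measure, so the domination is carried out in
  \<open>lebesgue\<close>; the slice norms of F are Borel, which brings the result back to
  \<open>lborel\<close>.\<close>

lemma square_integrable_of_slices:
  fixes F :: "real \<times> real \<Rightarrow> real" and N :: "real \<Rightarrow> real"
  assumes F: "F \<in> borel_measurable borel" and z: "\<And>x t. t \<notin> {0<..<T} \<Longrightarrow> F (x, t) = 0"
    and N: "integrable (lebesgue_on {0<..<T}) N"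
    and s: "AE t in lborel. t \<in> {0<..<T} \<longrightarrow> integrable lborel (\<lambda>x. (F (x, t))\<^sup>2) \<and> (\<integral>x. (F (x, t))\<^sup>2 \<partial>lborel) \<le> N t"
  shows "integrable lborel (\<lambda>p. (F p)\<^sup>2)"
proof (rule integrable_lborel_prodI')
  show F2m: "(\<lambda>p. (F p)\<^sup>2) \<in> borel_measurable borel" using F by measurable
  have s0: "integrable lborel (\<lambda>x. (F (x, t))\<^sup>2)" "(\<integral>x. (F (x, t))\<^sup>2 \<partial>lborel) = 0" if "t \<notin> {0<..<T}" for t
    using z[OF that] by simp_all
  show "AE t in lborel. integrable lborel (\<lambda>x. (F (x, t))\<^sup>2)"
    using s by eventually_elim (use s0 in blast)
  have "(\<lambda>q. (F (snd q, fst q))\<^sup>2) \<in> borel_measurable borel"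
    by (rule measurable_compose[OF _ F2m]) (intro borel_measurable_continuous_onI continuous_intros)
  then have "(\<lambda>(t, x). (F (x, t))\<^sup>2) \<in> borel_measurable (borel \<Otimes>\<^sub>M lborel)"
    by (simp add: case_prod_beta borel_prod measurable_cong_sets[OF sets_pair_measure_cong[OF refl sets_lborel] refl])
  then have m: "(\<lambda>t. \<integral>x. (F (x, t))\<^sup>2 \<partial>lborel) \<in> borel_measurable borel"
    by (rule lborel.borel_measurable_lebesgue_integral)
  have "integrable lebesgue (\<lambda>t. if t \<in> {0<..<T} then N t else 0)"
    using N by (subst Lebesgue_Measure.integrable_restrict_UNIV) auto
  then have "integrable lebesgue (\<lambda>t. \<integral>x. (F (x, t))\<^sup>2 \<partial>lborel)"
  proof (rule Bochner_Integration.integrable_bound)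
    show "(\<lambda>t. \<integral>x. (F (x, t))\<^sup>2 \<partial>lborel) \<in> borel_measurable lebesgue"
      using m by (intro measurable_completion) simp
    have "AE t in lebesgue. t \<in> {0<..<T} \<longrightarrow> integrable lborel (\<lambda>x. (F (x, t))\<^sup>2) \<and> (\<integral>x. (F (x, t))\<^sup>2 \<partial>lborel) \<le> N t"
      using s by (simp add: AE_completion_iff)
    then show "AE t in lebesgue. norm (\<integral>x. (F (x, t))\<^sup>2 \<partial>lborel) \<le> norm (if t \<in> {0<..<T} then N t else 0)"
    proof eventually_elim
      case (elim t)
      have "0 \<le> (\<integral>x. (F (x, t))\<^sup>2 \<partial>lborel)" by simp
      then show ?case using elim s0(2)[of t] by (cases "t \<in> {0<..<T}") auto
    qed
  qed
  then show "integrable lborel (\<lambda>t. \<integral>x. \<bar>(F (x, t))\<^sup>2\<bar> \<partial>lborel)"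
    using integrable_lborel_lebesgue(1)[OF m] by simp
qed

lemma C1_strip_tensor:
  assumes f: "\<And>x. DERIV f x :> f' x" "\<And>x. isCont f' x" and k: "\<And>t. DERIV th t :> k t" "\<And>t. isCont k t"
  shows "C1_strip T (\<lambda>p. f (fst p) * th (snd p)) (\<lambda>p. f' (fst p) * th (snd p)) (\<lambda>p. f (fst p) * k (snd p))"
proof -
  have "((\<lambda>p. f (fst p) * th (snd p)) has_derivative (\<lambda>h. f' (fst p) * th (snd p) * fst h + f (fst p) * k (snd p) * snd h))
      (at p within S)" for p :: "real \<times> real" and S
  proof -
    have 1: "((\<lambda>p. f (fst p)) has_derivative (\<lambda>h. f' (fst p) * fst h)) (at p within S)"
      by (rule has_derivative_compose[OF has_derivative_fst[OF has_derivative_ident], of f "\<lambda>h. f' (fst p) * h", unfolded])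
        (use f(1) in \<open>simp add: has_field_derivative_def\<close>)
    have 2: "((\<lambda>p. th (snd p)) has_derivative (\<lambda>h. k (snd p) * snd h)) (at p within S)"
      by (rule has_derivative_compose[OF has_derivative_snd[OF has_derivative_ident], of th "\<lambda>h. k (snd p) * h", unfolded])
        (use k(1) in \<open>simp add: has_field_derivative_def\<close>)
    show ?thesis
      by (rule has_derivative_eq_rhs[OF has_derivative_mult[OF 1 2]]) (auto simp: fun_eq_iff algebra_simps)
  qed
  moreover have "continuous_on S (\<lambda>p. f' (fst p) * th (snd p))" "continuous_on S (\<lambda>p. f (fst p) * k (snd p))" for S :: "(real \<times> real) set"
  proof -
    have c: "continuous_on UNIV f" "continuous_on UNIV f'" "continuous_on UNIV th" "continuous_on UNIV k"
      by (intro continuous_at_imp_continuous_on ballI DERIV_isCont[OF f(1)] DERIV_isCont[OF k(1)] f(2) k(2))+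
    show "continuous_on S (\<lambda>p. f' (fst p) * th (snd p))" "continuous_on S (\<lambda>p. f (fst p) * k (snd p))"
      by (intro continuous_intros continuous_on_compose2[OF c(1)] continuous_on_compose2[OF c(2)]
          continuous_on_compose2[OF c(3)] continuous_on_compose2[OF c(4)]; simp)+
  qed
  ultimately show ?thesis unfolding C1_strip_def by blast
qed

lemma integral_QT_representative:
  fixes f r c :: "real \<times> real \<Rightarrow> real"
  assumes f: "f \<in> borel_measurable (lebesgue_on (QT T))" and r: "r \<in> borel_measurable borel"
    and z: "\<And>x t. t \<notin> {0<..<T} \<Longrightarrow> r (x, t) = 0" and ae: "AE p in lborel. p \<in> QT T \<longrightarrow> r p = f p"
    and c: "c \<in> borel_measurable borel"
  shows "(\<integral>p. f p * c p \<partial>lebesgue_on (QT T)) = (\<integral>p. r p * c p \<partial>lborel)"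
    "integrable (lebesgue_on (QT T)) (\<lambda>p. f p * c p) \<Longrightarrow> integrable lborel (\<lambda>p. r p * c p)"
proof -
  have rc: "(\<lambda>p. r p * c p) \<in> borel_measurable borel" using r c by measurable
  then have rcl: "(\<lambda>p. r p * c p) \<in> borel_measurable (lebesgue_on (QT T))"
    by (intro measurable_restrict_space1 measurable_completion) simp
  have fc: "(\<lambda>p. f p * c p) \<in> borel_measurable (lebesgue_on (QT T))"
    using f c by (intro borel_measurable_times measurable_restrict_space1[of c] measurable_completion) simp_all
  have ae': "AE p in lebesgue_on (QT T). f p * c p = r p * c p"
    unfolding AE_lebesgue_on_iff_lborel[OF QT_sets(2)] using ae by eventually_elim simp
  have ind: "indicator (QT T) p *\<^sub>R (r p * c p) = r p * c p" for p
    using z[of "snd p" "fst p"] by (cases p) (auto simp: indicator_def QT_def)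
  have "(\<integral>p. f p * c p \<partial>lebesgue_on (QT T)) = (\<integral>p. r p * c p \<partial>lebesgue_on (QT T))"
    by (rule integral_cong_AE[OF fc rcl ae'])
  also have "\<dots> = (\<integral>p. indicator (QT T) p *\<^sub>R (r p * c p) \<partial>lebesgue)"
    using QT_sets(2) by (intro integral_restrict_space) simp
  also have "\<dots> = (\<integral>p. r p * c p \<partial>lborel)"
    unfolding ind by (rule integrable_lborel_lebesgue(2)[OF rc])
  finally show "(\<integral>p. f p * c p \<partial>lebesgue_on (QT T)) = (\<integral>p. r p * c p \<partial>lborel)" .
  assume "integrable (lebesgue_on (QT T)) (\<lambda>p. f p * c p)"
  then have "integrable (lebesgue_on (QT T)) (\<lambda>p. r p * c p)"
    using integrable_cong_AE[OF fc rcl ae'] by simp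
  then have "integrable lebesgue (\<lambda>p. indicator (QT T) p *\<^sub>R (r p * c p))"
    using QT_sets(2) by (subst integrable_restrict_space[symmetric]) simp_all
  then show "integrable lborel (\<lambda>p. r p * c p)"
    unfolding ind using integrable_lborel_lebesgue(1)[OF rc] by simp
qed

context degenerate_diffusion
begin

text \<open>The hypotheses on the two solutions differ because the definition of
  \<open>weak_solution\<close> does not list local integrability of the flux g, and the integral of
  a non-integrable function is 0 by convention. Integrability is assumed for the comparison solution
  (\<open>g2i\<close>) and transferred to the other one: g1 - g2 has the representative G, which is
  square integrable.\<close>

lemma weak_solution_unique:
  assumes T: "T > 0"
    and w1: "weak_solution (Dfun \<phi> \<epsilon>) w0 what T w1"
    and w2: "w2 \<in> L_infinity (QT T)"
    and V2: "V2 \<in> L2_W12 T" "AE p in lebesgue_on (QT T). Dfun \<phi> \<epsilon> (w2 p) = Dfun \<phi> \<epsilon> (what (fst p)) + V2 (snd p) (fst p)"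
    and g2: "g2 \<in> borel_measurable (lebesgue_on (QT T))"
    and wd2: "AE t in lebesgue_on {0<..<T}. has_weak_deriv (\<lambda>x. Dfun \<phi> \<epsilon> (w2 (x, t))) (\<lambda>x. g2 (x, t))"
    and id2: "\<And>\<Psi> \<Psi>x \<Psi>t. C1_strip T \<Psi> \<Psi>x \<Psi>t \<Longrightarrow> \<forall>x. \<Psi> (x, T) = 0 \<Longrightarrow>
        \<exists>J>0. \<forall>x. \<forall>t\<in>{0..T}. \<bar>x\<bar> > J \<longrightarrow> \<Psi> (x, t) = 0 \<Longrightarrow>
        (\<integral>x. w0 x * \<Psi> (x, 0) \<partial>lebesgue) + (\<integral>p. w2 p * \<Psi>t p \<partial>lebesgue_on (QT T))
             = (\<integral>p. g2 p * \<Psi>x p \<partial>lebesgue_on (QT T))"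
    and g2i: "\<And>J. integrable (lebesgue_on (QT T)) (\<lambda>p. g2 p * indicator {-J..J} (fst p))"
  shows "AE p in lebesgue_on (QT T). w1 p = w2 p"
proof -
  define D where "D = Dfun \<phi> \<epsilon>"
  have Dc: "isCont D s" for s unfolding D_def by (rule DERIV_isCont[OF DERIV_Dfun])
  have Dm: "D \<in> borel_measurable borel"
    using Dc by (intro borel_measurable_continuous_onI continuous_at_imp_continuous_on) auto
  have Dmono: "x < y \<Longrightarrow> D x < D y" for x y unfolding D_def by (rule Dfun_strict_mono)
  have w1L: "w1 \<in> L_infinity (QT T)" using w1 by (simp add: weak_solution_def)
  obtain V1 where V1: "V1 \<in> L2_W12 T" "AE p in lebesgue_on (QT T). D (w1 p) = D (what (fst p)) + V1 (snd p) (fst p)"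
    using w1 unfolding weak_solution_def D_def by blast
  obtain g1 where g1: "g1 \<in> borel_measurable (lebesgue_on (QT T))"
    and wd1: "AE t in lebesgue_on {0<..<T}. has_weak_deriv (\<lambda>x. D (w1 (x, t))) (\<lambda>x. g1 (x, t))"
    and id1: "\<And>\<Psi> \<Psi>x \<Psi>t. C1_strip T \<Psi> \<Psi>x \<Psi>t \<and> (\<forall>x. \<Psi> (x, T) = 0) \<and>
        (\<exists>J>0. \<forall>x. \<forall>t\<in>{0..T}. \<bar>x\<bar> > J \<longrightarrow> \<Psi> (x, t) = 0) \<longrightarrow>
        (\<integral>x. w0 x * \<Psi> (x, 0) \<partial>lebesgue) + (\<integral>p. w1 p * \<Psi>t p \<partial>lebesgue_on (QT T))
             = (\<integral>p. g1 p * \<Psi>x p \<partial>lebesgue_on (QT T))"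
    using w1 unfolding weak_solution_def D_def by blast
  have w1m: "w1 \<in> borel_measurable (lebesgue_on (QT T))" and w2m: "w2 \<in> borel_measurable (lebesgue_on (QT T))"
    using w1L w2 by (auto simp: L_infinity_def)
  obtain r1 M1 where r1: "r1 \<in> borel_measurable borel" "\<And>x t. t \<notin> {0<..<T} \<Longrightarrow> r1 (x, t) = 0"
    "AE p in lborel. p \<in> QT T \<longrightarrow> r1 p = w1 p" "\<And>p. \<bar>r1 p\<bar> \<le> M1"
    using borel_representative_bounded[OF w1L] by blast
  obtain r2 M2 where r2: "r2 \<in> borel_measurable borel" "\<And>x t. t \<notin> {0<..<T} \<Longrightarrow> r2 (x, t) = 0"
    "AE p in lborel. p \<in> QT T \<longrightarrow> r2 p = w2 p" "\<And>p. \<bar>r2 p\<bar> \<le> M2"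
    using borel_representative_bounded[OF w2] by blast
  obtain c1 where c1: "c1 \<in> borel_measurable borel" "\<And>x t. t \<notin> {0<..<T} \<Longrightarrow> c1 (x, t) = 0"
    "AE p in lborel. p \<in> QT T \<longrightarrow> c1 p = g1 p"
    using borel_representative[OF g1] by blast
  obtain c2 where c2: "c2 \<in> borel_measurable borel" "\<And>x t. t \<notin> {0<..<T} \<Longrightarrow> c2 (x, t) = 0"
    "AE p in lborel. p \<in> QT T \<longrightarrow> c2 p = g2 p"
    using borel_representative[OF g2] by blast
  define u where "u p = r1 p - r2 p" for p
  define h where "h p = D (r1 p) - D (r2 p)" for p
  define G where "G p = c1 p - c2 p" for p
  have um: "u \<in> borel_measurable borel" unfolding u_def[abs_def] using r1(1) r2(1) by measurable
  have Gm: "G \<in> borel_measurable borel" unfolding G_def[abs_def] using c1(1) c2(1) by measurable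
  have hm: "h \<in> borel_measurable borel" unfolding h_def[abs_def]
    by (intro borel_measurable_diff measurable_compose[OF _ Dm] r1(1) r2(1))
  have zu: "u (x, t) = 0" and zG: "G (x, t) = 0" and zh: "h (x, t) = 0" if "t \<notin> {0<..<T}" for x t
    using r1(2)[OF that] r2(2)[OF that] c1(2)[OF that] c2(2)[OF that] by (auto simp: u_def G_def h_def)
  have ub: "\<bar>u p\<bar> \<le> M1 + M2" for p using r1(4)[of p] r2(4)[of p] by (simp add: u_def)
  have Db: "\<bar>D y\<bar> \<le> \<bar>D M\<bar> + \<bar>D (- M)\<bar>" if "\<bar>y\<bar> \<le> M" for y M
  proof -
    have "D y \<le> D M" "D (- M) \<le> D y"
      using that Dmono[of y M] Dmono[of "-M" y] by (cases "y = M"; cases "y = - M"; force)+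
    then show ?thesis by linarith
  qed
  define M' where "M' = \<bar>D M1\<bar> + \<bar>D (- M1)\<bar> + (\<bar>D M2\<bar> + \<bar>D (- M2)\<bar>)"
  have hb: "\<bar>h p\<bar> \<le> M'" for p
    unfolding h_def M'_def using Db[OF r1(4)[of p]] Db[OF r2(4)[of p]] abs_triangle_ineq4[of "D (r1 p)" "D (r2 p)"] by linarith
  have uh: "0 \<le> u p * h p" for p
    using Dmono[of "r1 p" "r2 p"] Dmono[of "r2 p" "r1 p"]
    by (cases "r1 p" "r2 p" rule: linorder_cases) (auto simp: u_def h_def intro: mult_nonpos_nonpos)
  define N1 N2 where "N1 t = (W12_norm (V1 t))\<^sup>2" and "N2 t = (W12_norm (V2 t))\<^sup>2" for t
  have Nint: "integrable (lebesgue_on {0<..<T}) (\<lambda>t. 2 * (N1 t + N2 t))"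
    using V1(1) V2(1) by (simp add: L2_W12_def N1_def N2_def)
  have Vin: "V1 t \<in> W12" "V2 t \<in> W12" if "t \<in> {0<..<T}" for t
    using V1(1) V2(1) that by (auto simp: L2_W12_def)
  have pair: "p \<in> QT T \<longleftrightarrow> snd p \<in> {0<..<T}" for p by (cases p) (simp add: QT_def)
  have V1': "AE p in lborel. p \<in> QT T \<longrightarrow> D (w1 p) = D (what (fst p)) + V1 (snd p) (fst p)"
    and V2': "AE p in lborel. p \<in> QT T \<longrightarrow> D (w2 p) = D (what (fst p)) + V2 (snd p) (fst p)"
    using V1(2) V2(2) by (auto simp: AE_lebesgue_on_iff_lborel[OF QT_sets(2)] D_def)
  \<comment> \<open>The reference function D (what) cancels in the difference, so h is V1 - V2, and
    the bounds on V1 and V2 pass to h.\<close>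
  have "AE p in lborel. p \<in> QT T \<longrightarrow> h p = D (w1 p) - D (w2 p) \<and> h p = V1 (snd p) (fst p) - V2 (snd p) (fst p) \<and> G p = g1 p - g2 p"
    using r1(3) r2(3) c1(3) c2(3) V1' V2' by eventually_elim (auto simp: h_def G_def)
  from AE_lborel_slices(2)[OF this]
  have sl: "AE t in lborel. AE x in lborel. t \<in> {0<..<T} \<longrightarrow>
      h (x, t) = D (w1 (x, t)) - D (w2 (x, t)) \<and> h (x, t) = V1 t x - V2 t x \<and> G (x, t) = g1 (x, t) - g2 (x, t)"
    by (simp add: pair)
  have wd: "AE t in lborel. t \<in> {0<..<T} \<longrightarrow> has_weak_deriv (\<lambda>x. D (w1 (x, t))) (\<lambda>x. g1 (x, t))"
    "AE t in lborel. t \<in> {0<..<T} \<longrightarrow> has_weak_deriv (\<lambda>x. D (w2 (x, t))) (\<lambda>x. g2 (x, t))"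
    using wd1 wd2 by (simp_all add: AE_lebesgue_on_iff_lborel D_def)
  have key: "AE t in lborel. t \<in> {0<..<T} \<longrightarrow>
     has_weak_deriv (\<lambda>x. h (x, t)) (\<lambda>x. G (x, t)) \<and>
     (integrable lborel (\<lambda>x. (G (x, t))\<^sup>2) \<and> (\<integral>x. (G (x, t))\<^sup>2 \<partial>lborel) \<le> 2 * (N1 t + N2 t)) \<and>
     (integrable lborel (\<lambda>x. (h (x, t))\<^sup>2) \<and> (\<integral>x. (h (x, t))\<^sup>2 \<partial>lborel) \<le> 2 * (N1 t + N2 t))"
    using sl wd
  proof eventually_elim
    case (elim t)
    show ?case
    proof
      assume t: "t \<in> {0<..<T}"
      have a: "AE x in lebesgue. D (w1 (x, t)) - D (w2 (x, t)) = h (x, t)"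
        "AE x in lebesgue. h (x, t) = V1 t x - V2 t x"
        "AE x in lebesgue. g1 (x, t) - g2 (x, t) = G (x, t)"
        using elim(1) t by (auto simp: AE_completion_iff elim: eventually_mono)
      note hs = borel_slice(2)[OF hm, of t] and Gs = borel_slice(2)[OF Gm, of t]
      have w: "has_weak_deriv (\<lambda>x. D (w1 (x, t)) - D (w2 (x, t))) (\<lambda>x. g1 (x, t) - g2 (x, t))"
        using elim(2,3) t by (intro has_weak_deriv_diff) auto
      have hl: "locally_integrable (\<lambda>x. h (x, t))" by (rule locally_integrable_bounded[OF hs hb])
      have Gl: "locally_integrable (\<lambda>x. G (x, t))"
        by (rule locally_integrable_cong_AE[OF has_weak_deriv_locally_integrable(2)[OF w] Gs a(3)])
      have W: "has_weak_deriv (\<lambda>x. h (x, t)) (\<lambda>x. G (x, t))"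
        by (rule has_weak_deriv_cong_AE[OF w a(1) a(3) hl Gl])
      obtain v1 where v1: "has_weak_deriv (V1 t) v1" "v1 \<in> L2" "V1 t \<in> L2"
        "(W12_norm (V1 t))\<^sup>2 = (\<integral>x. (V1 t x)\<^sup>2 \<partial>lebesgue) + (\<integral>x. (v1 x)\<^sup>2 \<partial>lebesgue)"
        using W12_square_bounds[OF Vin(1)[OF t]] by blast
      obtain v2 where v2: "has_weak_deriv (V2 t) v2" "v2 \<in> L2" "V2 t \<in> L2"
        "(W12_norm (V2 t))\<^sup>2 = (\<integral>x. (V2 t x)\<^sup>2 \<partial>lebesgue) + (\<integral>x. (v2 x)\<^sup>2 \<partial>lebesgue)"
        using W12_square_bounds[OF Vin(2)[OF t]] by blast
      note dV = has_weak_deriv_diff[OF v1(1) v2(1)]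
      \<comment> \<open>On the slice h has two weak derivatives, G from the fluxes and v1 - v2 from
        the Bochner space; uniqueness transfers the L^2 bound of the latter to G.\<close>
      have "has_weak_deriv (\<lambda>x. h (x, t)) (\<lambda>x. v1 x - v2 x)"
        by (rule has_weak_deriv_cong_AE[OF dV _ _ hl has_weak_deriv_locally_integrable(2)[OF dV]])
          (use a(2) in \<open>auto elim: eventually_mono\<close>)
      then have Gv: "AE x in lebesgue. G (x, t) = v1 x - v2 x" by (rule has_weak_deriv_unique[OF W])
      have nn: "0 \<le> (\<integral>x. (V1 t x)\<^sup>2 \<partial>lebesgue)" "0 \<le> (\<integral>x. (V2 t x)\<^sup>2 \<partial>lebesgue)"
        "0 \<le> (\<integral>x. (v1 x)\<^sup>2 \<partial>lebesgue)" "0 \<le> (\<integral>x. (v2 x)\<^sup>2 \<partial>lebesgue)" by simp_all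
      have arith: "X \<le> 2 * ((a + b) + (c + d))" if "X \<le> 2 * b + 2 * d" "0 \<le> a" "0 \<le> c" for X a b c d :: real
        using that by (simp add: algebra_simps)
      have arith': "X \<le> 2 * ((a + b) + (c + d))" if "X \<le> 2 * a + 2 * c" "0 \<le> b" "0 \<le> d" for X a b c d :: real
        using that by (simp add: algebra_simps)
      show "has_weak_deriv (\<lambda>x. h (x, t)) (\<lambda>x. G (x, t)) \<and>
       (integrable lborel (\<lambda>x. (G (x, t))\<^sup>2) \<and> (\<integral>x. (G (x, t))\<^sup>2 \<partial>lborel) \<le> 2 * (N1 t + N2 t)) \<and>
       (integrable lborel (\<lambda>x. (h (x, t))\<^sup>2) \<and> (\<integral>x. (h (x, t))\<^sup>2 \<partial>lborel) \<le> 2 * (N1 t + N2 t))"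
        unfolding N1_def N2_def v1(4) v2(4)
        by (intro conjI W arith[OF square_diff_L2_bound(2)[OF Gs v1(2) v2(2) Gv] nn(1,2)]
            arith'[OF square_diff_L2_bound(2)[OF hs v1(3) v2(3) a(2)] nn(3,4)]
            square_diff_L2_bound(1)[OF Gs v1(2) v2(2) Gv] square_diff_L2_bound(1)[OF hs v1(3) v2(3) a(2)])
    qed
  qed
  have kG: "AE t in lborel. t \<in> {0<..<T} \<longrightarrow>
      integrable lborel (\<lambda>x. (G (x, t))\<^sup>2) \<and> (\<integral>x. (G (x, t))\<^sup>2 \<partial>lborel) \<le> 2 * (N1 t + N2 t)"
    using key by eventually_elim blast
  have G2: "integrable lborel (\<lambda>p. (G p)\<^sup>2)"
    by (rule square_integrable_of_slices[OF Gm zG Nint kG])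
  have kh: "AE t in lborel. t \<in> {0<..<T} \<longrightarrow>
      integrable lborel (\<lambda>x. (h (x, t))\<^sup>2) \<and> (\<integral>x. (h (x, t))\<^sup>2 \<partial>lborel) \<le> 2 * (N1 t + N2 t)"
    using key by eventually_elim blast
  have h2: "integrable lborel (\<lambda>p. (h p)\<^sup>2)"
    by (rule square_integrable_of_slices[OF hm zh Nint kh])
  have slice: "AE t in lborel. t \<in> {0<..<T} \<longrightarrow> (\<exists>d. AE x in lebesgue. h (x, t) = d + prim (\<lambda>x. G (x, t)) x)"
    using key
  proof eventually_elim
    case (elim t)
    then show ?case using has_weak_deriv_primitive[of "\<lambda>x. h (x, t)" "\<lambda>x. G (x, t)"] by simp
  qed
  have contm: "k \<in> borel_measurable borel" if "\<And>x. isCont k x" for k :: "real \<Rightarrow> real"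
    using that by (intro borel_measurable_continuous_onI continuous_at_imp_continuous_on) auto
  define i where "i t = (indicator {0<..<T} t :: real)" for t
  have im: "i \<in> borel_measurable borel" unfolding i_def[abs_def] by measurable
  have iint: "integrable lborel i" unfolding i_def[abs_def] by (rule integrable_real_indicator) (use T in auto)
  have weak: "(\<integral>p. u p * test_fun a b n (fst p) * k (snd p) \<partial>lborel) =
      (\<integral>p. G p * test_deriv a b n (fst p) * (prim k (snd p) - prim k T) \<partial>lborel)"
    if k: "\<And>t. isCont k t" for a b n and k :: "real \<Rightarrow> real"
  proof -
    let ?f = "test_fun a b n" and ?d = "test_deriv a b n"
    \<comment> \<open>Subtracting the value at T makes the product test function vanish at t = T, as
      admissibility demands, and leaves the derivative k unchanged.\<close>
    define th where "th t = prim k t - prim k T" for t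
    have thd: "DERIV th t :> k t" for t
    proof -
      have "DERIV (\<lambda>t. prim k t - prim k T) t :> k t - 0" by (intro derivative_intros DERIV_prim k)
      then show ?thesis by (simp add: th_def[abs_def])
    qed
    have thc: "isCont th t" for t by (rule DERIV_isCont[OF thd])
    define J where "J = \<bar>a\<bar> + \<bar>b\<bar> + 1"
    have fz: "?f x = 0" and dz: "?d x = 0" if "\<bar>x\<bar> > J" for x
      using that by (auto simp: J_def intro!: test_fun_outside test_deriv_outside)
    define \<Psi> where "\<Psi> p = ?f (fst p) * th (snd p)" for p
    define \<Psi>x where "\<Psi>x p = ?d (fst p) * th (snd p)" for p
    define \<Psi>t where "\<Psi>t p = ?f (fst p) * k (snd p)" for p
    have C1: "C1_strip T \<Psi> \<Psi>x \<Psi>t"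
      unfolding \<Psi>_def[abs_def] \<Psi>x_def[abs_def] \<Psi>t_def[abs_def]
      by (rule C1_strip_tensor[OF DERIV_test_fun isCont_test_deriv thd k])
    have end0: "\<forall>x. \<Psi> (x, T) = 0" by (simp add: \<Psi>_def th_def)
    have supp: "\<exists>J>0. \<forall>x. \<forall>t\<in>{0..T}. \<bar>x\<bar> > J \<longrightarrow> \<Psi> (x, t) = 0"
      by (rule exI[of _ J]) (use fz in \<open>auto simp: \<Psi>_def J_def\<close>)
    have m: "?f \<in> borel_measurable borel" "?d \<in> borel_measurable borel" "th \<in> borel_measurable borel" "k \<in> borel_measurable borel"
      by (intro contm isCont_test_fun isCont_test_deriv thc k)+
    have \<Psi>m: "\<Psi>x \<in> borel_measurable borel" "\<Psi>t \<in> borel_measurable borel"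
      unfolding \<Psi>x_def[abs_def] \<Psi>t_def[abs_def] by (intro borel_measurable_times borel_fst_snd m)+
    have eq1: "(\<integral>x. w0 x * \<Psi> (x, 0) \<partial>lebesgue) + (\<integral>p. r1 p * \<Psi>t p \<partial>lborel) = (\<integral>p. c1 p * \<Psi>x p \<partial>lborel)"
      using id1[THEN mp, OF conjI[OF C1 conjI[OF end0 supp]]] integral_QT_representative(1)[OF w1m r1(1,2,3) \<Psi>m(2)]
        integral_QT_representative(1)[OF g1 c1 \<Psi>m(1)] by simp
    have eq2: "(\<integral>x. w0 x * \<Psi> (x, 0) \<partial>lebesgue) + (\<integral>p. r2 p * \<Psi>t p \<partial>lborel) = (\<integral>p. c2 p * \<Psi>x p \<partial>lborel)"
      using id2[OF C1 end0 supp] integral_QT_representative(1)[OF w2m r2(1,2,3) \<Psi>m(2)]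
        integral_QT_representative(1)[OF g2 c2 \<Psi>m(1)] by simp
    have bounded: "\<exists>B. \<forall>t\<in>{0..T}. \<bar>q t\<bar> \<le> B" if "\<And>t. isCont q t" for q :: "real \<Rightarrow> real"
      using continuous_attains_sup[of "{0..T}" "\<lambda>t. \<bar>q t\<bar>"] T that
      by (force intro!: continuous_at_imp_continuous_on continuous_intros)
    have cs: "integrable lborel q" if q: "\<And>x. isCont q x" "\<And>x. \<bar>x\<bar> > J \<Longrightarrow> q x = 0" for q :: "real \<Rightarrow> real"
    proof -
      have "integrable lebesgue q"
        by (rule compact_support_integral(1)[OF locally_integrable_continuous[OF q(1)], of "-J" J]) (use q(2) in auto)
      then show ?thesis using integrable_lborel_lebesgue(1)[OF contm[OF q(1)]] by simp
    qed
    have fi: "integrable lborel ?f" "integrable lborel ?d" "integrable lborel (\<lambda>x. (?d x)\<^sup>2)"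
      by (intro cs continuous_intros isCont_test_fun isCont_test_deriv; simp add: fz dz)+
    obtain B where B: "\<And>t. t \<in> {0..T} \<Longrightarrow> \<bar>k t\<bar> \<le> B" using bounded[OF k] by blast
    obtain C where C: "\<And>t. t \<in> {0..T} \<Longrightarrow> \<bar>th t\<bar> \<le> C" using bounded[OF thc] by blast
    have ik: "(\<lambda>t. i t * k t) \<in> borel_measurable borel" "(\<lambda>t. i t * th t) \<in> borel_measurable borel"
      using im m by measurable
    have ikb: "\<bar>i t * k t\<bar> \<le> \<bar>B\<bar>" "\<bar>i t * th t\<bar> \<le> \<bar>C\<bar>" for t
      using B[of t] C[of t] by (auto simp: i_def indicator_def)
    have it: "integrable lborel (\<lambda>t. i t * k t)" "integrable lborel (\<lambda>t. (i t * th t)\<^sup>2)"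
    proof -
      show "integrable lborel (\<lambda>t. i t * k t)"
      proof -
        have "integrable lborel (\<lambda>t. i t * (i t * k t))"
          by (rule integrable_mult_bounded[OF iint, of _ "\<bar>B\<bar>"]) (use ik ikb in auto)
        moreover have "i t * (i t * k t) = i t * k t" for t by (simp add: i_def indicator_def)
        ultimately show ?thesis by simp
      qed
      have e: "(i t * th t)\<^sup>2 = i t * (i t * th t) * (i t * th t)" for t
        by (simp add: i_def indicator_def power2_eq_square)
      show "integrable lborel (\<lambda>t. (i t * th t)\<^sup>2)"
        unfolding e by (intro integrable_mult_bounded[where B="\<bar>C\<bar>"] iint) (use ik ikb in auto)
    qed
    have ru: "integrable lborel (\<lambda>p. r p * \<Psi>t p)"
      if r: "r \<in> borel_measurable borel" "\<And>x t. t \<notin> {0<..<T} \<Longrightarrow> r (x, t) = 0" "\<And>p. \<bar>r p\<bar> \<le> M" for r :: "real \<times> real \<Rightarrow> real" and M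
    proof -
      have "integrable lborel (\<lambda>p. (?f (fst p) * (i (snd p) * k (snd p))) * r p)"
        by (rule integrable_mult_bounded[OF integrable_tensor[OF fi(1) it(1)], of r M]) (use r in auto)
      moreover have "(?f (fst p) * (i (snd p) * k (snd p))) * r p = r p * \<Psi>t p" for p
        using r(2)[of "snd p" "fst p"] by (cases "snd p \<in> {0<..<T}") (auto simp: i_def \<Psi>t_def)
      ultimately show ?thesis by simp
    qed
    have c2i: "integrable lborel (\<lambda>p. c2 p * \<Psi>x p)"
    proof -
      obtain B' where B': "\<And>x. \<bar>?d x\<bar> \<le> B'"
      proof -
        have "continuous_on {-J..J} (\<lambda>x. \<bar>?d x\<bar>)"
          by (intro continuous_at_imp_continuous_on ballI continuous_rabs isCont_test_deriv)
        moreover have "{-J..J} \<noteq> {}" by (auto simp: J_def)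
        ultimately obtain y where y: "\<forall>x\<in>{-J..J}. \<bar>?d x\<bar> \<le> \<bar>?d y\<bar>"
          using continuous_attains_sup[OF compact_Icc] by blast
        have "\<bar>?d x\<bar> \<le> \<bar>?d y\<bar>" for x
        proof (cases "\<bar>x\<bar> > J")
          case False
          then have "x \<in> {-J..J}" by auto
          then show ?thesis using y by blast
        qed (simp add: dz)
        then show thesis using that by blast
      qed
      have im2: "(\<lambda>p::real\<times>real. indicator {-J..J} (fst p) :: real) \<in> borel_measurable borel"
        by (rule borel_fst_snd(1)) simp
      have i1: "integrable lborel (\<lambda>p. c2 p * indicator {-J..J} (fst p))"
        by (rule integral_QT_representative(2)[OF g2 c2 im2 g2i])
      have "integrable lborel (\<lambda>p. c2 p * indicator {-J..J} (fst p) * (?d (fst p) * (i (snd p) * th (snd p))))"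
      proof (rule integrable_mult_bounded[OF i1])
        show "(\<lambda>p. ?d (fst p) * (i (snd p) * th (snd p))) \<in> borel_measurable lborel"
          using borel_measurable_times[OF borel_fst_snd(1)[OF m(2)] borel_fst_snd(2)[OF ik(2)]] by simp
        show "\<bar>?d (fst p) * (i (snd p) * th (snd p))\<bar> \<le> B' * \<bar>C\<bar>" for p :: "real \<times> real"
          unfolding abs_mult[of "?d (fst p)"]
          by (rule mult_mono[OF B' ikb(2)]) (use order_trans[OF abs_ge_zero B'] in auto)
      qed
      moreover have "c2 p * indicator {-J..J} (fst p) * (?d (fst p) * (i (snd p) * th (snd p))) = c2 p * \<Psi>x p" for p
        using c2(2)[of "snd p" "fst p"] dz[of "fst p"]
        by (cases "snd p \<in> {0<..<T}"; cases "\<bar>fst p\<bar> > J") (auto simp: i_def \<Psi>x_def indicator_def abs_le_iff)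
      ultimately show ?thesis by simp
    qed
    have Gi: "integrable lborel (\<lambda>p. G p * \<Psi>x p)"
    proof -
      have t2: "integrable lborel (\<lambda>p. (?d (fst p) * (i (snd p) * th (snd p)))\<^sup>2)"
        unfolding power_mult_distrib[of "?d _"] by (rule integrable_tensor[OF fi(3) it(2)])
      have "integrable lborel (\<lambda>p. G p * (?d (fst p) * (i (snd p) * th (snd p))))"
        by (rule integrable_mult_L2)
          (use Gm G2 t2 borel_measurable_times[OF borel_fst_snd(1)[OF m(2)] borel_fst_snd(2)[OF ik(2)]] in simp_all)
      moreover have "G p * (?d (fst p) * (i (snd p) * th (snd p))) = G p * \<Psi>x p" for p
        using zG[of "snd p" "fst p"] by (cases "snd p \<in> {0<..<T}") (auto simp: i_def \<Psi>x_def)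
      ultimately show ?thesis by simp
    qed
    \<comment> \<open>Both products on the right are integrable, so this splitting makes the
      subtraction of the two weak identities legitimate.\<close>
    have c1e: "c1 p * \<Psi>x p = G p * \<Psi>x p + c2 p * \<Psi>x p" for p by (simp add: G_def algebra_simps)
    have "(\<integral>p. u p * \<Psi>t p \<partial>lborel) = (\<integral>p. r1 p * \<Psi>t p \<partial>lborel) - (\<integral>p. r2 p * \<Psi>t p \<partial>lborel)"
      using ru[OF r1(1,2,4)] ru[OF r2(1,2,4)] by (simp add: u_def left_diff_distrib)
    also have "\<dots> = (\<integral>p. c1 p * \<Psi>x p \<partial>lborel) - (\<integral>p. c2 p * \<Psi>x p \<partial>lborel)" using eq1 eq2 by linarith
    also have "\<dots> = (\<integral>p. G p * \<Psi>x p \<partial>lborel)" unfolding c1e using Gi c2i by simp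
    finally show ?thesis by (simp add: \<Psi>t_def \<Psi>x_def th_def mult.assoc)
  qed
  have "AE p in lborel. u p * h p = 0"
    by (rule dual_energy[OF T um hm Gm zu zG ub hb uh G2 h2 slice weak])
  then have "AE p in lborel. r1 p = r2 p"
  proof eventually_elim
    case (elim p)
    then show ?case using Dmono[of "r1 p" "r2 p"] Dmono[of "r2 p" "r1 p"]
      by (cases "r1 p" "r2 p" rule: linorder_cases) (auto simp: u_def h_def)
  qed
  then have "AE p in lborel. p \<in> QT T \<longrightarrow> w1 p = w2 p"
    using r1(3) r2(3) by eventually_elim auto
  then show ?thesis by (simp add: AE_lebesgue_on_iff_lborel[OF QT_sets(2)])
qed

end

section \<open>The self-similar function is a weak solution\<close>

lemma integrable_inverse_sqrt:
  assumes T: "T > 0"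
  shows "integrable lborel (\<lambda>t. indicator {0<..<T} t * (1 / sqrt t))"
proof -
  have "((\<lambda>t. 1 / sqrt t) has_integral (2 * sqrt T - 2 * sqrt 0)) {0..T}"
  proof (rule fundamental_theorem_of_calculus_interior)
    show "continuous_on {0..T} (\<lambda>t. 2 * sqrt t)" by (intro continuous_intros)
    show "((\<lambda>t. 2 * sqrt t) has_vector_derivative 1 / sqrt t) (at t)" if "t \<in> {0<..<T}" for t
      using that by (auto intro!: derivative_eq_intros simp: has_real_derivative_iff_has_vector_derivative[symmetric] field_simps)
  qed (use T in auto)
  then have "(\<lambda>t. 1 / sqrt t) integrable_on {0..T}" by blast
  then have a: "(\<lambda>t. 1 / sqrt t) absolutely_integrable_on {0..T}"
    by (rule nonnegative_absolutely_integrable_1) auto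
  have m: "(\<lambda>t. 1 / sqrt t) \<in> borel_measurable borel" by measurable
  have "integrable lborel (\<lambda>t. indicator {0..T} t * (1 / sqrt t))"
    using a integral_lebesgue_on_lborel(1)[OF m] by (simp add: absolutely_integrable_on_Icc_iff)
  then show ?thesis
    by (rule Bochner_Integration.integrable_bound) (auto simp: indicator_def intro!: AE_I2)
qed

text \<open>For all s with J < B s the integral is taken over the same interval [-B,B], which is
  what differentiation under the integral sign requires when s varies.\<close>

lemma scaled_integral:
  fixes k :: "real \<Rightarrow> real"
  assumes k: "\<And>x. isCont k x" and z: "\<And>x. \<bar>x\<bar> > J \<Longrightarrow> k x = 0" and s: "s > 0" and B: "J < B * s"
  shows "(\<integral>x. k x \<partial>lborel) = integral {-B..B} (\<lambda>y. s * k (y * s))"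
proof -
  have "(\<integral>x. k x \<partial>lborel) = \<bar>s\<bar> *\<^sub>R (\<integral>x. k (0 + s * x) \<partial>lborel)"
    using s by (intro lborel_integral_real_affine) auto
  also have "\<dots> = (\<integral>y. s * k (y * s) \<partial>lborel)" using s by (simp add: mult.commute)
  also have "\<dots> = integral {-B..B} (\<lambda>y. s * k (y * s))"
  proof -
    have c: "isCont (\<lambda>y. s * k (y * s)) y" for y
      by (intro continuous_intros isCont_o2[OF _ k])
    then have m: "(\<lambda>y. s * k (y * s)) \<in> borel_measurable borel"
      by (intro borel_measurable_continuous_onI continuous_at_imp_continuous_on) auto
    have kz: "s * k (y * s) = 0" if "y \<notin> {-B..B}" for y
    proof -
      have "B < \<bar>y\<bar>" using that by auto
      then have "B * s < \<bar>y\<bar> * s" using s by simp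
      then have "J < \<bar>y\<bar> * s" using B by linarith
      then have "J < \<bar>y * s\<bar>" using s by (simp add: abs_mult)
      then show ?thesis using z by simp
    qed
    show ?thesis unfolding integrable_lborel_lebesgue(2)[OF m, symmetric]
      by (rule compact_support_integral(2)[OF locally_integrable_continuous[OF c] kz])
  qed
  finally show ?thesis .
qed

text \<open>For t in the open interval the point is interior to the strip, so the derivative within
  the strip is the full, unique one; it vanishes because \<Psi> is 0 nearby.\<close>

lemma C1_strip_support:
  assumes C: "C1_strip T \<Psi> \<Psi>x \<Psi>t" and s: "\<And>x t. t \<in> {0..T} \<Longrightarrow> \<bar>x\<bar> > J \<Longrightarrow> \<Psi> (x, t) = 0"
    and t: "t \<in> {0<..<T}" and x: "\<bar>x\<bar> > J"
  shows "\<Psi>x (x, t) = 0" "\<Psi>t (x, t) = 0"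
proof -
  let ?O = "{x :: real. \<bar>x\<bar> > J} \<times> {0<..<T}"
  have oO: "open ?O" by (intro open_Times open_Collect_less continuous_intros open_greaterThanLessThan)
  have pO: "(x, t) \<in> ?O" using t x by simp
  have "(\<Psi> has_derivative (\<lambda>h. \<Psi>x (x, t) * fst h + \<Psi>t (x, t) * snd h)) (at (x, t) within UNIV \<times> {0..T})"
    using C t by (auto simp: C1_strip_def)
  moreover have "at (x, t) within (UNIV \<times> {0..T}) = at (x, t)"
  proof (rule at_within_interior)
    have "?O \<subseteq> UNIV \<times> {0..T}" by auto
    then show "(x, t) \<in> interior (UNIV \<times> {0..T})" using oO pO interiorI by blast
  qed
  ultimately have h1: "(\<Psi> has_derivative (\<lambda>h. \<Psi>x (x, t) * fst h + \<Psi>t (x, t) * snd h)) (at (x, t))" by simp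
  have h2: "(\<Psi> has_derivative (\<lambda>_. 0)) (at (x, t))"
    by (rule has_derivative_transform_within_open[OF has_derivative_const[of 0] oO pO]) (use s in auto)
  have "(\<lambda>h. \<Psi>x (x, t) * fst h + \<Psi>t (x, t) * snd h) = (\<lambda>_. 0)" by (rule has_derivative_unique[OF h1 h2])
  from fun_cong[OF this, of "(1, 0)"] fun_cong[OF this, of "(0, 1)"]
  show "\<Psi>x (x, t) = 0" "\<Psi>t (x, t) = 0" by simp_all
qed

lemma strip_slice:
  assumes "continuous_on (UNIV \<times> {0..T}) q" "t \<in> {0..T}"
  shows "isCont (\<lambda>x. q (x, t) :: real) (x::real)"
proof -
  have "continuous_on UNIV (\<lambda>x. q (x, t))"
    by (rule continuous_on_compose2[OF assms(1)]) (use assms(2) in \<open>auto intro!: continuous_intros\<close>)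
  then show ?thesis by (simp add: continuous_on_eq_continuous_at)
qed

text \<open>In the coordinates \<open>(\<eta>, t)\<close> the integral \<open>\<integral> w \<Psi> dx\<close> is differentiable in \<open>t\<close> for a merely \<open>C\<^sup>1\<close> test
  function; integrating the part that falls on \<open>\<surd>t\<close> by parts with the potential
  \<open>\<eta> f - 2 N\<close> of \<open>f\<close> yields the flux term.\<close>
lemma selfsimilar_weak_identity:
  fixes f N :: "real \<Rightarrow> real"
  assumes T: "T > 0" and fb: "\<And>y. \<bar>f y\<bar> \<le> M" and fc: "\<And>y. isCont f y"
    and Nb: "\<And>y. \<bar>N y\<bar> \<le> K" and Nc: "\<And>y. isCont N y"
    and Q: "\<And>y. DERIV (\<lambda>y. y * f y - 2 * N y) y :> f y"
    and lim: "(f \<longlongrightarrow> U0) at_bot" "(f \<longlongrightarrow> - V0) at_top"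
    and C: "C1_strip T \<Psi> \<Psi>x \<Psi>t" and end0: "\<And>x. \<Psi> (x, T) = 0"
    and J: "J > 0" and supp: "\<And>x t. t \<in> {0..T} \<Longrightarrow> \<bar>x\<bar> > J \<Longrightarrow> \<Psi> (x, t) = 0"
  shows "(\<integral>x. step_data U0 V0 x * \<Psi> (x, 0) \<partial>lebesgue)
      + (\<integral>p. f (fst p / sqrt (snd p)) * \<Psi>t p \<partial>lebesgue_on (QT T))
    = (\<integral>p. - N (fst p / sqrt (snd p)) / sqrt (snd p) * \<Psi>x p \<partial>lebesgue_on (QT T))"
proof -
  let ?S = "UNIV \<times> {0..T} :: (real \<times> real) set"
  have der: "(\<Psi> has_derivative (\<lambda>h. \<Psi>x p * fst h + \<Psi>t p * snd h)) (at p within ?S)" if "p \<in> ?S" for p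
    using C that by (auto simp: C1_strip_def)
  have xc: "continuous_on ?S \<Psi>x" and tc: "continuous_on ?S \<Psi>t" using C by (auto simp: C1_strip_def)
  have pc: "continuous_on ?S \<Psi>" using der by (rule has_derivative_continuous_on)
  have Mnn: "0 \<le> M" and Knn: "0 \<le> K" using fb[of 0] Nb[of 0] by linarith+
  obtain A where A: "0 \<le> A" "\<And>x t. \<bar>x\<bar> \<le> J \<Longrightarrow> t \<in> {0..T} \<Longrightarrow> \<bar>\<Psi> (x, t)\<bar> \<le> A \<and> \<bar>\<Psi>x (x, t)\<bar> \<le> A \<and> \<bar>\<Psi>t (x, t)\<bar> \<le> A"
  proof -
    have bdd: "\<exists>A. \<forall>p\<in>{-J..J} \<times> {0..T}. \<bar>q p\<bar> \<le> A" if "continuous_on ?S q" for q :: "real \<times> real \<Rightarrow> real"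
    proof -
      have "continuous_on ({-J..J} \<times> {0..T}) (\<lambda>p. \<bar>q p\<bar>)"
        by (intro continuous_intros continuous_on_subset[OF that]) auto
      moreover have "compact ({-J..J} \<times> {0..T})" "{-J..J} \<times> {0..T} \<noteq> {}" using J T by (auto intro: compact_Times)
      ultimately obtain p where "\<forall>p'\<in>{-J..J} \<times> {0..T}. \<bar>q p'\<bar> \<le> \<bar>q p\<bar>"
        using continuous_attains_sup by blast
      then show ?thesis by blast
    qed
    obtain A1 where A1: "\<forall>p\<in>{-J..J} \<times> {0..T}. \<bar>\<Psi> p\<bar> \<le> A1" using bdd[OF pc] by blast
    obtain A2 where A2: "\<forall>p\<in>{-J..J} \<times> {0..T}. \<bar>\<Psi>x p\<bar> \<le> A2" using bdd[OF xc] by blast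
    obtain A3 where A3: "\<forall>p\<in>{-J..J} \<times> {0..T}. \<bar>\<Psi>t p\<bar> \<le> A3" using bdd[OF tc] by blast
    show thesis
    proof (rule that[of "max 0 (max A1 (max A2 A3))"])
      fix x t assume "\<bar>x\<bar> \<le> J" "t \<in> {0..T}"
      then have "(x, t) \<in> {-J..J} \<times> {0..T}" by auto
      then have "\<bar>\<Psi> (x, t)\<bar> \<le> A1" "\<bar>\<Psi>x (x, t)\<bar> \<le> A2" "\<bar>\<Psi>t (x, t)\<bar> \<le> A3" using A1 A2 A3 by blast+
      then show "\<bar>\<Psi> (x, t)\<bar> \<le> max 0 (max A1 (max A2 A3)) \<and> \<bar>\<Psi>x (x, t)\<bar> \<le> max 0 (max A1 (max A2 A3)) \<and>
          \<bar>\<Psi>t (x, t)\<bar> \<le> max 0 (max A1 (max A2 A3))" by auto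
    qed simp
  qed
  have fcon: "continuous_on UNIV f" and Ncon: "continuous_on UNIV N"
    using fc Nc by (simp_all add: continuous_at_imp_continuous_on)
  have QTS: "QT T \<subseteq> ?S" by (auto simp: QT_def)
  have quot: "continuous_on (QT T) (\<lambda>p. fst p / sqrt (snd p))"
    by (intro continuous_intros) (auto simp: QT_def)
  have H1c: "continuous_on (QT T) (\<lambda>p. f (fst p / sqrt (snd p)) * \<Psi>t p)"
    by (intro continuous_intros continuous_on_compose2[OF fcon quot] continuous_on_subset[OF tc QTS]) auto
  have H2c: "continuous_on (QT T) (\<lambda>p. - N (fst p / sqrt (snd p)) / sqrt (snd p) * \<Psi>x p)"
    by (intro continuous_intros continuous_on_compose2[OF Ncon quot] continuous_on_subset[OF xc QTS]) (auto simp: QT_def)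
  define H1 where "H1 p = indicator (QT T) p * (f (fst p / sqrt (snd p)) * \<Psi>t p)" for p
  define H2 where "H2 p = indicator (QT T) p * (- N (fst p / sqrt (snd p)) / sqrt (snd p) * \<Psi>x p)" for p
  have H1m: "H1 \<in> borel_measurable borel" and H2m: "H2 \<in> borel_measurable borel"
    using borel_measurable_continuous_on_indicator[OF QT_sets(1) H1c] borel_measurable_continuous_on_indicator[OF QT_sets(1) H2c]
    by (simp_all add: H1_def[abs_def] H2_def[abs_def])
  have conv: "(\<integral>p. f (fst p / sqrt (snd p)) * \<Psi>t p \<partial>lebesgue_on (QT T)) = (\<integral>p. H1 p \<partial>lborel)"
    "(\<integral>p. - N (fst p / sqrt (snd p)) / sqrt (snd p) * \<Psi>x p \<partial>lebesgue_on (QT T)) = (\<integral>p. H2 p \<partial>lborel)"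
    using integrable_lborel_lebesgue(2)[OF H1m] integrable_lborel_lebesgue(2)[OF H2m] QT_sets(2)
    by (simp_all add: integral_restrict_space H1_def H2_def)
  have zx: "\<Psi>x (x, t) = 0" and zt: "\<Psi>t (x, t) = 0" if "t \<in> {0<..<T}" "\<bar>x\<bar> > J" for x t
    using C1_strip_support[OF C supp that] by auto
  let ?iJ = "indicator {-J..J} :: real \<Rightarrow> real" and ?iT = "\<lambda>t. indicator {0<..<T} t :: real"
  have \<Psi>b: "\<bar>\<Psi>x (x, t)\<bar> \<le> A * ?iJ x" "\<bar>\<Psi>t (x, t)\<bar> \<le> A * ?iJ x" if t: "t \<in> {0<..<T}" for x t
  proof -
    have "\<bar>\<Psi>x (x, t)\<bar> \<le> A * ?iJ x \<and> \<bar>\<Psi>t (x, t)\<bar> \<le> A * ?iJ x"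
    proof (cases "\<bar>x\<bar> \<le> J")
      case True
      then have "x \<in> {-J..J}" by auto
      then show ?thesis using A(2)[OF True, of t] t by simp
    next
      case False
      then show ?thesis using zx[OF t, of x] zt[OF t, of x] A(1) by simp
    qed
    then show "\<bar>\<Psi>x (x, t)\<bar> \<le> A * ?iJ x" "\<bar>\<Psi>t (x, t)\<bar> \<le> A * ?iJ x" by auto
  qed
  have iT: "integrable lborel ?iT" by (rule integrable_real_indicator) (use T in auto)
  have H1i: "integrable lborel H1"
  proof (rule Bochner_Integration.integrable_bound)
    show "integrable lborel (\<lambda>p. (M * A) * (?iJ (fst p) * ?iT (snd p)))"
      by (intro integrable_mult_right integrable_tensor integrable_indicator_Icc iT)
    show "AE p in lborel. norm (H1 p) \<le> norm ((M * A) * (?iJ (fst p) * ?iT (snd p)))"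
    proof (rule AE_I2)
      fix p :: "real \<times> real"
      obtain x t where p: "p = (x, t)" by (cases p)
      have "\<bar>f (x / sqrt t)\<bar> * \<bar>\<Psi>t (x, t)\<bar> \<le> M * (A * ?iJ x)" if "t \<in> {0<..<T}"
        by (rule mult_mono[OF fb \<Psi>b(2)[OF that]]) (use Mnn in auto)
      then show "norm (H1 p) \<le> norm ((M * A) * (?iJ (fst p) * ?iT (snd p)))"
        using Mnn A(1) by (auto simp: H1_def p QT_def abs_mult indicator_def split: if_splits)
    qed
  qed (use H1m in simp)
  have H2i: "integrable lborel H2"
  proof (rule Bochner_Integration.integrable_bound)
    show "integrable lborel (\<lambda>p. (K * A) * (?iJ (fst p) * (?iT (snd p) * (1 / sqrt (snd p)))))"
      by (intro integrable_mult_right integrable_tensor[OF integrable_indicator_Icc integrable_inverse_sqrt[OF T]])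
    show "AE p in lborel. norm (H2 p) \<le> norm ((K * A) * (?iJ (fst p) * (?iT (snd p) * (1 / sqrt (snd p)))))"
    proof (rule AE_I2)
      fix p :: "real \<times> real"
      obtain x t where p: "p = (x, t)" by (cases p)
      show "norm (H2 p) \<le> norm ((K * A) * (?iJ (fst p) * (?iT (snd p) * (1 / sqrt (snd p)))))"
      proof (cases "t \<in> {0<..<T}")
        case True
        have "\<bar>N (x / sqrt t)\<bar> * \<bar>\<Psi>x (x, t)\<bar> \<le> K * (A * ?iJ x)"
          by (rule mult_mono[OF Nb \<Psi>b(1)[OF True]]) (use Knn in auto)
        then have "\<bar>N (x / sqrt t)\<bar> * \<bar>\<Psi>x (x, t)\<bar> / sqrt t \<le> K * (A * ?iJ x) / sqrt t"
          using True by (intro divide_right_mono) auto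
        then show ?thesis using True Knn A(1) by (simp add: H2_def p QT_def abs_mult mult_ac)
      next
        case False
        then have "H2 p = 0" by (auto simp: H2_def p QT_def)
        then show ?thesis by simp
      qed
    qed
  qed (use H2m in simp)
  \<comment> \<open>R t is the difference of the two space-time integrands integrated over the
    slice. The claim says that R has total integral - \<integral>w0 \<Psi>(x,0) dx; with e t =
    \<integral>w \<Psi> dx, it follows from R = e' on (0,T) and e T = 0.\<close>
  define R where "R t = (\<integral>x. H1 (x, t) - H2 (x, t) \<partial>lborel)" for t
  have H12: "integrable lborel (\<lambda>p. H1 p - H2 p)" using H1i H2i by simp
  have Ri: "integrable lborel R" unfolding R_def[abs_def] by (rule lborel_Fubini(4)[OF H12])
  have Rtot: "(\<integral>t. R t \<partial>lborel) = (\<integral>p. H1 p \<partial>lborel) - (\<integral>p. H2 p \<partial>lborel)"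
    using lborel_Fubini(6)[OF H12] H1i H2i by (simp add: R_def)
  have Rz: "R t = 0" if "t \<notin> {0<..<T}" for t
  proof -
    have "(x, t) \<notin> QT T" for x using that by (auto simp: QT_def)
    then show ?thesis by (simp add: R_def H1_def H2_def)
  qed
  have Rm: "R \<in> borel_measurable borel" using borel_measurable_integrable[OF Ri] by simp
  define e where "e t = (\<integral>x. f (x / sqrt t) * \<Psi> (x, t) \<partial>lborel)" for t
  have slice: "isCont (\<lambda>x. f (x / sqrt t) * q (x, t)) x" "isCont (\<lambda>x. N (x / sqrt t) / sqrt t * q (x, t)) x"
    if "continuous_on ?S q" "t \<in> {0<..T}" for q x t
  proof -
    have "isCont (\<lambda>x. q (x, t)) x" by (rule strip_slice[OF that(1)]) (use that(2) in auto)
    moreover have "isCont (\<lambda>x. x / sqrt t) x" using that(2) by (intro continuous_intros) auto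
    ultimately show "isCont (\<lambda>x. f (x / sqrt t) * q (x, t)) x" "isCont (\<lambda>x. N (x / sqrt t) / sqrt t * q (x, t)) x"
      using that(2) by (auto intro!: continuous_intros isCont_o2[OF _ fc] isCont_o2[OF _ Nc])
  qed
  have main: "(R has_integral (- e \<tau>)) {\<tau>..T}" if \<tau>: "\<tau> \<in> {0<..<T}" for \<tau>
  proof -
    \<comment> \<open>One interval serves all t in [\<tau>,T]: |x| \<le> J means |y| \<le> J / sqrt
      t, which is less than B since t \<ge> \<tau>. B blows up as \<tau> goes to 0, so that limit is
      taken afterwards.\<close>
    define B where "B = J / sqrt \<tau> + 1"
    have Bt: "J < B * sqrt t" if "t \<in> {\<tau>..T}" for t
    proof -
      have "sqrt \<tau> > 0" "sqrt \<tau> \<le> sqrt t" using \<tau> that by auto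
      have "B > 0" using J \<tau> by (simp add: B_def add_pos_pos)
      have "J < B * sqrt \<tau>" using \<open>sqrt \<tau> > 0\<close> by (simp add: B_def distrib_right)
      also have "\<dots> \<le> B * sqrt t" using \<open>B > 0\<close> \<open>sqrt \<tau> \<le> sqrt t\<close> by simp
      finally show ?thesis .
    qed
    have pos: "sqrt t > 0" "t \<in> {0<..T}" "t \<in> {0..T}" if "t \<in> {\<tau>..T}" for t using that \<tau> by auto
    \<comment> \<open>The factor sqrt t is the Jacobian of x = y sqrt t. The argument of f no longer
      depends on t, so no derivative of f is taken.\<close>
    define F where "F t y = f y * (sqrt t * \<Psi> (y * sqrt t, t))" for t y
    define F' where "F' t y = f y * (inverse (sqrt t) / 2 * \<Psi> (y * sqrt t, t) +
        (\<Psi>x (y * sqrt t, t) * (y * (inverse (sqrt t) / 2)) + \<Psi>t (y * sqrt t, t)) * sqrt t)" for t y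
    have eF: "e t = integral {-B..B} (F t)" if t: "t \<in> {\<tau>..T}" for t
    proof -
      have "e t = integral {-B..B} (\<lambda>y. sqrt t * (f (y * sqrt t / sqrt t) * \<Psi> (y * sqrt t, t)))"
        unfolding e_def
        by (rule scaled_integral[OF slice(1)[OF pc pos(2)[OF t]] _ pos(1)[OF t] Bt[OF t]])
          (use supp pos(3)[OF t] in auto)
      also have "\<dots> = integral {-B..B} (F t)"
        using pos(1)[OF t] by (intro integral_cong) (simp add: F_def)
      finally show ?thesis .
    qed
    have path: "((\<lambda>t. \<Psi> (y * sqrt t, t)) has_real_derivative
        (\<Psi>x (y * sqrt t, t) * (y * (inverse (sqrt t) / 2)) + \<Psi>t (y * sqrt t, t))) (at t within {\<tau>..T})"
      if t: "t \<in> {\<tau>..T}" for y t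
    proof -
      have 1: "((\<lambda>t. (y * sqrt t, t)) has_derivative (\<lambda>h. (y * (inverse (sqrt t) / 2) * h, h))) (at t within {\<tau>..T})"
      proof (rule has_derivative_Pair)
        have "DERIV (\<lambda>t. y * sqrt t) t :> y * (inverse (sqrt t) / 2)"
          using pos(1)[OF t] by (auto intro!: derivative_eq_intros simp: field_simps)
        then have "((\<lambda>t. y * sqrt t) has_real_derivative y * (inverse (sqrt t) / 2)) (at t within {\<tau>..T})"
          by (rule has_field_derivative_at_within)
        then show "((\<lambda>t. y * sqrt t) has_derivative (\<lambda>h. y * (inverse (sqrt t) / 2) * h)) (at t within {\<tau>..T})"
          by (simp only: has_field_derivative_def)
      qed (rule has_derivative_ident)
      have img: "(\<lambda>t. (y * sqrt t, t)) ` {\<tau>..T} \<subseteq> ?S" using \<tau> by auto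
      have 2: "(\<Psi> has_derivative (\<lambda>h. \<Psi>x (y * sqrt t, t) * fst h + \<Psi>t (y * sqrt t, t) * snd h))
          (at (y * sqrt t, t) within (\<lambda>t. (y * sqrt t, t)) ` {\<tau>..T})"
        by (rule has_derivative_subset[OF der img]) (use pos(3)[OF t] in simp)
      have "((\<lambda>t. \<Psi> (y * sqrt t, t)) has_derivative
          (\<lambda>h. \<Psi>x (y * sqrt t, t) * fst (y * (inverse (sqrt t) / 2) * h, h) + \<Psi>t (y * sqrt t, t) * snd (y * (inverse (sqrt t) / 2) * h, h)))
          (at t within {\<tau>..T})"
        by (rule has_derivative_in_compose[OF 1 2])
      then show ?thesis unfolding has_field_derivative_def
        by (rule has_derivative_eq_rhs) (auto simp: fun_eq_iff algebra_simps)
    qed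
    have FD: "((\<lambda>t. F t y) has_real_derivative F' t y) (at t within {\<tau>..T})" if t: "t \<in> {\<tau>..T}" for t y
    proof -
      have "(sqrt has_real_derivative inverse (sqrt t) / 2) (at t within {\<tau>..T})"
        using pos(2)[OF t] by (intro has_field_derivative_at_within[OF DERIV_real_sqrt]) simp
      from DERIV_cmult[OF DERIV_mult[OF this path[OF t]]]
      show ?thesis unfolding F_def F'_def .
    qed
    have maps: "continuous_on ({\<tau>..T} \<times> {-B..B}) (\<lambda>q. (snd q * sqrt (fst q), fst q))"
      "(\<lambda>q. (snd q * sqrt (fst q), fst q)) ` ({\<tau>..T} \<times> {-B..B}) \<subseteq> ?S"
      using \<tau> by (auto intro!: continuous_intros)
    have F'c: "continuous_on ({\<tau>..T} \<times> {-B..B}) (\<lambda>(t, y). F' t y)"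
      unfolding F'_def case_prod_beta using \<tau>
      by (intro continuous_intros continuous_on_compose2[OF fcon] continuous_on_compose2[OF pc maps(1)]
          continuous_on_compose2[OF xc maps(1)] continuous_on_compose2[OF tc maps(1)] maps(2)) auto
    have sl: "continuous_on {-B..B} (\<lambda>y. q (y * sqrt t, t))" if "continuous_on ?S q" "t \<in> {\<tau>..T}" for q :: "real \<times> real \<Rightarrow> real" and t
      by (rule continuous_on_compose2[OF that(1)]) (use pos(3)[OF that(2)] in \<open>auto intro!: continuous_intros\<close>)
    have fB: "continuous_on {-B..B} f" "continuous_on {-B..B} N"
      using fcon Ncon continuous_on_subset by blast+
    have Fi: "F t integrable_on {-B..B}" if "t \<in> {\<tau>..T}" for t
      unfolding F_def by (intro integrable_continuous_interval continuous_intros fB sl[OF pc that])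
    have eD: "(e has_real_derivative integral {-B..B} (F' t)) (at t within {\<tau>..T})" if t: "t \<in> {\<tau>..T}" for t
    proof -
      have "((\<lambda>t. integral (cbox (-B) B) (F t)) has_real_derivative integral (cbox (-B) B) (F' t)) (at t within {\<tau>..T})"
        by (rule leibniz_rule_field_derivative[OF FD _ _ t]) (use Fi F'c in auto)
      then have "((\<lambda>t. integral {-B..B} (F t)) has_real_derivative integral {-B..B} (F' t)) (at t within {\<tau>..T})"
        by simp
      then show ?thesis
        by (rule has_field_derivative_transform_within[OF _ zero_less_one t]) (simp add: eF)
    qed
    have eT: "e T = 0" by (simp add: e_def end0)
    have "((\<lambda>t. integral {-B..B} (F' t)) has_integral (e T - e \<tau>)) {\<tau>..T}"
      by (rule fundamental_theorem_of_calculus)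
        (use \<tau> eD in \<open>auto simp: has_real_derivative_iff_has_vector_derivative[symmetric]\<close>)
    then have hi: "((\<lambda>t. integral {-B..B} (F' t)) has_integral (- e \<tau>)) {\<tau>..T}" by (simp add: eT)
    have Req: "integral {-B..B} (F' t) = R t" if t: "t \<in> {\<tau>..<T}" for t
    proof -
      have t': "t \<in> {\<tau>..T}" "t \<in> {0<..<T}" using t \<tau> by auto
      let ?s = "sqrt t"
      have s: "?s > 0" by (rule pos(1)[OF t'(1)])
      define X where "X y = ?s * (f y * \<Psi>t (y * ?s, t) + N y / ?s * \<Psi>x (y * ?s, t))" for y
      \<comment> \<open>Y is the y-derivative of (y f - 2 N) \<Psi>(y sqrt t, t), so it integrates
        to 0. Adding Y/(2 sqrt t) to X reproduces F': the terms from differentiating sqrt t are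
        traded for the flux term with N.\<close>
      define Y where "Y y = f y * \<Psi> (y * ?s, t) + (y * f y - 2 * N y) * (\<Psi>x (y * ?s, t) * ?s)" for y
      have "R t = (\<integral>x. f (x / ?s) * \<Psi>t (x, t) + N (x / ?s) / ?s * \<Psi>x (x, t) \<partial>lborel)"
        unfolding R_def using t'(2) by (intro Bochner_Integration.integral_cong refl) (simp add: H1_def H2_def QT_def)
      also have "\<dots> = integral {-B..B} (\<lambda>y. ?s * (f (y * ?s / ?s) * \<Psi>t (y * ?s, t) + N (y * ?s / ?s) / ?s * \<Psi>x (y * ?s, t)))"
      proof (rule scaled_integral[OF _ _ s Bt[OF t'(1)]])
        show "isCont (\<lambda>x. f (x / ?s) * \<Psi>t (x, t) + N (x / ?s) / ?s * \<Psi>x (x, t)) x" for x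
          by (intro continuous_add slice(1)[OF tc pos(2)[OF t'(1)]] slice(2)[OF xc pos(2)[OF t'(1)]])
        show "f (x / ?s) * \<Psi>t (x, t) + N (x / ?s) / ?s * \<Psi>x (x, t) = 0" if "\<bar>x\<bar> > J" for x
          using zx[OF t'(2) that] zt[OF t'(2) that] by simp
      qed
      also have "\<dots> = integral {-B..B} X" using s by (intro integral_cong) (simp add: X_def)
      finally have RX: "R t = integral {-B..B} X" .
      have Yi: "(Y has_integral ((B * f B - 2 * N B) * \<Psi> (B * ?s, t) - ((-B) * f (-B) - 2 * N (-B)) * \<Psi> ((-B) * ?s, t))) {-B..B}"
      proof (rule fundamental_theorem_of_calculus)
        have "J < B * ?s" by (rule Bt[OF t'(1)])
        then have "B * ?s > 0" using J by linarith
        then show "- B \<le> B" using s by (simp add: zero_less_mult_iff)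
        fix y assume "y \<in> {-B..B}"
        have d: "((\<lambda>y. \<Psi> (y * ?s, t)) has_real_derivative \<Psi>x (y * ?s, t) * ?s) (at y)"
        proof -
          have 1: "((\<lambda>y. (y * ?s, t)) has_derivative (\<lambda>h. (h * ?s, 0))) (at y)"
            by (auto intro!: derivative_eq_intros)
          have 2: "(\<Psi> has_derivative (\<lambda>h. \<Psi>x (y * ?s, t) * fst h + \<Psi>t (y * ?s, t) * snd h))
              (at (y * ?s, t) within range (\<lambda>y. (y * ?s, t)))"
            by (rule has_derivative_subset[OF der]) (use t'(2) in auto)
          have "((\<lambda>y. \<Psi> (y * ?s, t)) has_derivative (\<lambda>h. \<Psi>x (y * ?s, t) * fst (h * ?s, 0::real) + \<Psi>t (y * ?s, t) * snd (h * ?s, 0::real))) (at y)"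
            by (rule has_derivative_in_compose[OF 1 2])
          then show ?thesis unfolding has_field_derivative_def
            by (rule has_derivative_eq_rhs) (auto simp: fun_eq_iff)
        qed
        have "((\<lambda>y. (y * f y - 2 * N y) * \<Psi> (y * ?s, t)) has_real_derivative Y y) (at y)"
          using DERIV_mult[OF Q d] by (simp add: Y_def mult.commute add.commute)
        then show "((\<lambda>y. (y * f y - 2 * N y) * \<Psi> (y * ?s, t)) has_vector_derivative Y y) (at y within {-B..B})"
          by (auto simp: has_real_derivative_iff_has_vector_derivative[symmetric] intro: has_field_derivative_at_within)
      qed
      have "\<Psi> (B * ?s, t) = 0" "\<Psi> ((-B) * ?s, t) = 0"
        using supp[OF pos(3)[OF t'(1)], of "B * ?s"] supp[OF pos(3)[OF t'(1)], of "(-B) * ?s"] Bt[OF t'(1)] J by auto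
      then have Y0: "(Y has_integral 0) {-B..B}" using Yi by simp
      have Xi: "X integrable_on {-B..B}"
        unfolding X_def using s by (intro integrable_continuous_interval continuous_intros fB sl[OF tc t'(1)] sl[OF xc t'(1)]) auto
      have "F' t y = X y + inverse ?s / 2 * Y y" for y
        using s by (simp add: F'_def X_def Y_def field_simps)
      then have "F' t = (\<lambda>y. X y + inverse ?s / 2 * Y y)" by (rule ext)
      then have "integral {-B..B} (F' t) = integral {-B..B} (\<lambda>y. X y + inverse ?s / 2 * Y y)" by (rule arg_cong)
      also have "\<dots> = integral {-B..B} X + 0"
      proof (rule integral_unique, rule has_integral_add)
        show "(X has_integral integral {-B..B} X) {-B..B}" using Xi by (rule integrable_integral)
        show "((\<lambda>y. inverse ?s / 2 * Y y) has_integral 0) {-B..B}"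
          using has_integral_mult_right[OF Y0, of "inverse ?s / 2"] by simp
      qed
      finally show ?thesis using RX by simp
    qed
    show ?thesis
      by (rule has_integral_spike_finite[OF _ _ hi, of "{T}"]) (use Req in auto)
  qed
  \<comment> \<open>The offset 2 keeps every \<tau> n strictly below T.\<close>
  define \<tau> where "\<tau> n = T / real (n + 2)" for n
  have \<tau>: "\<tau> n \<in> {0<..<T}" for n
  proof -
    have "T / real (n + 2) < T / 1" using T by (intro divide_strict_left_mono) auto
    then show ?thesis using T by (simp add: \<tau>_def)
  qed
  have \<tau>0: "\<tau> \<longlonglongrightarrow> 0"
  proof -
    have "(\<lambda>n. T * inverse (real (Suc (n + 1)))) \<longlonglongrightarrow> T * 0"
      by (intro tendsto_mult tendsto_const LIMSEQ_ignore_initial_segment[OF LIMSEQ_inverse_real_of_nat])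
    then show ?thesis by (simp add: \<tau>_def[abs_def] divide_inverse)
  qed
  have lim1: "(\<lambda>n. - e (\<tau> n)) \<longlonglongrightarrow> (\<integral>t. R t \<partial>lborel)"
  proof -
    have "(\<lambda>n. \<integral>t. indicator {\<tau> n..T} t * R t \<partial>lborel) \<longlonglongrightarrow> (\<integral>t. R t \<partial>lborel)"
    proof (rule integral_dominated_convergence[where w="\<lambda>t. \<bar>R t\<bar>"])
      show "AE t in lborel. (\<lambda>n. indicator {\<tau> n..T} t * R t) \<longlonglongrightarrow> R t"
      proof (rule AE_I2)
        fix t
        show "(\<lambda>n. indicator {\<tau> n..T} t * R t) \<longlonglongrightarrow> R t"
        proof (cases "t \<in> {0<..<T}")
          case True
          then have "\<forall>\<^sub>F n in sequentially. \<tau> n < t" using \<tau>0 by (auto dest: order_tendstoD)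
          then have "\<forall>\<^sub>F n in sequentially. indicator {\<tau> n..T} t * R t = R t"
            by eventually_elim (use True in auto)
          then show ?thesis by (rule tendsto_eventually)
        qed (simp add: Rz)
      qed
      show "AE t in lborel. norm (indicator {\<tau> n..T} t * R t) \<le> \<bar>R t\<bar>" for n
        by (intro AE_I2) (auto simp: indicator_def)
      show "(\<lambda>t. indicator {\<tau> n..T} t * R t) \<in> borel_measurable lborel" for n using Rm by measurable
    qed (use Ri Rm in auto)
    moreover have "(\<integral>t. indicator {\<tau> n..T} t * R t \<partial>lborel) = - e (\<tau> n)" for n
    proof -
      have "integrable lborel (\<lambda>t. indicator {\<tau> n..T} t * R t)"
        by (rule Bochner_Integration.integrable_bound[OF Ri]) (use Rm in \<open>auto simp: indicator_def\<close>)
      then have "integrable (lebesgue_on {\<tau> n..T}) R" using integral_lebesgue_on_lborel(1)[OF Rm] by simp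
      then have "(\<integral>t. R t \<partial>lebesgue_on {\<tau> n..T}) = integral {\<tau> n..T} R"
        by (intro lebesgue_integral_eq_integral) auto
      then show ?thesis
        using integral_lebesgue_on_lborel(2)[OF Rm] integral_unique[OF main[OF \<tau>]] by simp
    qed
    ultimately show ?thesis by simp
  qed
  have w0m: "(\<lambda>x. step_data U0 V0 x * \<Psi> (x, 0)) \<in> borel_measurable borel"
  proof -
    have "(\<lambda>x. \<Psi> (x, 0)) \<in> borel_measurable borel"
      using strip_slice[OF pc, of 0] T by (intro borel_measurable_continuous_onI continuous_at_imp_continuous_on) auto
    then show ?thesis unfolding step_data_def by measurable
  qed
  have lim2: "(\<lambda>n. e (\<tau> n)) \<longlonglongrightarrow> (\<integral>x. step_data U0 V0 x * \<Psi> (x, 0) \<partial>lborel)"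
    unfolding e_def
  proof (rule integral_dominated_convergence[where w="\<lambda>x. M * A * ?iJ x"])
    \<comment> \<open>For x \<noteq> 0 the argument x / sqrt (\<tau> n) runs to minus or plus
      infinity, where the limits of f are the two initial values; the point x = 0 is a null
      set.\<close>
    have lims: "(\<lambda>n. f (x / sqrt (\<tau> n)) * \<Psi> (x, \<tau> n)) \<longlonglongrightarrow> step_data U0 V0 x * \<Psi> (x, 0)" if x: "x \<noteq> 0" for x
    proof (rule tendsto_mult)
      have s0: "filterlim (\<lambda>n. sqrt (\<tau> n)) (at_right 0) sequentially"
      proof -
        have "0 < sqrt (\<tau> n)" for n using \<tau>[of n] by simp
        then have "\<forall>n. sqrt (\<tau> n) \<in> {0<..} \<and> sqrt (\<tau> n) \<noteq> 0" by (auto simp: less_imp_neq[symmetric])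
        then show ?thesis unfolding filterlim_at
          using tendsto_real_sqrt[OF \<tau>0] by (intro conjI always_eventually) simp_all
      qed
      have inv: "filterlim (\<lambda>n. inverse (sqrt (\<tau> n))) at_top sequentially"
        by (rule filterlim_compose[OF filterlim_inverse_at_top_right s0])
      show "(\<lambda>n. f (x / sqrt (\<tau> n))) \<longlonglongrightarrow> step_data U0 V0 x"
      proof (cases "x < 0")
        case True
        have "filterlim (\<lambda>n. x * inverse (sqrt (\<tau> n))) at_bot sequentially"
          by (rule filterlim_tendsto_neg_mult_at_bot[OF tendsto_const True inv])
        then show ?thesis using filterlim_compose[OF lim(1)] True by (simp add: step_data_def divide_inverse)
      next
        case False
        then have "x > 0" using x by simp
        then have "filterlim (\<lambda>n. x * inverse (sqrt (\<tau> n))) at_top sequentially"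
          by (intro filterlim_tendsto_pos_mult_at_top[OF tendsto_const _ inv])
        then show ?thesis using filterlim_compose[OF lim(2)] False by (simp add: step_data_def divide_inverse)
      qed
      have "continuous_on {0..T} (\<lambda>t. \<Psi> (x, t))"
        by (rule continuous_on_compose2[OF pc]) (auto intro!: continuous_intros)
      then show "(\<lambda>n. \<Psi> (x, \<tau> n)) \<longlonglongrightarrow> \<Psi> (x, 0)"
        using continuous_on_tendsto_compose[of "{0..T}" "\<lambda>t. \<Psi> (x, t)" \<tau> 0 sequentially] \<tau>0 \<tau> T
        by (auto intro!: always_eventually simp: less_imp_le)
    qed
    show "AE x in lborel. (\<lambda>n. f (x / sqrt (\<tau> n)) * \<Psi> (x, \<tau> n)) \<longlonglongrightarrow> step_data U0 V0 x * \<Psi> (x, 0)"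
      using AE_lborel_singleton[of 0] by eventually_elim (rule lims)
    show "AE x in lborel. norm (f (x / sqrt (\<tau> n)) * \<Psi> (x, \<tau> n)) \<le> M * A * ?iJ x" for n
    proof (rule AE_I2)
      fix x
      have t: "\<tau> n \<in> {0..T}" using \<tau>[of n] by auto
      have "\<bar>\<Psi> (x, \<tau> n)\<bar> \<le> A * ?iJ x"
        using A(2)[OF _ t, of x] supp[OF t, of x] by (cases "\<bar>x\<bar> \<le> J") (auto simp: indicator_def)
      then have "\<bar>f (x / sqrt (\<tau> n))\<bar> * \<bar>\<Psi> (x, \<tau> n)\<bar> \<le> M * (A * ?iJ x)" using fb Mnn by (intro mult_mono) auto
      then show "norm (f (x / sqrt (\<tau> n)) * \<Psi> (x, \<tau> n)) \<le> M * A * ?iJ x" by (simp add: abs_mult mult.assoc)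
    qed
    show "(\<lambda>x. f (x / sqrt (\<tau> n)) * \<Psi> (x, \<tau> n)) \<in> borel_measurable lborel" for n
    proof -
      have "\<tau> n \<in> {0<..T}" using \<tau>[of n] by auto
      then show ?thesis using slice(1)[OF pc, of "\<tau> n"]
        by (simp add: borel_measurable_continuous_onI continuous_at_imp_continuous_on)
    qed
    show "integrable lborel (\<lambda>x. M * A * ?iJ x)" by (intro integrable_mult_right integrable_indicator_Icc)
  qed (use w0m in simp)
  have "(\<integral>t. R t \<partial>lborel) = - (\<integral>x. step_data U0 V0 x * \<Psi> (x, 0) \<partial>lborel)"
    by (rule LIMSEQ_unique[OF lim1 tendsto_minus[OF lim2]])
  then show ?thesis
    using Rtot conv integrable_lborel_lebesgue(2)[OF w0m] by simp
qed

section \<open>Membership in the Bochner space\<close>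

lemma integrable_exp_abs:
  assumes c: "c > 0"
  shows "integrable lborel (\<lambda>x::real. exp (- c * \<bar>x\<bar>))"
proof -
  define k where "k x = indicator {0..} x * exp (- c * x)" for x :: real
  have km: "k \<in> borel_measurable borel" unfolding k_def[abs_def] by measurable
  have "(\<lambda>x. exp (- c * x)) absolutely_integrable_on {0..}"
    by (rule nonnegative_absolutely_integrable_1[OF integrable_on_exp_minus_to_infinity[OF c]]) simp
  then have "integrable lebesgue k" by (simp add: set_integrable_def k_def[abs_def])
  then have k: "integrable lborel k" using integrable_lborel_lebesgue(1)[OF km] by simp
  have k': "integrable lborel (\<lambda>x. k (0 + (- 1) * x))" by (rule lborel_integrable_real_affine[OF k]) simp
  have "integrable lborel (\<lambda>x. k x + k (0 + (- 1) * x))" using k k' by (rule Bochner_Integration.integrable_add)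
  then show ?thesis
    by (rule Bochner_Integration.integrable_bound) (auto simp: k_def indicator_def intro!: AE_I2)
qed

lemma exp_abs_scaled:
  assumes s: "s > 0"
  shows "integrable lborel (\<lambda>x::real. exp (- 2 * \<bar>x / s\<bar>))"
    "(\<integral>x. exp (- 2 * \<bar>x / s\<bar>) \<partial>lborel) = s * (\<integral>y. exp (- 2 * \<bar>y\<bar>) \<partial>lborel)"
proof -
  have "exp (- (2 / s) * \<bar>x\<bar>) = exp (- 2 * \<bar>x / s\<bar>)" for x using s by (simp add: abs_divide)
  then show "integrable lborel (\<lambda>x::real. exp (- 2 * \<bar>x / s\<bar>))"
    using integrable_exp_abs[of "2 / s"] s by simp
  have "(\<integral>x. exp (- 2 * \<bar>x / s\<bar>) \<partial>lborel) = \<bar>s\<bar> *\<^sub>R (\<integral>x. exp (- 2 * \<bar>(0 + s * x) / s\<bar>) \<partial>lborel)"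
    using s by (intro lborel_integral_real_affine) auto
  then show "(\<integral>x. exp (- 2 * \<bar>x / s\<bar>) \<partial>lborel) = s * (\<integral>y. exp (- 2 * \<bar>y\<bar>) \<partial>lborel)"
    using s by simp
qed

lemma power2_le_of_abs_le_add:
  fixes a p q :: real
  assumes "\<bar>a\<bar> \<le> p + q"
  shows "a\<^sup>2 \<le> 2 * p\<^sup>2 + 2 * q\<^sup>2"
proof -
  have "a\<^sup>2 \<le> (p + q)\<^sup>2" using assms by (rule abs_le_square_iff[THEN iffD1, OF order_trans[OF _ abs_ge_self]])
  moreover have "(p + q)\<^sup>2 + (p - q)\<^sup>2 = 2 * p\<^sup>2 + 2 * q\<^sup>2" by (simp add: power2_eq_square algebra_simps)
  moreover have "0 \<le> (p - q)\<^sup>2" by simp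
  ultimately show ?thesis by linarith
qed

text \<open>This is (p + q)^2 \<le> 2 p^2 + 2 q^2 integrated. The factor s from rescaling the
  exponential decides integrability in time below; 4 B^2 is 2 B^2 times the length of
  [-1,1].\<close>

lemma square_integrable_exp_bound:
  fixes g :: "real \<Rightarrow> real"
  assumes g: "g \<in> borel_measurable borel" and s: "s > 0"
    and b: "\<And>x. \<bar>g x\<bar> \<le> A * exp (- \<bar>x / s\<bar>) + B * indicator {-1..1} x"
  shows "integrable lborel (\<lambda>x. (g x)\<^sup>2)"
    "(\<integral>x. (g x)\<^sup>2 \<partial>lborel) \<le> 2 * A\<^sup>2 * (s * (\<integral>y. exp (- 2 * \<bar>y\<bar>) \<partial>lborel)) + 4 * B\<^sup>2"
proof -
  let ?h = "\<lambda>x. 2 * A\<^sup>2 * exp (- 2 * \<bar>x / s\<bar>) + 2 * B\<^sup>2 * indicator {-1..1} x"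
  have le: "(g x)\<^sup>2 \<le> ?h x" for x
  proof -
    have "(exp (- \<bar>x / s\<bar>))\<^sup>2 = exp (- 2 * \<bar>x / s\<bar>)" by (simp add: power2_eq_square exp_add[symmetric])
    moreover have "(indicator {-1..1} x :: real)\<^sup>2 = indicator {-1..1} x" by (simp add: indicator_def)
    ultimately show ?thesis
      using power2_le_of_abs_le_add[OF b[of x]] by (simp only: power_mult_distrib mult.assoc)
  qed
  have i1: "integrable lborel (\<lambda>x. 2 * A\<^sup>2 * exp (- 2 * \<bar>x / s\<bar>))"
    by (intro integrable_mult_right exp_abs_scaled(1) s)
  have i2: "integrable lborel (\<lambda>x::real. 2 * B\<^sup>2 * indicator {-1..1} x :: real)"
    by (rule integrable_mult_right) (rule integrable_indicator_Icc)
  have i: "integrable lborel ?h" using i1 i2 by (rule Bochner_Integration.integrable_add)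
  show gi: "integrable lborel (\<lambda>x. (g x)\<^sup>2)"
  proof (rule Bochner_Integration.integrable_bound[OF i])
    show "AE x in lborel. norm ((g x)\<^sup>2) \<le> norm (?h x)"
      using le by (intro AE_I2) (auto intro: order_trans[OF _ abs_ge_self])
  qed (use g in measurable)
  have "(\<integral>x. (g x)\<^sup>2 \<partial>lborel) \<le> (\<integral>x. ?h x \<partial>lborel)" by (rule integral_mono[OF gi i le])
  also have "\<dots> = 2 * A\<^sup>2 * (\<integral>x. exp (- 2 * \<bar>x / s\<bar>) \<partial>lborel) + 2 * B\<^sup>2 * (\<integral>x. indicator {-1..1::real} x \<partial>lborel)"
    using i1 i2 by (simp add: Bochner_Integration.integral_add)
  also have "(\<integral>x. indicator {-1..1::real} x \<partial>lborel) = (2::real)" by simp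
  finally show "(\<integral>x. (g x)\<^sup>2 \<partial>lborel) \<le> 2 * A\<^sup>2 * (s * (\<integral>y. exp (- 2 * \<bar>y\<bar>) \<partial>lborel)) + 4 * B\<^sup>2"
    unfolding exp_abs_scaled(2)[OF s] by simp
qed

text \<open>Outside [-1,1], where E is constant, the difference decays like exp (- |x| / sqrt t).
  Its squared norm is of order sqrt t, that of its derivative of order (1/sqrt t)^2 sqrt t = 1/sqrt
  t, up to constants from [-1,1]; both are integrable on (0,T). Strong measurability comes from
  sampling t on a grid of width 1/(k + 1).\<close>

lemma profile_L2_W12:
  fixes F N E E' :: "real \<Rightarrow> real"
  assumes T: "T > 0" and F: "\<And>y. DERIV F y :> - N y" and Nc: "\<And>y. isCont N y"
    and C: "0 \<le> C" and Nb: "\<And>y. \<bar>N y\<bar> \<le> C * exp (- \<bar>y\<bar>)"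
    and E: "\<And>x. DERIV E x :> E' x" and E'c: "\<And>x. isCont E' x"
    and El: "\<And>x. x < -1 \<Longrightarrow> E x = Fu" and Er: "\<And>x. x > 1 \<Longrightarrow> E x = Fl"
    and Fl: "\<And>y. y \<le> 0 \<Longrightarrow> \<bar>F y - Fu\<bar> \<le> C * exp (- \<bar>y\<bar>)"
    and Fr: "\<And>y. y \<ge> 0 \<Longrightarrow> \<bar>F y - Fl\<bar> \<le> C * exp (- \<bar>y\<bar>)"
  shows "(\<lambda>t x. F (x / sqrt t) - E x) \<in> L2_W12 T"
proof -
  define V where "V t x = F (x / sqrt t) - E x" for t x
  define v where "v t x = - N (x / sqrt t) / sqrt t - E' x" for t x
  have Fc: "isCont F y" for y by (rule DERIV_isCont[OF F])
  have Ec: "isCont E x" for x by (rule DERIV_isCont[OF E])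
  have contm: "k \<in> borel_measurable borel" if "\<And>x. isCont k x" for k :: "real \<Rightarrow> real"
    using that by (intro borel_measurable_continuous_onI continuous_at_imp_continuous_on) auto
  have [measurable]: "F \<in> borel_measurable borel" "N \<in> borel_measurable borel"
    "E \<in> borel_measurable borel" "E' \<in> borel_measurable borel"
    by (intro contm Fc Nc Ec E'c)+
  have Vm: "V t \<in> borel_measurable borel" "v t \<in> borel_measurable borel" for t
    unfolding V_def[abs_def] v_def[abs_def] by measurable
  have dF: "DERIV (\<lambda>x. F (x / sqrt t)) x :> - N (x / sqrt t) / sqrt t" if "t > 0" for t x
  proof -
    have "DERIV (\<lambda>x. F (x / sqrt t)) x :> - N (x / sqrt t) * (1 / sqrt t)"
      by (rule DERIV_chain2[OF F]) (rule DERIV_cdivide[OF DERIV_ident])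
    then show ?thesis by simp
  qed
  have wd: "has_weak_deriv (V t) (v t)" if t: "t > 0" for t
  proof (rule has_weak_deriv_C1)
    show "DERIV (V t) x :> v t x" for x
      unfolding V_def[abs_def] v_def by (intro DERIV_diff dF E t)
    show "isCont (v t) x" for x
      unfolding v_def[abs_def] using t by (intro continuous_intros isCont_o2[OF _ Nc] E'c) auto
  qed
  have E'z: "E' x = 0" if x: "x \<notin> {-1..1}" for x
  proof (cases "x < -1")
    case True
    have "DERIV E x :> 0" by (rule DERIV_cong_open[of "\<lambda>_. Fu" _ _ "{..<-1}"]) (use True El in auto)
    then show ?thesis using E DERIV_unique by blast
  next
    case False
    then have "x > 1" using x by auto
    have "DERIV E x :> 0" by (rule DERIV_cong_open[of "\<lambda>_. Fl" _ _ "{1<..}"]) (use \<open>x > 1\<close> Er in auto)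
    then show ?thesis using E DERIV_unique by blast
  qed
  have bdd: "\<exists>K\<ge>0. \<forall>x\<in>{-1..1}. \<bar>q x\<bar> \<le> K" if q: "\<And>x. isCont q x" for q :: "real \<Rightarrow> real"
  proof -
    have "continuous_on {-1..1} (\<lambda>x. \<bar>q x\<bar>)"
      by (intro continuous_at_imp_continuous_on ballI continuous_rabs q)
    moreover have "{-1..1::real} \<noteq> {}" by simp
    ultimately obtain y where "\<forall>x\<in>{-1..1}. \<bar>q x\<bar> \<le> \<bar>q y\<bar>"
      using continuous_attains_sup[OF compact_Icc] by blast
    then show ?thesis by (intro exI[of _ "\<bar>q y\<bar>"]) simp
  qed
  obtain K1 where K1: "0 \<le> K1" "\<And>x. x \<in> {-1..1} \<Longrightarrow> \<bar>E x\<bar> \<le> K1" using bdd[OF Ec] by blast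
  obtain K2 where K2: "0 \<le> K2" "\<And>x. x \<in> {-1..1} \<Longrightarrow> \<bar>E' x\<bar> \<le> K2" using bdd[OF E'c] by blast
  define B where "B = \<bar>Fu\<bar> + \<bar>Fl\<bar> + K1"
  have bV: "\<bar>V t x\<bar> \<le> C * exp (- \<bar>x / sqrt t\<bar>) + B * indicator {-1..1} x" if t: "t > 0" for t x
  proof -
    let ?y = "x / sqrt t"
    have s: "sqrt t > 0" using t by simp
    consider "x < -1" | "x > 1" | "x \<in> {-1..1}" by fastforce
    then show ?thesis
    proof cases
      case 1
      then have "?y \<le> 0" using s by (simp add: divide_nonpos_pos)
      then show ?thesis using Fl[of ?y] El[OF 1] 1 by (simp add: V_def)
    next
      case 2
      then have "?y \<ge> 0" using s by simp
      then show ?thesis using Fr[of ?y] Er[OF 2] 2 by (simp add: V_def)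
    next
      case 3
      have "\<bar>F ?y\<bar> \<le> \<bar>Fu\<bar> + \<bar>Fl\<bar> + C * exp (- \<bar>?y\<bar>)"
        using Fl[of ?y] Fr[of ?y] by (cases "?y \<le> 0") linarith+
      then have "\<bar>F ?y - E x\<bar> \<le> C * exp (- \<bar>?y\<bar>) + B" using K1(2)[OF 3] unfolding B_def by linarith
      then show ?thesis using 3 by (simp add: V_def)
    qed
  qed
  have bv: "\<bar>v t x\<bar> \<le> C / sqrt t * exp (- \<bar>x / sqrt t\<bar>) + K2 * indicator {-1..1} x" if t: "t > 0" for t x
  proof -
    have "\<bar>N (x / sqrt t) / sqrt t\<bar> = \<bar>N (x / sqrt t)\<bar> / sqrt t" using t by (simp add: abs_divide)
    also have "\<dots> \<le> C * exp (- \<bar>x / sqrt t\<bar>) / sqrt t" using t by (intro divide_right_mono Nb) auto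
    finally have 1: "\<bar>N (x / sqrt t) / sqrt t\<bar> \<le> C / sqrt t * exp (- \<bar>x / sqrt t\<bar>)" by simp
    have 2: "\<bar>E' x\<bar> \<le> K2 * indicator {-1..1} x"
      using K2(2)[of x] E'z[of x] by (cases "x \<in> {-1..1}") auto
    have "\<bar>v t x\<bar> \<le> \<bar>N (x / sqrt t) / sqrt t\<bar> + \<bar>E' x\<bar>"
      unfolding v_def using abs_triangle_ineq4[of "- N (x / sqrt t) / sqrt t" "E' x"] by simp
    with 1 2 show ?thesis by linarith
  qed
  define \<kappa> where "\<kappa> = (\<integral>y. exp (- 2 * \<bar>y\<bar>) \<partial>lborel :: real)"
  have \<kappa>: "0 \<le> \<kappa>" unfolding \<kappa>_def by simp
  note V2 = square_integrable_exp_bound[OF Vm(1) _ bV]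
  note v2 = square_integrable_exp_bound[OF Vm(2) _ bv]
  have toleb: "q \<in> L2" if "q \<in> borel_measurable borel" "integrable lborel (\<lambda>x. (q x)\<^sup>2)" for q :: "real \<Rightarrow> real"
  proof -
    have "q \<in> borel_measurable lebesgue" using that(1) by (intro measurable_completion) simp
    moreover have "integrable lebesgue (\<lambda>x. (q x)\<^sup>2) = integrable lborel (\<lambda>x. (q x)\<^sup>2)"
      by (rule integrable_lborel_lebesgue(1)) (use that(1) in measurable)
    ultimately show ?thesis using that(2) by (simp add: L2_def)
  qed
  have W: "V t \<in> W12" if t: "t > 0" for t
  proof -
    have "V t \<in> L2" "v t \<in> L2" using toleb[OF Vm(1) V2(1)] toleb[OF Vm(2) v2(1)] t by auto
    then show ?thesis unfolding W12_def using wd[OF t] by blast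
  qed
  define n where "n t = (\<integral>x. (V t x)\<^sup>2 \<partial>lborel) + (\<integral>x. (v t x)\<^sup>2 \<partial>lborel)" for t
  have sqm: "(\<lambda>x. (q x)\<^sup>2) \<in> borel_measurable borel" if "q \<in> borel_measurable borel" for q :: "real \<Rightarrow> real"
    using that by measurable
  have norm_eq: "(W12_norm (V t))\<^sup>2 = n t" if t: "t > 0" for t
    unfolding W12_norm_eq[OF wd[OF t]] n_def
    using integrable_lborel_lebesgue(2)[OF sqm[OF Vm(1)]] integrable_lborel_lebesgue(2)[OF sqm[OF Vm(2)]] by simp
  have nm: "n \<in> borel_measurable borel"
  proof -
    have "(\<lambda>(t, x). (V t x)\<^sup>2) \<in> borel_measurable (borel \<Otimes>\<^sub>M lborel)"
      "(\<lambda>(t, x). (v t x)\<^sup>2) \<in> borel_measurable (borel \<Otimes>\<^sub>M lborel)"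
      unfolding V_def v_def by measurable
    then show ?thesis unfolding n_def[abs_def]
      by (intro borel_measurable_add lborel.borel_measurable_lebesgue_integral)
  qed
  have n_le: "n t \<le> (2 * C\<^sup>2 * (sqrt T * \<kappa>) + 4 * B\<^sup>2 + 4 * K2\<^sup>2) + 2 * C\<^sup>2 * \<kappa> * (1 / sqrt t)" if t: "t \<in> {0<..<T}" for t
  proof -
    have s: "sqrt t > 0" "sqrt t \<le> sqrt T" "t > 0" using t by auto
    have "(\<integral>x. (V t x)\<^sup>2 \<partial>lborel) \<le> 2 * C\<^sup>2 * (sqrt t * \<kappa>) + 4 * B\<^sup>2"
      using V2(2)[OF s(1) s(3)] by (simp add: \<kappa>_def)
    moreover have "2 * C\<^sup>2 * (sqrt t * \<kappa>) \<le> 2 * C\<^sup>2 * (sqrt T * \<kappa>)"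
      using s \<kappa> by (intro mult_left_mono mult_right_mono) auto
    moreover have "(\<integral>x. (v t x)\<^sup>2 \<partial>lborel) \<le> 2 * (C / sqrt t)\<^sup>2 * (sqrt t * \<kappa>) + 4 * K2\<^sup>2"
      using v2(2)[OF s(1) s(3)] by (simp add: \<kappa>_def)
    moreover have "2 * (C / sqrt t)\<^sup>2 * (sqrt t * \<kappa>) = 2 * C\<^sup>2 * \<kappa> * (1 / sqrt t)"
      using s by (simp add: power2_eq_square field_simps)
    ultimately show ?thesis unfolding n_def by linarith
  qed
  have nnn: "0 \<le> n t" for t unfolding n_def by simp
  have iT: "integrable lborel (\<lambda>t. indicator {0<..<T} t :: real)" by (rule integrable_real_indicator) (use T in auto)
  have norm_int: "integrable (lebesgue_on {0<..<T}) (\<lambda>t. (W12_norm (V t))\<^sup>2)"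
  proof -
    let ?a = "2 * C\<^sup>2 * (sqrt T * \<kappa>) + 4 * B\<^sup>2 + 4 * K2\<^sup>2" and ?b = "2 * C\<^sup>2 * \<kappa>"
    have m: "(\<lambda>t. indicator {0<..<T} t * n t) \<in> borel_measurable borel" using nm by measurable
    have "integrable lborel (\<lambda>t. ?a * indicator {0<..<T} t + ?b * (indicator {0<..<T} t * (1 / sqrt t)))"
      by (intro Bochner_Integration.integrable_add integrable_mult_right iT integrable_inverse_sqrt T)
    then have "integrable lborel (\<lambda>t. indicator {0<..<T} t * n t)"
    proof (rule Bochner_Integration.integrable_bound)
      show "AE t in lborel. norm (indicator {0<..<T} t * n t) \<le> norm (?a * indicator {0<..<T} t + ?b * (indicator {0<..<T} t * (1 / sqrt t)))"
      proof (rule AE_I2)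
        fix t
        show "norm (indicator {0<..<T} t * n t) \<le> norm (?a * indicator {0<..<T} t + ?b * (indicator {0<..<T} t * (1 / sqrt t)))"
        proof (cases "t \<in> {0<..<T}")
          case True
          then have "norm (indicator {0<..<T} t * n t) = n t" using nnn[of t] by simp
          also have "\<dots> \<le> ?a + ?b * (1 / sqrt t)" by (rule n_le[OF True])
          also have "\<dots> \<le> \<bar>?a + ?b * (1 / sqrt t)\<bar>" by (rule abs_ge_self)
          finally show ?thesis using True by simp
        qed simp
      qed
    qed (use m in simp)
    then have "integrable lebesgue (\<lambda>t. indicator {0<..<T} t *\<^sub>R n t)" using integrable_lborel_lebesgue(1)[OF m] by simp
    then have "integrable (lebesgue_on {0<..<T}) n" by (subst integrable_restrict_space) auto
    then show ?thesis
      by (rule Bochner_Integration.integrable_cong[OF refl, THEN iffD2, rotated]) (auto simp: norm_eq)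
  qed
  \<comment> \<open>Rounding strictly upwards keeps the sampled time positive and to the right of t,
    so V is in \<open>W12\<close> there and the factor 1/sqrt is at most its value at t. Only
    finitely many grid values occur on (0,T).\<close>
  define \<tau> where "\<tau> k t = real_of_int (\<lfloor>real (Suc k) * t\<rfloor> + 1) / real (Suc k)" for k t
  have \<tau>: "t < \<tau> k t" "\<tau> k t \<le> t + inverse (real (Suc k))" for k t
  proof -
    have "real (Suc k) * t < real_of_int (\<lfloor>real (Suc k) * t\<rfloor> + 1)" by linarith
    then show "t < \<tau> k t" by (simp add: \<tau>_def pos_less_divide_eq mult.commute)
    have "real_of_int (\<lfloor>real (Suc k) * t\<rfloor> + 1) \<le> real (Suc k) * t + 1" by linarith
    then have "\<tau> k t \<le> (real (Suc k) * t + 1) / real (Suc k)" unfolding \<tau>_def by (rule divide_right_mono) simp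
    also have "\<dots> = t + inverse (real (Suc k))"
      by (simp only: add_divide_distrib nonzero_mult_div_cancel_left[OF of_nat_neq_0] inverse_eq_divide)
    finally show "\<tau> k t \<le> t + inverse (real (Suc k))" .
  qed
  have \<tau>lim: "(\<lambda>k. \<tau> k t) \<longlonglongrightarrow> t" for t
  proof (rule tendsto_sandwich[OF _ _ tendsto_const])
    show "(\<lambda>k. t + inverse (real (Suc k))) \<longlonglongrightarrow> t"
      using tendsto_add[OF tendsto_const[of t] LIMSEQ_inverse_real_of_nat] by simp
  qed (use \<tau> in \<open>auto intro!: always_eventually less_imp_le\<close>)
  have simple: "simple_function (lebesgue_on {0<..<T}) (\<lambda>t. V (\<tau> k t))" for k
  proof (rule simple_function_compose1[where g=V], rule simple_function_borel_measurable)
    have "\<tau> k \<in> borel_measurable borel" unfolding \<tau>_def[abs_def] by measurable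
    then show "\<tau> k \<in> borel_measurable (lebesgue_on {0<..<T})"
      by (intro measurable_restrict_space1 measurable_completion) simp
    have "\<tau> k ` {0<..<T} \<subseteq> (\<lambda>i. real_of_int (i + 1) / real (Suc k)) ` {0..\<lfloor>real (Suc k) * T\<rfloor>}"
    proof
      fix y assume "y \<in> \<tau> k ` {0<..<T}"
      then obtain t where t: "t \<in> {0<..<T}" "y = \<tau> k t" by auto
      have "0 \<le> real (Suc k) * t" "real (Suc k) * t \<le> real (Suc k) * T" using t(1) by (auto intro: mult_left_mono)
      then have "\<lfloor>real (Suc k) * t\<rfloor> \<in> {0..\<lfloor>real (Suc k) * T\<rfloor>}" by (auto intro: floor_mono)
      then show "y \<in> (\<lambda>i. real_of_int (i + 1) / real (Suc k)) ` {0..\<lfloor>real (Suc k) * T\<rfloor>}"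
        using t(2) by (auto simp: \<tau>_def)
    qed
    then have "finite (\<tau> k ` {0<..<T})" by (rule finite_subset) simp
    then show "finite (\<tau> k ` space (lebesgue_on {0<..<T}))" by simp
  qed
  have conv: "(\<lambda>k. W12_norm (\<lambda>x. V (\<tau> k t) x - V t x)) \<longlonglongrightarrow> 0" if t: "t > 0" for t
  proof -
    have tp: "\<tau> k t > 0" "t \<le> \<tau> k t" "\<tau> k t \<le> t + 1" for k
    proof -
      have "inverse (real (Suc k)) \<le> 1" by (simp add: field_simps)
      then show "\<tau> k t > 0" "t \<le> \<tau> k t" "\<tau> k t \<le> t + 1" using \<tau>(1)[of t k] \<tau>(2)[of k t] t by linarith+
    qed
    \<comment> \<open>All sampled times lie in [t, t + 1], so the scale sqrt (t + 1) gives one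
      exponential majorant for the dominated convergence in k.\<close>
    let ?s = "sqrt (t + 1)"
    have s: "?s > 0" using t by simp
    have ex: "exp (- \<bar>x / sqrt r\<bar>) \<le> exp (- \<bar>x / ?s\<bar>)" if "r > 0" "r \<le> t + 1" for r x
    proof -
      have "\<bar>x\<bar> / ?s \<le> \<bar>x\<bar> / sqrt r" using that by (intro divide_left_mono) auto
      then show ?thesis using that t by (simp add: abs_divide)
    qed
    \<comment> \<open>E cancels in V (\<tau> k t) - V t. Both values of F are compared with the same
      limit, Fu or Fl according to the sign of x, so their difference inherits the decay.\<close>
    have Fd: "\<bar>F (x / sqrt r) - (if x \<le> 0 then Fu else Fl)\<bar> \<le> C * exp (- \<bar>x / ?s\<bar>)" if r: "r > 0" "r \<le> t + 1" for r x
    proof -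
      have "\<bar>F (x / sqrt r) - (if x \<le> 0 then Fu else Fl)\<bar> \<le> C * exp (- \<bar>x / sqrt r\<bar>)"
        using Fl[of "x / sqrt r"] Fr[of "x / sqrt r"] r by (auto simp: divide_nonpos_nonneg)
      also have "\<dots> \<le> C * exp (- \<bar>x / ?s\<bar>)" using C ex[OF r] by (intro mult_left_mono)
      finally show ?thesis .
    qed
    have Nd: "\<bar>N (x / sqrt r) / sqrt r\<bar> \<le> C / sqrt t * exp (- \<bar>x / ?s\<bar>)" if r: "t \<le> r" "r \<le> t + 1" for r x
    proof -
      have "\<bar>N (x / sqrt r) / sqrt r\<bar> = \<bar>N (x / sqrt r)\<bar> / sqrt r" using t r by (simp add: abs_divide)
      also have "\<dots> \<le> (C * exp (- \<bar>x / ?s\<bar>)) / sqrt t"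
        using t r C order_trans[OF Nb mult_left_mono[OF ex[of r x] C]] by (intro frac_le) auto
      finally show ?thesis by simp
    qed
    define b where "b A x = 4 * A\<^sup>2 * exp (- 2 * \<bar>x / ?s\<bar>)" for A x :: real
    have bi: "integrable lborel (b A)" for A
      unfolding b_def[abs_def] by (intro integrable_mult_right exp_abs_scaled(1) s)
    have sq: "z\<^sup>2 \<le> b A x" if "\<bar>z\<bar> \<le> 2 * (A * exp (- \<bar>x / ?s\<bar>))" for z A x
    proof -
      have "z\<^sup>2 \<le> (2 * (A * exp (- \<bar>x / ?s\<bar>)))\<^sup>2"
        using that by (rule abs_le_square_iff[THEN iffD1, OF order_trans[OF _ abs_ge_self]])
      also have "\<dots> = b A x" by (simp add: b_def power2_eq_square exp_add[symmetric])
      finally show ?thesis .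
    qed
    have xc: "(\<lambda>k. q (x / sqrt (\<tau> k t))) \<longlonglongrightarrow> q (x / sqrt t)" if "\<And>y. isCont q y" for q :: "real \<Rightarrow> real" and x
      using t by (intro isCont_tendsto_compose[OF that] tendsto_intros \<tau>lim) auto
    have 1: "(\<lambda>k. \<integral>x. (V (\<tau> k t) x - V t x)\<^sup>2 \<partial>lborel) \<longlonglongrightarrow> (\<integral>x. 0 \<partial>(lborel :: real measure))"
    proof (rule integral_dominated_convergence[where w="b C"])
      show "AE x in lborel. (\<lambda>k. (V (\<tau> k t) x - V t x)\<^sup>2) \<longlonglongrightarrow> 0"
      proof (rule AE_I2)
        fix x
        have "(\<lambda>k. (F (x / sqrt (\<tau> k t)) - F (x / sqrt t))\<^sup>2) \<longlonglongrightarrow> (F (x / sqrt t) - F (x / sqrt t))\<^sup>2"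
          by (intro tendsto_intros xc Fc)
        then show "(\<lambda>k. (V (\<tau> k t) x - V t x)\<^sup>2) \<longlonglongrightarrow> 0" by (simp add: V_def)
      qed
      show "AE x in lborel. norm ((V (\<tau> k t) x - V t x)\<^sup>2) \<le> b C x" for k
      proof (rule AE_I2)
        fix x
        have "\<bar>V (\<tau> k t) x - V t x\<bar> \<le> 2 * (C * exp (- \<bar>x / ?s\<bar>))"
          unfolding V_def using Fd[OF tp(1,3), of x k] Fd[of t x] t by (simp add: abs_le_iff)
        then show "norm ((V (\<tau> k t) x - V t x)\<^sup>2) \<le> b C x" using sq by simp
      qed
    qed (use bi Vm in measurable)
    have 2: "(\<lambda>k. \<integral>x. (v (\<tau> k t) x - v t x)\<^sup>2 \<partial>lborel) \<longlonglongrightarrow> (\<integral>x. 0 \<partial>(lborel :: real measure))"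
    proof (rule integral_dominated_convergence[where w="b (C / sqrt t)"])
      show "AE x in lborel. (\<lambda>k. (v (\<tau> k t) x - v t x)\<^sup>2) \<longlonglongrightarrow> 0"
      proof (rule AE_I2)
        fix x
        have "(\<lambda>k. (- N (x / sqrt (\<tau> k t)) / sqrt (\<tau> k t) - (- N (x / sqrt t) / sqrt t))\<^sup>2) \<longlonglongrightarrow>
            (- N (x / sqrt t) / sqrt t - (- N (x / sqrt t) / sqrt t))\<^sup>2"
          using t by (intro tendsto_intros xc Nc \<tau>lim) auto
        then show "(\<lambda>k. (v (\<tau> k t) x - v t x)\<^sup>2) \<longlonglongrightarrow> 0" by (simp add: v_def)
      qed
      show "AE x in lborel. norm ((v (\<tau> k t) x - v t x)\<^sup>2) \<le> b (C / sqrt t) x" for k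
      proof (rule AE_I2)
        fix x
        have "\<bar>v (\<tau> k t) x - v t x\<bar> \<le> \<bar>N (x / sqrt (\<tau> k t)) / sqrt (\<tau> k t)\<bar> + \<bar>N (x / sqrt t) / sqrt t\<bar>"
          unfolding v_def minus_divide_left[symmetric] by linarith
        also have "\<dots> \<le> 2 * (C / sqrt t * exp (- \<bar>x / ?s\<bar>))"
          using Nd[OF tp(2,3), of x k] Nd[of t x] by linarith
        finally show "norm ((v (\<tau> k t) x - v t x)\<^sup>2) \<le> b (C / sqrt t) x" using sq by simp
      qed
    qed (use bi Vm in measurable)
    have eq: "W12_norm (\<lambda>x. V (\<tau> k t) x - V t x) =
        sqrt ((\<integral>x. (V (\<tau> k t) x - V t x)\<^sup>2 \<partial>lborel) + (\<integral>x. (v (\<tau> k t) x - v t x)\<^sup>2 \<partial>lborel))" for k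
    proof -
      have "(\<lambda>x. V (\<tau> k t) x - V t x) \<in> borel_measurable borel" "(\<lambda>x. v (\<tau> k t) x - v t x) \<in> borel_measurable borel"
        using Vm by measurable
      then show ?thesis
        unfolding W12_norm_eq[OF has_weak_deriv_diff[OF wd[OF tp(1)] wd[OF t]]]
        by (simp only: integrable_lborel_lebesgue(2) sqm)
    qed
    have "(\<lambda>k. sqrt ((\<integral>x. (V (\<tau> k t) x - V t x)\<^sup>2 \<partial>lborel) + (\<integral>x. (v (\<tau> k t) x - v t x)\<^sup>2 \<partial>lborel)))
        \<longlonglongrightarrow> sqrt ((\<integral>x. 0 \<partial>(lborel :: real measure)) + (\<integral>x. 0 \<partial>(lborel :: real measure)))"
      by (intro tendsto_intros 1 2)
    then show ?thesis by (simp add: eq)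
  qed
  have "V \<in> L2_W12 T" unfolding L2_W12_def
  proof (intro CollectI conjI ballI exI[of _ "\<lambda>k t. V (\<tau> k t)"] allI)
    show "V t \<in> W12" if "t \<in> {0<..<T}" for t using W that by simp
    show "simple_function (lebesgue_on {0<..<T}) (\<lambda>t. V (\<tau> k t))" for k by (rule simple)
    show "V (\<tau> k t) \<in> W12" if "t \<in> {0<..<T}" for k t
      using W[of "\<tau> k t"] \<tau>(1)[of t k] that by simp
    show "AE t in lebesgue_on {0<..<T}. (\<lambda>k. W12_norm (\<lambda>x. V (\<tau> k t) x - V t x)) \<longlonglongrightarrow> 0"
      by (rule AE_I2) (simp add: conv)
    show "integrable (lebesgue_on {0<..<T}) (\<lambda>t. (W12_norm (V t))\<^sup>2)" by (rule norm_int)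
  qed
  then show ?thesis by (simp add: V_def[abs_def])
qed

section \<open>Assembly of existence, uniqueness and similarity form\<close>

theorem theorem5p5:
  fixes \<phi> what :: "real \<Rightarrow> real" and \<epsilon> T U0 V0 :: real
  assumes "C2_on UNIV \<phi>"
    and "strict_mono_on {0..} \<phi>" and "strict_mono_on {0..} (deriv \<phi>)"
    and "\<And>s. s > 0 \<Longrightarrow> \<phi> s > 0"
    and "\<phi> 0 = 0" and "deriv \<phi> 0 = 0"
    and "(\<integral>\<^sup>+ s\<in>{0<..<1}. ennreal (deriv \<phi> s / s) \<partial>lborel) < \<infinity>"
    and "(\<integral>\<^sup>+ s\<in>{1<..}. ennreal (deriv \<phi> s / s) \<partial>lborel) = \<infinity>"
    and "smooth what" and "\<And>x. x < -1 \<Longrightarrow> what x = U0" and "\<And>x. x > 1 \<Longrightarrow> what x = - V0"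
    and "\<epsilon> > 0" and "T > 0" and "U0 > 0" and "V0 > 0"
  shows "\<exists>w. weak_solution (Dfun \<phi> \<epsilon>) (step_data U0 V0) what T w \<and>
           (\<forall>w'. weak_solution (Dfun \<phi> \<epsilon>) (step_data U0 V0) what T w' \<longrightarrow>
                 (AE p in lebesgue_on (QT T). w' p = w p)) \<and>
           (\<exists>f a. (\<forall>(x, t)\<in>QT T. w (x, t) = f (x / sqrt t)) \<and>
                  free_boundary T w (\<lambda>t. a * sqrt t) \<and>
                  selfsimilar_system \<phi> \<epsilon> U0 V0 f a)"
proof -
  interpret degenerate_diffusion \<phi> \<epsilon>
    by unfold_locales (fact assms)+
  let ?D = "Dfun \<phi> \<epsilon>"
  have T: "T > 0" and V0: "- V0 < 0" and U0: "0 < U0" using assms by auto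
  have d0: "Dfun_deriv \<phi> \<epsilon> 0 = 0" by (simp add: Dfun_deriv_def deriv_phi0)
  obtain f N a C where frange: "\<And>y. f y \<in> {-V0<..<U0}" and anti: "\<And>x y. x < y \<Longrightarrow> f y < f x"
    and fa: "f a = 0" and fc: "\<And>y. isCont f y"
    and lim: "(f \<longlongrightarrow> U0) at_bot" "(f \<longlongrightarrow> - V0) at_top"
    and df: "\<And>y. y \<noteq> a \<Longrightarrow> DERIV f y :> - N y / Dfun_deriv \<phi> \<epsilon> (f y)"
    and dN: "\<And>y. y \<noteq> a \<Longrightarrow> DERIV N y :> (y / 2) * (- N y / Dfun_deriv \<phi> \<epsilon> (f y))"
    and Npos: "\<And>y. N y > 0" and Nc: "\<And>y. isCont N y"
    and dD: "\<And>y. DERIV (\<lambda>y. ?D (f y)) y :> - N y"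
    and Q: "\<And>y. DERIV (\<lambda>y. y * f y - 2 * N y) y :> f y"
    and C: "C \<ge> 0" and N_le: "\<And>y. N y \<le> C * exp (- \<bar>y\<bar>)"
    and Fl: "\<And>y. y \<le> 0 \<Longrightarrow> \<bar>?D (f y) - ?D U0\<bar> \<le> C * exp (- \<bar>y\<bar>)"
    and Fr: "\<And>y. y \<ge> 0 \<Longrightarrow> \<bar>?D (f y) - ?D (- V0)\<bar> \<le> C * exp (- \<bar>y\<bar>)"
    by (rule similarity_profile[OF V0 U0 DERIV_Dfun isCont_Dfun_deriv d0 Dfun_deriv_pos]) (assumption, rule that)
  have fb: "\<bar>f y\<bar> \<le> U0 + V0" for y using frange[of y] U0 V0 by auto
  have Nb: "\<bar>N y\<bar> \<le> C * exp (- \<bar>y\<bar>)" for y using Npos[of y] N_le[of y] by simp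
  have NC: "\<bar>N y\<bar> \<le> C" for y
    by (rule order_trans[OF Nb]) (use mult_left_mono[OF _ C, of "exp (- \<bar>y\<bar>)" 1] in simp)
  define w where "w p = f (fst p / sqrt (snd p))" for p :: "real \<times> real"
  define g where "g p = - N (fst p / sqrt (snd p)) / sqrt (snd p)" for p :: "real \<times> real"
  define V where "V t x = ?D (f (x / sqrt t)) - ?D (what x)" for t x
  have quot: "continuous_on (QT T) (\<lambda>p. fst p / sqrt (snd p))"
    by (intro continuous_intros) (auto simp: QT_def)
  have contm: "q \<in> borel_measurable (lebesgue_on (QT T))" if "continuous_on (QT T) q" for q :: "real \<times> real \<Rightarrow> real"
    using that QT_sets(2) by (rule continuous_imp_measurable_on_sets_lebesgue)
  have wm: "w \<in> borel_measurable (lebesgue_on (QT T))" unfolding w_def[abs_def]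
    by (intro contm continuous_on_compose2[OF _ quot, of UNIV f] continuous_at_imp_continuous_on ballI fc) auto
  have gm: "g \<in> borel_measurable (lebesgue_on (QT T))" unfolding g_def[abs_def]
    by (intro contm continuous_intros continuous_on_compose2[OF _ quot, of UNIV N] continuous_at_imp_continuous_on[of UNIV N] ballI Nc)
      (auto simp: QT_def)
  have w_inf: "w \<in> L_infinity (QT T)"
    unfolding L_infinity_def using wm fb by (auto simp: w_def intro!: exI[of _ "U0 + V0"])
  \<comment> \<open>\<open>profile_L2_W12\<close> is applied to F = D(f) and E = D(what); E is
    constant on either side of [-1,1], with the limits of F as values.\<close>
  have V: "V \<in> L2_W12 T" unfolding V_def[abs_def]
  proof (rule profile_L2_W12[OF T dD Nc C Nb _ _ _ _ Fl Fr])
    show "DERIV (\<lambda>x. ?D (what x)) x :> Dfun_deriv \<phi> \<epsilon> (what x) * deriv what x" for x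
      by (rule DERIV_chain2[OF DERIV_Dfun smooth_isCont(3)]) (fact assms)
    show "isCont (\<lambda>x. Dfun_deriv \<phi> \<epsilon> (what x) * deriv what x) x" for x
      by (intro continuous_intros isCont_o2[OF _ isCont_Dfun_deriv] smooth_isCont) (fact assms)+
  qed (use assms(10,11) in auto)
  have wV: "AE p in lebesgue_on (QT T). ?D (w p) = ?D (what (fst p)) + V (snd p) (fst p)"
    by (rule AE_I2) (simp add: w_def V_def)
  have wd: "has_weak_deriv (\<lambda>x. ?D (w (x, t))) (\<lambda>x. g (x, t))" if t: "t > 0" for t
  proof (rule has_weak_deriv_C1)
    fix x
    have "DERIV (\<lambda>x. ?D (f (x / sqrt t))) x :> - N (x / sqrt t) * (1 / sqrt t)"
      by (rule DERIV_chain2[OF dD]) (rule DERIV_cdivide[OF DERIV_ident])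
    then show "DERIV (\<lambda>x. ?D (w (x, t))) x :> g (x, t)" by (simp add: w_def g_def)
    show "isCont (\<lambda>x. g (x, t)) x"
      unfolding g_def using t by (auto intro!: continuous_intros isCont_o2[OF _ Nc])
  qed
  have wd_AE: "AE t in lebesgue_on {0<..<T}. has_weak_deriv (\<lambda>x. ?D (w (x, t))) (\<lambda>x. g (x, t))"
    by (rule AE_I2) (simp add: wd)
  have identity: "(\<integral>x. step_data U0 V0 x * \<Psi> (x, 0) \<partial>lebesgue) + (\<integral>p. w p * \<Psi>t p \<partial>lebesgue_on (QT T))
      = (\<integral>p. g p * \<Psi>x p \<partial>lebesgue_on (QT T))"
    if \<Psi>: "C1_strip T \<Psi> \<Psi>x \<Psi>t" "\<forall>x. \<Psi> (x, T) = 0" "\<exists>J>0. \<forall>x. \<forall>t\<in>{0..T}. \<bar>x\<bar> > J \<longrightarrow> \<Psi> (x, t) = 0"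
    for \<Psi> \<Psi>x \<Psi>t
  proof -
    obtain J where "J > 0" and J: "\<And>x t. t \<in> {0..T} \<Longrightarrow> \<bar>x\<bar> > J \<Longrightarrow> \<Psi> (x, t) = 0" using \<Psi>(3) by blast
    have "\<Psi> (x, T) = 0" for x using \<Psi>(2) by blast
    from selfsimilar_weak_identity[OF T fb fc NC Nc Q lim \<Psi>(1) this \<open>J > 0\<close> J]
    show ?thesis by (simp add: w_def g_def)
  qed
  \<comment> \<open>N is bounded by C, so on bounded x-intervals the flux is dominated by C / sqrt
    t, which is integrable in t. This supplies \<open>g2i\<close> of
    \<open>weak_solution_unique\<close>.\<close>
  have gi: "integrable (lebesgue_on (QT T)) (\<lambda>p. g p * indicator {-J..J} (fst p))" for J
  proof -
    let ?k = "\<lambda>p. C * (indicator {-J..J} (fst p) * (indicator {0<..<T} (snd p) * (1 / sqrt (snd p))))"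
    have k: "integrable lborel ?k"
      by (intro integrable_mult_right integrable_tensor[OF integrable_indicator_Icc integrable_inverse_sqrt[OF T]])
    then have "integrable lebesgue ?k" by (rule integrable_completion[THEN iffD2, rotated]) (use borel_measurable_integrable[OF k] in simp)
    then have "integrable (lebesgue_on (QT T)) ?k"
      by (subst integrable_restrict_space) (use QT_sets(2) integrable_mult_indicator[OF QT_sets(2)] in \<open>simp, blast\<close>)
    then show ?thesis
    proof (rule Bochner_Integration.integrable_bound)
      have "(\<lambda>p. indicator {-J..J} (fst p) :: real) \<in> borel_measurable (borel :: (real \<times> real) measure)"
        unfolding borel_prod[symmetric] by measurable
      then have "(\<lambda>p. indicator {-J..J} (fst p) :: real) \<in> borel_measurable (lebesgue_on (QT T))"
        by (intro measurable_restrict_space1 measurable_completion) simp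
      with gm show "(\<lambda>p. g p * indicator {-J..J} (fst p)) \<in> borel_measurable (lebesgue_on (QT T))"
        by (rule borel_measurable_times)
      show "AE p in lebesgue_on (QT T). norm (g p * indicator {-J..J} (fst p)) \<le> norm (?k p)"
      proof (rule AE_I2)
        fix p assume "p \<in> space (lebesgue_on (QT T))"
        then have t: "snd p > 0" "snd p < T" by (auto simp: QT_def)
        then have "\<bar>N (fst p / sqrt (snd p))\<bar> / sqrt (snd p) \<le> C / sqrt (snd p)" by (intro divide_right_mono NC) simp
        then show "norm (g p * indicator {-J..J} (fst p)) \<le> norm (?k p)"
          using t C by (auto simp: g_def indicator_def abs_mult)
      qed
    qed
  qed
  have "weak_solution ?D (step_data U0 V0) what T w"
    unfolding weak_solution_def using w_inf V wV gm wd_AE identity by blast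
  moreover have "AE p in lebesgue_on (QT T). w' p = w p"
    if "weak_solution ?D (step_data U0 V0) what T w'" for w'
    by (rule weak_solution_unique[OF T that w_inf V wV gm wd_AE identity gi])
  moreover have "\<forall>(x, t)\<in>QT T. w (x, t) = f (x / sqrt t)" by (simp add: w_def)
  moreover have "free_boundary T w (\<lambda>t. a * sqrt t)" unfolding free_boundary_def
  proof (intro ballI, clarify, intro conjI impI)
    fix x t assume "(x, t) \<in> QT T"
    then have s: "sqrt t > 0" by (simp add: QT_def)
    show "w (x, t) > 0" if "x < a * sqrt t"
      using anti[of "x / sqrt t" a] that s fa by (simp add: w_def pos_divide_less_eq)
    show "w (x, t) < 0" if "x > a * sqrt t"
      using anti[of a "x / sqrt t"] that s fa by (simp add: w_def pos_less_divide_eq)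
  qed
  moreover have "selfsimilar_system \<phi> \<epsilon> U0 V0 f a"
    by (rule selfsimilar_system_profile[OF anti fa fc lim df dN Nc])
  ultimately show ?thesis by blast
qed

end
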